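(* Let $C$ be the Cesàro operator on $L^2(0,1)$, $(Cf)(x)=\frac1x\int_0^x\frac{f(t)}{1-t}\,dt$ for $0<x<1$. Let $\mu$ be the measure on the circle $\partial D(1,1)=\{z\in\mathbb{C}:|z-1|=1\}$ given by $$d\mu(z)=\frac{\pi}{2}\,\frac{\operatorname{sech}^2(\pi m^{-1}(z))}{|z|^2}\,|dz|,$$ where $m(x)=\frac{1}{\frac12-ix}$ for $x\in(-\infty,\infty)$. Then $C$ is unitarily equivalent to the multiplication operator $M_zf=zf$ on $L^2(\mu)$.
   Context: $L^2(0,1)$ is the Hilbert space of complex-valued square-integrable functions on $(0,1)$ with respect to Lebesgue measure; $C$ is a bounded linear operator on it. $|dz|$ is arc length measure on $\partial D(1,1)$. The map $m$ is a bijection of $(-\infty,\infty)$ onto $\partial D(1,1)\setminus\{0\}$, and $m^{-1}$ denotes its inverse (the density of $\mu$ is thus defined except at the single point $z=0$). Equivalently, $\mu$ is the push-forward under $m$ of the measure $\frac{\pi}{2}\operatorname{sech}^2(\pi x)\,dx$ on $(-\infty,\infty)$. Two bounded operators $T_1$ on $\mathcal H_1$ and $T_2$ on $\mathcal H_2$ are unitarily equivalent if there is a surjective linear isometry $\Psi:\mathcal H_1\to\mathcal H_2$ with $\Psi T_1=T_2\Psi$. *)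

theory Defs
  imports "HOL-Analysis.Analysis"
begin

section \<open>Complex inner product spaces given by explicit carriers\<close>

text \<open>
  The library has no type of square-integrable functions for a measure that is given as a term, so
  Hilbert spaces are represented by records with an explicit carrier.
  The inner product is linear in the first argument.
\<close>

record 'v hspace =
  hcarrier :: "'v set"
  hadd :: "'v \<Rightarrow> 'v \<Rightarrow> 'v"
  hscale :: "complex \<Rightarrow> 'v \<Rightarrow> 'v"
  hinner :: "'v \<Rightarrow> 'v \<Rightarrow> complex"

definition hnorm :: "'v hspace \<Rightarrow> 'v \<Rightarrow> real" where
  "hnorm H v = sqrt (Re (hinner H v v))"

definition linear_map :: "'v hspace \<Rightarrow> 'w hspace \<Rightarrow> ('v \<Rightarrow> 'w) \<Rightarrow> bool" where
  "linear_map H K T \<longleftrightarrow>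
     (\<forall>v\<in>hcarrier H. T v \<in> hcarrier K) \<and>
     (\<forall>v\<in>hcarrier H. \<forall>w\<in>hcarrier H. T (hadd H v w) = hadd K (T v) (T w)) \<and>
     (\<forall>c. \<forall>v\<in>hcarrier H. T (hscale H c v) = hscale K c (T v))"

definition bounded_operator :: "'v hspace \<Rightarrow> ('v \<Rightarrow> 'v) \<Rightarrow> bool" where
  "bounded_operator H T \<longleftrightarrow>
     linear_map H H T \<and> (\<exists>B. \<forall>v\<in>hcarrier H. hnorm H (T v) \<le> B * hnorm H v)"

definition surjective_linear_isometry :: "'v hspace \<Rightarrow> 'w hspace \<Rightarrow> ('v \<Rightarrow> 'w) \<Rightarrow> bool" where
  "surjective_linear_isometry H K \<Psi> \<longleftrightarrow>
     linear_map H K \<Psi> \<and>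
     (\<forall>v\<in>hcarrier H. hnorm K (\<Psi> v) = hnorm H v) \<and>
     \<Psi> ` hcarrier H = hcarrier K"

text \<open>
  Unitary equivalence is a relation between bounded operators; their boundedness is part of the
  definition.
\<close>

definition unitarily_equivalent ::
    "'v hspace \<Rightarrow> ('v \<Rightarrow> 'v) \<Rightarrow> 'w hspace \<Rightarrow> ('w \<Rightarrow> 'w) \<Rightarrow> bool" where
  "unitarily_equivalent H T K S \<longleftrightarrow>
     bounded_operator H T \<and> bounded_operator K S \<and>
     (\<exists>\<Psi>. surjective_linear_isometry H K \<Psi> \<and> (\<forall>v\<in>hcarrier H. \<Psi> (T v) = S (\<Psi> v)))"


section \<open>The Hilbert space \<open>L\<^sup>2(M)\<close>\<close>

definition square_integrable :: "'a measure \<Rightarrow> ('a \<Rightarrow> complex) set" where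
  "square_integrable M = {f \<in> borel_measurable M. integrable M (\<lambda>x. (cmod (f x))\<^sup>2)}"

definition ae_rel :: "'a measure \<Rightarrow> (('a \<Rightarrow> complex) \<times> ('a \<Rightarrow> complex)) set" where
  "ae_rel M = {(f, g). f \<in> square_integrable M \<and> g \<in> square_integrable M \<and> (AE x in M. f x = g x)}"

definition ae_class :: "'a measure \<Rightarrow> ('a \<Rightarrow> complex) \<Rightarrow> ('a \<Rightarrow> complex) set" where
  "ae_class M f = ae_rel M `` {f}"

text \<open>
  The operations on classes are defined by unions over all representatives.  All the members of
  such a union agree, which the lemmas below confirm, so no representative is chosen.
\<close>

definition L2 :: "'a measure \<Rightarrow> ('a \<Rightarrow> complex) set hspace" where
  "L2 M =
    \<lparr> hcarrier = square_integrable M // ae_rel M,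
      hadd = (\<lambda>F G. \<Union>f\<in>F. \<Union>g\<in>G. ae_class M (\<lambda>x. f x + g x)),
      hscale = (\<lambda>c F. \<Union>f\<in>F. ae_class M (\<lambda>x. c * f x)),
      hinner = (\<lambda>F G. the_elem (\<Union>f\<in>F. \<Union>g\<in>G. {\<integral>x. f x * cnj (g x) \<partial>M})) \<rparr>"

definition L2_lift :: "'a measure \<Rightarrow> (('a \<Rightarrow> complex) \<Rightarrow> ('a \<Rightarrow> complex))
    \<Rightarrow> ('a \<Rightarrow> complex) set \<Rightarrow> ('a \<Rightarrow> complex) set" where
  "L2_lift M \<phi> F = (\<Union>f\<in>F. ae_class M (\<phi> f))"

lemma square_integrable_add:
  assumes "f \<in> square_integrable M" "g \<in> square_integrable M"
  shows "(\<lambda>x. f x + g x) \<in> square_integrable M"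
proof -
  have [measurable]: "f \<in> borel_measurable M" "g \<in> borel_measurable M"
    and i: "integrable M (\<lambda>x. (cmod (f x))\<^sup>2)" "integrable M (\<lambda>x. (cmod (g x))\<^sup>2)"
    using assms by (auto simp: square_integrable_def)
  have bound: "(cmod (f x + g x))\<^sup>2 \<le> 2 * (cmod (f x))\<^sup>2 + 2 * (cmod (g x))\<^sup>2" for x
  proof -
    have "(cmod (f x + g x))\<^sup>2 \<le> (cmod (f x) + cmod (g x))\<^sup>2"
      by (intro power_mono norm_triangle_ineq norm_ge_zero)
    also have "\<dots> \<le> 2 * (cmod (f x))\<^sup>2 + 2 * (cmod (g x))\<^sup>2"
      using sum_squares_bound[of "cmod (f x)" "cmod (g x)"] unfolding power2_sum by linarith
    finally show ?thesis .
  qed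
  have "integrable M (\<lambda>x. (cmod (f x + g x))\<^sup>2)"
  proof (rule Bochner_Integration.integrable_bound)
    show "integrable M (\<lambda>x. 2 * (cmod (f x))\<^sup>2 + 2 * (cmod (g x))\<^sup>2)"
      by (intro Bochner_Integration.integrable_add integrable_mult_right i)
    show "AE x in M. norm ((cmod (f x + g x))\<^sup>2) \<le> norm (2 * (cmod (f x))\<^sup>2 + 2 * (cmod (g x))\<^sup>2)"
      by (rule AE_I2) (use bound in simp)
    show "(\<lambda>x. (cmod (f x + g x))\<^sup>2) \<in> borel_measurable M" by measurable
  qed
  then show ?thesis by (simp add: square_integrable_def)
qed

lemma square_integrable_scale:
  assumes "f \<in> square_integrable M"
  shows "(\<lambda>x. c * f x) \<in> square_integrable M"
  using assms by (auto simp: square_integrable_def norm_mult power_mult_distrib)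

lemma equiv_ae_rel: "equiv (square_integrable M) (ae_rel M)"
  by (rule equivI) (auto simp: ae_rel_def refl_on_def sym_def trans_def)

lemma mem_ae_class_iff:
  "g \<in> ae_class M f \<longleftrightarrow>
     f \<in> square_integrable M \<and> g \<in> square_integrable M \<and> (AE x in M. f x = g x)"
  by (auto simp: ae_class_def ae_rel_def)

lemma ae_class_nonempty: "f \<in> square_integrable M \<Longrightarrow> ae_class M f \<noteq> {}"
  using mem_ae_class_iff[of f M f] by auto

lemma ae_class_eqI:
  assumes "f \<in> square_integrable M" "g \<in> square_integrable M" "AE x in M. f x = g x"
  shows "ae_class M f = ae_class M g"
  unfolding ae_class_def
  by (rule equiv_class_eq[OF equiv_ae_rel]) (use assms in \<open>auto simp: ae_rel_def\<close>)

lemma hcarrier_L2: "hcarrier (L2 M) = ae_class M ` square_integrable M"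
  by (auto simp: L2_def ae_class_def quotient_def)

lemma L2_lift_ae_class:
  assumes f: "f \<in> square_integrable M"
    and ext: "\<And>g. g \<in> square_integrable M \<Longrightarrow> \<phi> g \<in> square_integrable M"
    and resp: "\<And>g h. g \<in> square_integrable M \<Longrightarrow> h \<in> square_integrable M \<Longrightarrow>
                 AE x in M. g x = h x \<Longrightarrow> AE x in M. \<phi> g x = \<phi> h x"
  shows "L2_lift M \<phi> (ae_class M f) = ae_class M (\<phi> f)"
proof -
  have "ae_class M (\<phi> g) = ae_class M (\<phi> f)" if "g \<in> ae_class M f" for g
  proof (rule ae_class_eqI[symmetric])
    have g: "g \<in> square_integrable M" and fg: "AE x in M. f x = g x"
      using that by (simp_all add: mem_ae_class_iff)
    show "AE x in M. \<phi> f x = \<phi> g x" by (rule resp[OF f g fg])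
    show "\<phi> f \<in> square_integrable M" "\<phi> g \<in> square_integrable M" by (rule ext[OF f], rule ext[OF g])
  qed
  then have "L2_lift M \<phi> (ae_class M f) = (\<Union>g\<in>ae_class M f. ae_class M (\<phi> f))"
    unfolding L2_lift_def by (intro SUP_cong refl)
  then show ?thesis using ae_class_nonempty[OF f] by simp
qed

lemma hscale_ae_class:
  assumes "f \<in> square_integrable M"
  shows "hscale (L2 M) c (ae_class M f) = ae_class M (\<lambda>x. c * f x)"
proof -
  have "hscale (L2 M) c (ae_class M f) = L2_lift M (\<lambda>f x. c * f x) (ae_class M f)"
    by (simp add: L2_def L2_lift_def)
  also have "\<dots> = ae_class M (\<lambda>x. c * f x)"
    by (rule L2_lift_ae_class[OF assms square_integrable_scale]) auto
  finally show ?thesis .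
qed

lemma hadd_ae_class:
  assumes "f \<in> square_integrable M" "g \<in> square_integrable M"
  shows "hadd (L2 M) (ae_class M f) (ae_class M g) = ae_class M (\<lambda>x. f x + g x)"
proof -
  have ne: "ae_class M f \<noteq> {}" "ae_class M g \<noteq> {}"
    using assms by (simp_all add: ae_class_nonempty)
  have eq: "ae_class M (\<lambda>x. f' x + g' x) = ae_class M (\<lambda>x. f x + g x)"
    if "f' \<in> ae_class M f" "g' \<in> ae_class M g" for f' g'
  proof (rule ae_class_eqI)
    have "AE x in M. f x = f' x" "AE x in M. g x = g' x"
      using that by (simp_all add: mem_ae_class_iff)
    then show "AE x in M. f' x + g' x = f x + g x" by eventually_elim simp
    show "(\<lambda>x. f' x + g' x) \<in> square_integrable M" "(\<lambda>x. f x + g x) \<in> square_integrable M"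
      using that by (simp_all add: mem_ae_class_iff square_integrable_add)
  qed
  have "hadd (L2 M) (ae_class M f) (ae_class M g) =
      (\<Union>f'\<in>ae_class M f. \<Union>g'\<in>ae_class M g. ae_class M (\<lambda>x. f' x + g' x))"
    by (simp add: L2_def)
  also have "\<dots> = (\<Union>f'\<in>ae_class M f. \<Union>g'\<in>ae_class M g. ae_class M (\<lambda>x. f x + g x))"
    by (intro SUP_cong refl eq)
  also have "\<dots> = ae_class M (\<lambda>x. f x + g x)" using ne by simp
  finally show ?thesis .
qed

lemma hinner_ae_class:
  assumes "f \<in> square_integrable M" "g \<in> square_integrable M"
  shows "hinner (L2 M) (ae_class M f) (ae_class M g) = (\<integral>x. f x * cnj (g x) \<partial>M)"
proof -
  have ne: "ae_class M f \<noteq> {}" "ae_class M g \<noteq> {}"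
    using assms by (simp_all add: ae_class_nonempty)
  have eq: "(\<integral>x. f' x * cnj (g' x) \<partial>M) = (\<integral>x. f x * cnj (g x) \<partial>M)"
    if "f' \<in> ae_class M f" "g' \<in> ae_class M g" for f' g'
  proof (rule integral_cong_AE)
    have "AE x in M. f x = f' x" "AE x in M. g x = g' x"
      using that by (simp_all add: mem_ae_class_iff)
    then show "AE x in M. f' x * cnj (g' x) = f x * cnj (g x)" by eventually_elim simp
    have [measurable]: "f \<in> borel_measurable M" "f' \<in> borel_measurable M"
      "g \<in> borel_measurable M" "g' \<in> borel_measurable M"
      using that by (simp_all add: mem_ae_class_iff square_integrable_def)
    have [measurable]: "cnj \<in> borel_measurable borel"
      by (intro borel_measurable_continuous_onI continuous_intros)
    show "(\<lambda>x. f' x * cnj (g' x)) \<in> borel_measurable M" "(\<lambda>x. f x * cnj (g x)) \<in> borel_measurable M"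
      by measurable
  qed
  have "(\<Union>f'\<in>ae_class M f. \<Union>g'\<in>ae_class M g. {\<integral>x. f' x * cnj (g' x) \<partial>M}) =
      (\<Union>f'\<in>ae_class M f. \<Union>g'\<in>ae_class M g. {\<integral>x. f x * cnj (g x) \<partial>M})"
    by (intro SUP_cong refl arg_cong[where f = "\<lambda>c. {c}"] eq)
  also have "\<dots> = {\<integral>x. f x * cnj (g x) \<partial>M}" using ne by simp
  finally have "(\<Union>f'\<in>ae_class M f. \<Union>g'\<in>ae_class M g. {\<integral>x. f' x * cnj (g' x) \<partial>M}) =
      {\<integral>x. f x * cnj (g x) \<partial>M}" .
  then show ?thesis by (simp add: L2_def)
qed

lemma hnorm_ae_class:
  assumes "f \<in> square_integrable M"
  shows "hnorm (L2 M) (ae_class M f) = sqrt (\<integral>x. (cmod (f x))\<^sup>2 \<partial>M)"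
proof -
  have "(\<integral>x. f x * cnj (f x) \<partial>M) = complex_of_real (\<integral>x. (cmod (f x))\<^sup>2 \<partial>M)"
    unfolding complex_norm_square[symmetric] by (rule integral_complex_of_real)
  then show ?thesis by (simp add: hnorm_def hinner_ae_class[OF assms assms])
qed


section \<open>The Cesaro operator\<close>

abbreviation unit_interval_measure :: "real measure" where
  "unit_interval_measure \<equiv> lebesgue_on {0<..<1}"

text \<open>
  Only the values for \<open>0 < x < 1\<close> matter: elsewhere \<open>cesaro_fun f\<close> is not seen by
  \<^const>\<open>unit_interval_measure\<close>.
\<close>

definition cesaro_fun :: "(real \<Rightarrow> complex) \<Rightarrow> real \<Rightarrow> complex" where
  "cesaro_fun f x =
     1 / complex_of_real x * (LINT t:{0<..<x}|lebesgue. f t / complex_of_real (1 - t))"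

definition cesaro :: "(real \<Rightarrow> complex) set \<Rightarrow> (real \<Rightarrow> complex) set" where
  "cesaro = L2_lift unit_interval_measure cesaro_fun"

lemma cesaro_fun_cong_AE:
  assumes ae: "AE t in unit_interval_measure. f t = g t" and x: "0 < x" "x < 1"
    and meas: "f \<in> borel_measurable unit_interval_measure" "g \<in> borel_measurable unit_interval_measure"
  shows "cesaro_fun f x = cesaro_fun g x"
proof -
  have sub: "{0<..<x} \<subseteq> {0<..<1}" using x by auto
  have *: "(\<lambda>t. indicator {0<..<x} t *\<^sub>R (h t / complex_of_real (1 - t))) \<in> borel_measurable lebesgue"
    if "h \<in> borel_measurable unit_interval_measure" for h
  proof -
    have "h \<in> borel_measurable (lebesgue_on {0<..<x})"
      by (rule measurable_restrict_mono[OF that sub])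
    moreover have "(\<lambda>t. complex_of_real (1 - t)) \<in> borel_measurable (lebesgue_on {0<..<x})"
      by (intro measurable_restrict_space1 measurable_completion) measurable
    ultimately have "(\<lambda>t. h t / complex_of_real (1 - t)) \<in> borel_measurable (lebesgue_on {0<..<x})"
      by (rule borel_measurable_divide)
    then show ?thesis by (subst (asm) borel_measurable_restrict_space_iff) auto
  qed
  have "AE t in lebesgue. t \<in> {0<..<1} \<longrightarrow> f t = g t"
    using ae by (subst (asm) AE_restrict_space_iff) auto
  then have "AE t in lebesgue. indicator {0<..<x} t *\<^sub>R (f t / complex_of_real (1 - t)) =
      indicator {0<..<x} t *\<^sub>R (g t / complex_of_real (1 - t))"
    by eventually_elim (use x in \<open>auto simp: indicator_def\<close>)
  then show ?thesis
    unfolding cesaro_fun_def set_lebesgue_integral_def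
    by (simp only: integral_cong_AE[OF *[OF meas(1)] *[OF meas(2)]])
qed


section \<open>The measure on the circle\<close>

definition sech :: "real \<Rightarrow> real" where
  "sech x = 1 / cosh x"

definition m_map :: "real \<Rightarrow> complex" where
  "m_map x = 1 / (1/2 - \<i> * complex_of_real x)"

text \<open>
  Arc length on the circle with centre 1 and radius 1 is the image of Lebesgue measure under a
  parametrization by arc length.
\<close>

definition arc_length_measure :: "complex measure" where
  "arc_length_measure =
     distr (lebesgue_on {0..<2 * pi}) (restrict_space borel (sphere 1 1)) (\<lambda>\<theta>. 1 + cis \<theta>)"

text \<open>
  The map \<^const>\<open>m_map\<close> is a bijection onto \<^term>\<open>sphere 1 1 - {0}\<close>, so \<^term>\<open>inv m_map z\<close> is unspecified
  at the null point \<open>z = 0\<close>; there the density is 0 because division by zero yields 0.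
\<close>

definition mu :: "complex measure" where
  "mu = density arc_length_measure
     (\<lambda>z. ennreal (pi / 2 * ((sech (pi * inv m_map z))\<^sup>2 / (cmod z)\<^sup>2)))"

text \<open>The bijectivity of \<^const>\<open>m_map\<close> and the measurability of the map and the density used above.\<close>

lemma bij_betw_m_map: "bij_betw m_map UNIV (sphere 1 1 - {0})"
proof -
  have ne: "1/2 - \<i> * complex_of_real x \<noteq> 0" for x
    by (simp add: complex_eq_iff)
  have "inj m_map"
    by (rule injI) (use ne in \<open>simp add: m_map_def field_simps\<close>)
  moreover have "m_map x \<in> sphere 1 1 - {0}" for x
  proof -
    have "1 - m_map x = - (1/2 + \<i> * complex_of_real x) / (1/2 - \<i> * complex_of_real x)"
      unfolding m_map_def by (subst diff_divide_eq_iff[OF ne]) (simp add: algebra_simps)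
    then have "cmod (1 - m_map x) = cmod (1/2 + \<i> * complex_of_real x) / cmod (1/2 - \<i> * complex_of_real x)"
      by (simp only: norm_divide norm_minus_cancel)
    also have "cmod (1/2 + \<i> * complex_of_real x) = cmod (1/2 - \<i> * complex_of_real x)"
      by (simp add: cmod_def)
    finally show ?thesis using ne[of x] by (simp add: dist_norm m_map_def)
  qed
  moreover have "z \<in> range m_map" if z: "z \<in> sphere 1 1 - {0}" for z
  proof -
    have "(1 - Re z)\<^sup>2 + (Im z)\<^sup>2 = 1"
      using z by (auto simp: dist_norm norm_minus_commute cmod_def)
    then have circ: "(Re z)\<^sup>2 + (Im z)\<^sup>2 = 2 * Re z"
      by (simp add: power2_eq_square algebra_simps)
    have "Re z \<noteq> 0" using circ z by (auto simp: complex_eq_iff)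
    then have "1 / z = 1/2 - \<i> * complex_of_real (Im z / (cmod z)\<^sup>2)"
      by (simp add: complex_eq_iff Re_divide Im_divide cmod_power2 circ) (simp add: power2_eq_square)
    then have "1 / (1 / z) = m_map (Im z / (cmod z)\<^sup>2)"
      unfolding m_map_def by (rule arg_cong)
    then have "z = m_map (Im z / (cmod z)\<^sup>2)" by simp
    then show ?thesis by blast
  qed
  ultimately have "inj m_map \<and> range m_map \<subseteq> sphere 1 1 - {0} \<and> sphere 1 1 - {0} \<subseteq> range m_map"
    by (intro conjI image_subsetI subsetI)
  then show ?thesis unfolding bij_betw_def by (simp only: subset_antisym simp_thms)
qed

lemma inv_m_map:
  assumes "z \<in> sphere 1 1 - {0}"
  shows "inv m_map z = Im z / (cmod z)\<^sup>2"
proof -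
  have "z = m_map (inv m_map z)"
    using assms bij_betw_m_map by (metis bij_betw_def f_inv_into_f)
  then have "1 / z = 1 / m_map (inv m_map z)" by (rule arg_cong)
  then have "1 / z = 1/2 - \<i> * complex_of_real (inv m_map z)" by (simp add: m_map_def)
  then have "Im (1 / z) = - inv m_map z" by simp
  then show ?thesis by (simp add: Im_divide cmod_power2)
qed

lemma measurable_arc_length_param:
  "(\<lambda>\<theta>. 1 + cis \<theta>) \<in> lebesgue_on {0..<2 * pi} \<rightarrow>\<^sub>M restrict_space borel (sphere 1 1)"
proof (rule measurable_restrict_space2)
  show "(\<lambda>\<theta>. 1 + cis \<theta>) \<in> borel_measurable (lebesgue_on {0..<2 * pi})"
    by (intro measurable_restrict_space1 measurable_completion)
      (simp add: borel_measurable_continuous_onI continuous_intros)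
qed (auto simp: dist_norm)

lemma measurable_mu_density:
  "(\<lambda>z. ennreal (pi / 2 * ((sech (pi * inv m_map z))\<^sup>2 / (cmod z)\<^sup>2)))
     \<in> borel_measurable arc_length_measure"
proof -
  have "(\<lambda>z. ennreal (pi / 2 * ((sech (pi * inv m_map z))\<^sup>2 / (cmod z)\<^sup>2)))
      \<in> borel_measurable (restrict_space borel (sphere 1 1))
    \<longleftrightarrow> (\<lambda>z. ennreal (pi / 2 * ((sech (pi * (Im z / (cmod z)\<^sup>2)))\<^sup>2 / (cmod z)\<^sup>2)))
      \<in> borel_measurable (restrict_space borel (sphere 1 1))"
    by (rule measurable_cong) (use inv_m_map in \<open>force simp: space_restrict_space\<close>)
  moreover have "(\<lambda>z. ennreal (pi / 2 * ((sech (pi * (Im z / (cmod z)\<^sup>2)))\<^sup>2 / (cmod z)\<^sup>2)))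
      \<in> borel_measurable (restrict_space borel (sphere 1 1))"
    unfolding sech_def cosh_def by (intro measurable_restrict_space1) measurable
  ultimately show ?thesis by (simp add: arc_length_measure_def)
qed

definition mult_z :: "(complex \<Rightarrow> complex) set \<Rightarrow> (complex \<Rightarrow> complex) set" where
  "mult_z = L2_lift mu (\<lambda>f z. z * f z)"

end

theory Submission
  imports Defs
begin

text \<open>Both operators are one plus a bilateral shift of multiplicity one, and the proof writes down, in each
space, an orthonormal basis indexed by the integers that is shifted.  If the operators act in the same
way on coefficients, then the map that preserves coefficients is the required unitary.

On the interval, \<open>C\<close> has the kernel \<open>k(x, t) = 1 / (x (1 - t))\<close> for \<open>t < x\<close>.  For \<open>s \<noteq> t\<close> the integral of
\<open>k(x, s) k(x, t)\<close> over \<open>x\<close> equals \<open>k(t, s) + k(s, t)\<close>, which says that \<open>C\<^sup>* C = C + C\<^sup>*\<close>.  The reflection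
\<open>x \<mapsto> 1 - x\<close> exchanges \<open>C\<close> and \<open>C\<^sup>*\<close>, so also \<open>C C\<^sup>* = C + C\<^sup>*\<close>.  Hence \<open>U = C - 1\<close> is unitary, in the
same way as \<open>|z - 1| = 1\<close> makes multiplication by \<open>z - 1\<close> unitary on the circle.  These identities are
\<open>cesaro_adj_cesaro_op\<close> and \<open>cesaro_op_cesaro_adj\<close>.  They need \<open>C\<close> to be bounded; for nonnegative \<open>h\<close> the
same identity reads \<open>\<parallel>C h\<parallel>\<^sup>2 = 2 \<langle>C h, h\<rangle>\<close>, which bounds \<open>\<parallel>C h\<parallel>\<close> by \<open>2 \<parallel>h\<parallel>\<close> as soon as it is finite
(\<open>nn_cesaro_bound\<close>).

Let \<open>w(x)\<close> be \<open>1 / x\<close> for \<open>x > 1/2\<close> and 0 otherwise.  The functions \<open>U\<^sup>n w\<close> with \<open>n \<ge> 0\<close> vanish on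
\<open>(0, 1/2)\<close>, while \<open>U\<^sup>* w\<close> vanishes on \<open>(1/2, 1)\<close>; so \<open>w\<close> is orthogonal to \<open>U\<^sup>n w\<close> for \<open>n \<ge> 1\<close>, and all
\<open>U\<^sup>n w\<close> with \<open>n\<close> an integer form an orthonormal family.  In the variable \<open>log (x / (1 - x))\<close>, up to
signs and the square root of the Jacobian, these are the Laguerre functions and their mirror images.

The family is complete.  Put \<open>g\<^sub>k(x) = ((1 - x) / x)\<^sup>k w(x)\<close>.  Then \<open>k C g\<^sub>k = w - g\<^sub>k\<close>, so if \<open>f\<close> is
orthogonal to every \<open>U\<^sup>n w\<close> with \<open>n \<ge> 0\<close>, the numbers \<open>c\<^sub>n = \<langle>U\<^sup>n g\<^sub>k, f\<rangle>\<close> satisfy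
\<open>k c\<^sub>n\<^sub>+\<^sub>1 = - (k + 1) c\<^sub>n\<close>.  They are bounded because \<open>U\<close> is an isometry, and for \<open>k \<ge> 1\<close> they grow
geometrically unless they vanish, while \<open>g\<^sub>0 = w\<close>; hence \<open>\<langle>g\<^sub>k, f\<rangle> = 0\<close> for all \<open>k\<close>, and the Weierstrass theorem in the variable
\<open>(1 - x) / x\<close> gives \<open>f = 0\<close> on \<open>(1/2, 1)\<close> (\<open>zero_on_upper_half\<close>).  The reflection gives the other half.

On the circle, let \<open>\<rho>\<close> be the density of \<open>\<mu>\<close> with respect to arc length.  It is positive except at 0, so
\<open>(z - 1)\<^sup>n / sqrt (2 \<pi> \<rho>(z))\<close> is the Fourier basis transported to \<open>L\<^sup>2(\<mu>)\<close>; it is complete by the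
Stone-Weierstrass theorem (\<open>orthonormal_basis_mu_basis\<close>).

Finally, \<open>unitarily_equivalent_of_bases\<close> turns the two bases into a unitary equivalence, by the theorem
of Riesz and Fischer and Parseval's identity.\<close>

section \<open>Square-integrable functions\<close>

definition l2_inner :: "'a measure \<Rightarrow> ('a \<Rightarrow> complex) \<Rightarrow> ('a \<Rightarrow> complex) \<Rightarrow> complex" where
  "l2_inner M f g = (\<integral>x. f x * cnj (g x) \<partial>M)"

definition l2_normsq :: "'a measure \<Rightarrow> ('a \<Rightarrow> complex) \<Rightarrow> real" where
  "l2_normsq M f = (\<integral>x. (cmod (f x))\<^sup>2 \<partial>M)"

lemma measurable_cnj [measurable]: "cnj \<in> borel_measurable borel"
  by (intro borel_measurable_continuous_onI continuous_intros)

lemma mult_cnj_self: "z * cnj z = (complex_of_real (cmod z))\<^sup>2"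
  by (simp only: complex_norm_square[symmetric] of_real_power)

lemma square_integrable_measurable: "f \<in> square_integrable M \<Longrightarrow> f \<in> borel_measurable M"
  by (simp add: square_integrable_def)

lemma square_integrable_diff:
  assumes "f \<in> square_integrable M" "g \<in> square_integrable M"
  shows "(\<lambda>x. f x - g x) \<in> square_integrable M"
  using square_integrable_add[OF assms(1) square_integrable_scale[OF assms(2), of "-1"]] by simp

lemma square_integrable_zero [simp]: "(\<lambda>x. 0) \<in> square_integrable M"
  by (simp add: square_integrable_def)

lemma square_integrable_sum:
  "(\<And>i. i \<in> A \<Longrightarrow> f i \<in> square_integrable M) \<Longrightarrow> (\<lambda>x. \<Sum>i\<in>A. f i x) \<in> square_integrable M"
  by (induction A rule: infinite_finite_induct) (auto intro: square_integrable_add)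

lemma square_integrable_bounded_by:
  assumes g: "g \<in> square_integrable M" and [measurable]: "f \<in> borel_measurable M"
    and le: "AE x in M. cmod (f x) \<le> B * cmod (g x)"
  shows "f \<in> square_integrable M"
proof -
  have "integrable M (\<lambda>x. B\<^sup>2 * (cmod (g x))\<^sup>2)"
    using g by (simp add: square_integrable_def)
  moreover have "AE x in M. norm ((cmod (f x))\<^sup>2) \<le> norm (B\<^sup>2 * (cmod (g x))\<^sup>2)"
    using le
  proof eventually_elim
    case (elim x)
    then have "(cmod (f x))\<^sup>2 \<le> (B * cmod (g x))\<^sup>2" by (intro power_mono) auto
    then show ?case by (simp add: power_mult_distrib)
  qed
  moreover have "(\<lambda>x. (cmod (f x))\<^sup>2) \<in> borel_measurable M" by measurable
  ultimately have "integrable M (\<lambda>x. (cmod (f x))\<^sup>2)"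
    using Bochner_Integration.integrable_bound by blast
  then show ?thesis by (simp add: square_integrable_def)
qed

lemma square_integrable_bounded:
  assumes "finite_measure M" "f \<in> borel_measurable M" "AE x in M. cmod (f x) \<le> B"
  shows "f \<in> square_integrable M"
proof (rule square_integrable_bounded_by)
  interpret finite_measure M by fact
  show "(\<lambda>x. 1) \<in> square_integrable M" by (simp add: square_integrable_def)
qed (use assms in auto)

lemma integrable_l2_prod:
  assumes "f \<in> square_integrable M" "g \<in> square_integrable M"
  shows "integrable M (\<lambda>x. f x * g x)"
proof (rule Bochner_Integration.integrable_bound)
  show "integrable M (\<lambda>x. (cmod (f x))\<^sup>2 + (cmod (g x))\<^sup>2)"
    using assms by (simp add: square_integrable_def)
  have "cmod (f x) * cmod (g x) \<le> (cmod (f x))\<^sup>2 + (cmod (g x))\<^sup>2" for x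
  proof -
    have "0 \<le> cmod (f x) * cmod (g x)" by simp
    then show ?thesis using sum_squares_bound[of "cmod (f x)" "cmod (g x)"] by linarith
  qed
  then show "AE x in M. norm (f x * g x) \<le> norm ((cmod (f x))\<^sup>2 + (cmod (g x))\<^sup>2)"
    by (simp add: norm_mult)
  show "(\<lambda>x. f x * g x) \<in> borel_measurable M"
    using assms[THEN square_integrable_measurable] by measurable
qed

lemma square_integrable_cnj:
  "f \<in> square_integrable M \<Longrightarrow> (\<lambda>x. cnj (f x)) \<in> square_integrable M"
  by (auto simp: square_integrable_def)

lemma integrable_l2_inner:
  assumes "f \<in> square_integrable M" "g \<in> square_integrable M"
  shows "integrable M (\<lambda>x. f x * cnj (g x))"
  by (rule integrable_l2_prod[OF assms(1) square_integrable_cnj[OF assms(2)]])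

lemma l2_inner_add_left:
  assumes "f \<in> square_integrable M" "g \<in> square_integrable M" "h \<in> square_integrable M"
  shows "l2_inner M (\<lambda>x. f x + g x) h = l2_inner M f h + l2_inner M g h"
  using assms by (simp add: l2_inner_def distrib_right integrable_l2_inner)

lemma l2_inner_diff_left:
  assumes "f \<in> square_integrable M" "g \<in> square_integrable M" "h \<in> square_integrable M"
  shows "l2_inner M (\<lambda>x. f x - g x) h = l2_inner M f h - l2_inner M g h"
  using assms by (simp add: l2_inner_def left_diff_distrib integrable_l2_inner)

lemma l2_inner_scale_left: "l2_inner M (\<lambda>x. c * f x) g = c * l2_inner M f g"
  by (simp add: l2_inner_def mult.assoc)

lemma l2_inner_commute: "l2_inner M g f = cnj (l2_inner M f g)"
  unfolding l2_inner_def by (subst Bochner_Integration.integral_cnj[symmetric]) (simp add: mult.commute)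

lemma l2_inner_add_right:
  assumes "f \<in> square_integrable M" "g \<in> square_integrable M" "h \<in> square_integrable M"
  shows "l2_inner M h (\<lambda>x. f x + g x) = l2_inner M h f + l2_inner M h g"
  using l2_inner_add_left[OF assms] by (simp add: l2_inner_commute[of M h])

lemma l2_inner_diff_right:
  assumes "f \<in> square_integrable M" "g \<in> square_integrable M" "h \<in> square_integrable M"
  shows "l2_inner M h (\<lambda>x. f x - g x) = l2_inner M h f - l2_inner M h g"
  using l2_inner_diff_left[OF assms] by (simp add: l2_inner_commute[of M h])

lemma l2_inner_sum_left:
  assumes "\<And>i. i \<in> A \<Longrightarrow> f i \<in> square_integrable M" "h \<in> square_integrable M"
  shows "l2_inner M (\<lambda>x. \<Sum>i\<in>A. f i x) h = (\<Sum>i\<in>A. l2_inner M (f i) h)"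
  using assms by (simp add: l2_inner_def sum_distrib_right integrable_l2_inner)

lemma l2_inner_cong_AE:
  assumes "f \<in> square_integrable M" "f' \<in> square_integrable M"
    and "g \<in> square_integrable M" "g' \<in> square_integrable M"
    and "AE x in M. f x = f' x" "AE x in M. g x = g' x"
  shows "l2_inner M f g = l2_inner M f' g'"
  unfolding l2_inner_def
proof (rule integral_cong_AE)
  note [measurable] = assms(1-4)[THEN square_integrable_measurable]
  show "(\<lambda>x. f x * cnj (g x)) \<in> borel_measurable M" "(\<lambda>x. f' x * cnj (g' x)) \<in> borel_measurable M"
    by measurable
  show "AE x in M. f x * cnj (g x) = f' x * cnj (g' x)"
    using assms(5,6) by eventually_elim simp
qed

lemma l2_normsq_nonneg [simp]: "l2_normsq M f \<ge> 0"
  by (simp add: l2_normsq_def)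

lemma l2_inner_self: "l2_inner M f f = complex_of_real (l2_normsq M f)"
  unfolding l2_inner_def l2_normsq_def complex_norm_square[symmetric]
  by (rule integral_complex_of_real)

lemma l2_normsq_eq_inner: "l2_normsq M f = Re (l2_inner M f f)"
  by (simp add: l2_inner_self)

lemma l2_normsq_diff:
  assumes f: "f \<in> square_integrable M" and g: "g \<in> square_integrable M"
  shows "l2_normsq M (\<lambda>x. f x - g x) = l2_normsq M f + l2_normsq M g - 2 * Re (l2_inner M f g)"
  using square_integrable_diff[OF f g] l2_inner_commute[of M g f]
  by (simp add: l2_normsq_eq_inner l2_inner_diff_left l2_inner_diff_right f g)

lemma ennreal_l2_normsq:
  assumes "f \<in> square_integrable M"
  shows "(\<integral>\<^sup>+x. ennreal ((cmod (f x))\<^sup>2) \<partial>M) = ennreal (l2_normsq M f)"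
  using assms unfolding l2_normsq_def square_integrable_def
  by (intro nn_integral_eq_integral) auto

lemma square_integrableI_nn:
  assumes "f \<in> borel_measurable M" "(\<integral>\<^sup>+x. ennreal ((cmod (f x))\<^sup>2) \<partial>M) < \<infinity>"
  shows "f \<in> square_integrable M"
  using assms by (auto simp: square_integrable_def intro!: integrableI_bounded)

lemma l2_Cauchy_Schwarz:
  assumes f: "f \<in> square_integrable M" and g: "g \<in> square_integrable M"
  shows "(cmod (l2_inner M f g))\<^sup>2 \<le> l2_normsq M f * l2_normsq M g"
proof -
  note [measurable] = f[THEN square_integrable_measurable] g[THEN square_integrable_measurable]
  have "ennreal (cmod (l2_inner M f g)) \<le> (\<integral>\<^sup>+x. ennreal (cmod (f x * cnj (g x))) \<partial>M)"
    unfolding l2_inner_def by (rule integral_norm_bound_ennreal[OF integrable_l2_inner[OF f g]])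
  also have "\<dots> = (\<integral>\<^sup>+x. ennreal (cmod (f x)) * ennreal (cmod (g x)) \<partial>M)"
    by (simp add: norm_mult ennreal_mult)
  finally have "(ennreal (cmod (l2_inner M f g)))\<^sup>2 \<le> \<dots>\<^sup>2"
    by (intro power_mono) auto
  also have "\<dots> \<le> (\<integral>\<^sup>+x. (ennreal (cmod (f x)))\<^sup>2 \<partial>M) * (\<integral>\<^sup>+x. (ennreal (cmod (g x)))\<^sup>2 \<partial>M)"
    by (rule Cauchy_Schwarz_nn_integral) measurable
  also have "\<dots> = ennreal (l2_normsq M f * l2_normsq M g)"
    by (simp add: ennreal_power ennreal_l2_normsq f g ennreal_mult)
  finally show ?thesis by (simp add: ennreal_power)
qed

text \<open>Completeness of \<open>L\<^sup>2(M)\<close>.  Along a subsequence whose squared increments integrate to less than \<open>4\<^sup>-\<^sup>k\<close>, the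
sum over \<open>k\<close> of \<open>2\<^sup>k\<close> times the squared increments has a finite integral.  Since
\<open>a \<le> 2\<^sup>-\<^sup>k + 2\<^sup>k a\<^sup>2\<close>, the increments themselves are then summable almost everywhere.  This avoids comparing
\<open>L\<^sup>1\<close> with \<open>L\<^sup>2\<close>, so the measure may be infinite.  Fatou's lemma identifies the limit.\<close>

lemma l2_complete:
  fixes f :: "nat \<Rightarrow> 'a \<Rightarrow> complex"
  assumes f: "\<And>n. f n \<in> square_integrable M"
    and cauchy: "\<And>e. e > 0 \<Longrightarrow> \<exists>N. \<forall>m\<ge>N. \<forall>n\<ge>N. l2_normsq M (\<lambda>x. f m x - f n x) < e"
  obtains g where "g \<in> square_integrable M" "(\<lambda>n. l2_normsq M (\<lambda>x. f n x - g x)) \<longlonglongrightarrow> 0"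
proof -
  note [measurable] = f[THEN square_integrable_measurable]
  obtain N where N: "\<And>k m n. m \<ge> N k \<Longrightarrow> n \<ge> N k \<Longrightarrow> l2_normsq M (\<lambda>x. f m x - f n x) < (1/4)^k"
    using cauchy[of "(1/4)^k" for k] by (metis zero_less_power zero_less_divide_1_iff zero_less_numeral)
  \<comment> \<open>a strictly increasing choice of indices with \<open>r k \<ge> N k\<close>\<close>
  define r where "r = rec_nat (N 0) (\<lambda>k p. max (Suc p) (N (Suc k)))"
  have r_Suc: "r (Suc k) = max (Suc (r k)) (N (Suc k))" and r_0: "r 0 = N 0" for k
    by (simp_all add: r_def)
  have r_ge: "r k \<ge> N k" for k by (cases k) (auto simp: r_Suc r_0)
  have r_mono: "strict_mono r" by (rule strict_mono_Suc_iff[THEN iffD2]) (simp add: r_Suc less_max_iff_disj)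
  define d where "d k x = f (r (Suc k)) x - f (r k) x" for k x
  have d_meas[measurable]: "d k \<in> borel_measurable M" for k unfolding d_def by measurable
  have d_sq: "d k \<in> square_integrable M" for k
    unfolding d_def by (intro square_integrable_diff f)
  have d_small: "l2_normsq M (d k) \<le> (1/4)^k" for k
    using N[of k "r (Suc k)" "r k"] r_ge[of k] strict_mono_leD[OF r_mono, of k "Suc k"]
    by (auto simp: d_def[abs_def])
  have fin: "(\<integral>\<^sup>+x. (\<Sum>k. ennreal (2^k * (cmod (d k x))\<^sup>2)) \<partial>M) < \<infinity>"
  proof -
    have "(\<integral>\<^sup>+x. (\<Sum>k. ennreal (2^k * (cmod (d k x))\<^sup>2)) \<partial>M)
        = (\<Sum>k. (\<integral>\<^sup>+x. ennreal (2^k * (cmod (d k x))\<^sup>2) \<partial>M))"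
      by (rule nn_integral_suminf) measurable
    also have "\<dots> = (\<Sum>k. ennreal (2^k * l2_normsq M (d k)))"
      by (simp add: ennreal_mult nn_integral_cmult ennreal_l2_normsq d_sq)
    also have "\<dots> \<le> (\<Sum>k. ennreal ((1/2)^k))"
    proof (intro suminf_le summableI ennreal_leI)
      fix k
      have "2^k * l2_normsq M (d k) \<le> 2^k * (1/4)^k" using d_small by simp
      also have "\<dots> = (1/2::real)^k" by (simp add: power_mult_distrib[symmetric])
      finally show "2^k * l2_normsq M (d k) \<le> (1/2)^k" .
    qed
    also have "\<dots> = ennreal (\<Sum>k. (1/2)^k)"
      by (rule suminf_ennreal2) auto
    finally show ?thesis using le_less_trans by fastforce
  qed
  have conv: "AE x in M. convergent (\<lambda>k. f (r k) x)"
  proof -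
    have "AE x in M. (\<Sum>k. ennreal (2^k * (cmod (d k x))\<^sup>2)) \<noteq> \<infinity>"
      by (rule nn_integral_noteq_infinite) (use fin in auto)
    then show ?thesis
    proof eventually_elim
      case (elim x)
      then have s: "summable (\<lambda>k. 2^k * (cmod (d k x))\<^sup>2)"
        by (intro summable_suminf_not_top) auto
      have "summable (\<lambda>k. (1/2)^k + 2^k * (cmod (d k x))\<^sup>2)"
        by (intro summable_add s) auto
      moreover have "norm (d k x) \<le> (1/2)^k + 2^k * (cmod (d k x))\<^sup>2" for k
      proof (cases "cmod (d k x) \<le> (1/2)^k")
        case False
        have "cmod (d k x) = 2^k * ((1/2)^k * cmod (d k x))" by (simp add: power_one_over)
        also have "\<dots> \<le> 2^k * (cmod (d k x) * cmod (d k x))"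
          using False by (intro mult_left_mono mult_right_mono) auto
        also have "\<dots> \<le> (1/2)^k + 2^k * (cmod (d k x))\<^sup>2" by (simp add: power2_eq_square)
        finally show ?thesis .
      qed (simp add: add_increasing2)
      ultimately have "summable (\<lambda>k. d k x)"
        by (rule summable_comparison_test'[where N = 0])
      then have "convergent (\<lambda>n. \<Sum>k<n. d k x)" by (simp add: summable_iff_convergent)
      then have "convergent (\<lambda>n. f (r 0) x + (\<Sum>k<n. d k x))"
        by (intro convergent_add convergent_const)
      moreover have "f (r 0) x + (\<Sum>k<n. d k x) = f (r n) x" for n
        using sum_lessThan_telescope[of "\<lambda>k. f (r k) x" n] by (simp add: d_def)
      ultimately show ?case by simp
    qed
  qed
  define g where "g x = lim (\<lambda>k. f (r k) x)" for x
  have [measurable]: "g \<in> borel_measurable M"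
    unfolding g_def by measurable
  have bound: "(\<integral>\<^sup>+x. ennreal ((cmod (f n x - g x))\<^sup>2) \<partial>M) \<le> ennreal e"
    if e: "e > 0" and n: "\<forall>m\<ge>K. l2_normsq M (\<lambda>x. f n x - f m x) < e" for n K e
  proof -
    have "(\<integral>\<^sup>+x. ennreal ((cmod (f n x - g x))\<^sup>2) \<partial>M)
        = (\<integral>\<^sup>+x. liminf (\<lambda>k. ennreal ((cmod (f n x - f (r k) x))\<^sup>2)) \<partial>M)"
    proof (rule nn_integral_cong_AE)
      show "AE x in M. ennreal ((cmod (f n x - g x))\<^sup>2)
          = liminf (\<lambda>k. ennreal ((cmod (f n x - f (r k) x))\<^sup>2))"
        using conv
      proof eventually_elim
        case (elim x)
        then have "(\<lambda>k. f (r k) x) \<longlonglongrightarrow> g x" by (simp add: g_def convergent_LIMSEQ_iff)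
        then have "(\<lambda>k. ennreal ((cmod (f n x - f (r k) x))\<^sup>2)) \<longlonglongrightarrow> ennreal ((cmod (f n x - g x))\<^sup>2)"
          by (intro tendsto_intros tendsto_ennrealI)
        then show ?case by (intro lim_imp_Liminf[symmetric]) auto
      qed
    qed
    also have "\<dots> \<le> liminf (\<lambda>k. (\<integral>\<^sup>+x. ennreal ((cmod (f n x - f (r k) x))\<^sup>2) \<partial>M))"
      by (rule nn_integral_liminf) measurable
    also have "\<dots> = liminf (\<lambda>k. ennreal (l2_normsq M (\<lambda>x. f n x - f (r k) x)))"
      by (simp add: ennreal_l2_normsq square_integrable_diff f)
    also have "\<dots> \<le> ennreal e"
    proof (rule Liminf_le)
      show "\<forall>\<^sub>F k in sequentially. ennreal (l2_normsq M (\<lambda>x. f n x - f (r k) x)) \<le> ennreal e"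
        using eventually_ge_at_top[of K]
      proof eventually_elim
        case (elim k)
        then have "K \<le> r k" using strict_mono_imp_increasing[OF r_mono, of k] by linarith
        then show ?case using n by (simp add: ennreal_leI less_imp_le)
      qed
    qed simp
    finally show ?thesis .
  qed
  have g_sq: "g \<in> square_integrable M"
  proof -
    obtain K where "\<forall>m\<ge>K. \<forall>n\<ge>K. l2_normsq M (\<lambda>x. f m x - f n x) < 1" using cauchy[of 1] by auto
    then have "(\<integral>\<^sup>+x. ennreal ((cmod (f K x - g x))\<^sup>2) \<partial>M) \<le> ennreal 1" by (intro bound[of _ K]) auto
    then have "(\<lambda>x. f K x - g x) \<in> square_integrable M"
      by (intro square_integrableI_nn) (auto simp: le_less_trans)
    from square_integrable_diff[OF f[of K] this] show ?thesis by simp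
  qed
  moreover have "(\<lambda>n. l2_normsq M (\<lambda>x. f n x - g x)) \<longlonglongrightarrow> 0"
  proof (rule LIMSEQ_I)
    fix e :: real assume e: "e > 0"
    then obtain K where K: "\<forall>m\<ge>K. \<forall>n\<ge>K. l2_normsq M (\<lambda>x. f m x - f n x) < e / 2"
      using cauchy[of "e/2"] by auto
    have "norm (l2_normsq M (\<lambda>x. f n x - g x) - 0) < e" if "n \<ge> K" for n
    proof -
      have "(\<integral>\<^sup>+x. ennreal ((cmod (f n x - g x))\<^sup>2) \<partial>M) \<le> ennreal (e / 2)"
        using K that e by (intro bound[of _ K]) auto
      then have "l2_normsq M (\<lambda>x. f n x - g x) \<le> e / 2"
        using e by (simp add: ennreal_l2_normsq square_integrable_diff f g_sq)
      then show ?thesis using e by simp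
    qed
    then show "\<exists>K. \<forall>n\<ge>K. norm (l2_normsq M (\<lambda>x. f n x - g x) - 0) < e" by blast
  qed
  ultimately show ?thesis by (rule that)
qed

section \<open>Orthonormal bases indexed by the integers\<close>

definition orthonormal :: "'a measure \<Rightarrow> (int \<Rightarrow> 'a \<Rightarrow> complex) \<Rightarrow> bool" where
  "orthonormal M e \<longleftrightarrow> (\<forall>n. e n \<in> square_integrable M) \<and>
     (\<forall>m n. l2_inner M (e m) (e n) = (if m = n then 1 else 0))"

definition orthonormal_basis :: "'a measure \<Rightarrow> (int \<Rightarrow> 'a \<Rightarrow> complex) \<Rightarrow> bool" where
  "orthonormal_basis M e \<longleftrightarrow> orthonormal M e \<and>
     (\<forall>f\<in>square_integrable M. (\<forall>n. l2_inner M f (e n) = 0) \<longrightarrow> (AE x in M. f x = 0))"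

text \<open>The symmetric partial sums make \<open>UNIV :: int set\<close> an increasing union of finite sets.\<close>

definition sumsq_upto :: "(int \<Rightarrow> complex) \<Rightarrow> nat \<Rightarrow> real" where
  "sumsq_upto c n = (\<Sum>i\<in>{-int n..int n}. (cmod (c i))\<^sup>2)"

lemma incseq_sumsq_upto: "incseq (sumsq_upto c)"
  unfolding sumsq_upto_def by (intro monoI sum_mono2) auto

lemma l2_inner_combination:
  assumes e: "orthonormal M e" and A: "finite A"
  shows "l2_inner M (\<lambda>x. \<Sum>i\<in>A. c i * e i x) (e j) = (if j \<in> A then c j else 0)"
proof -
  have e_sq: "e i \<in> square_integrable M" for i using e by (simp add: orthonormal_def)
  have "l2_inner M (\<lambda>x. \<Sum>i\<in>A. c i * e i x) (e j) = (\<Sum>i\<in>A. c i * l2_inner M (e i) (e j))"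
    by (simp add: l2_inner_sum_left l2_inner_scale_left square_integrable_scale e_sq)
  also have "\<dots> = (\<Sum>i\<in>A. if i = j then c j else 0)"
    using e by (intro sum.cong) (auto simp: orthonormal_def)
  finally show ?thesis using A by simp
qed

lemma l2_inner_with_combination:
  assumes e: "orthonormal M e" and f: "f \<in> square_integrable M"
  shows "l2_inner M (\<lambda>x. \<Sum>i\<in>A. c i * e i x) f = (\<Sum>i\<in>A. c i * cnj (l2_inner M f (e i)))"
proof -
  have e_sq: "e i \<in> square_integrable M" for i using e by (simp add: orthonormal_def)
  show ?thesis
    by (simp add: l2_inner_sum_left l2_inner_scale_left square_integrable_scale e_sq f)
      (simp add: l2_inner_commute[of M _ f])
qed

lemma l2_normsq_combination:
  assumes e: "orthonormal M e" and A: "finite A"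
  shows "l2_normsq M (\<lambda>x. \<Sum>i\<in>A. c i * e i x) = (\<Sum>i\<in>A. (cmod (c i))\<^sup>2)"
proof -
  have e_sq: "e i \<in> square_integrable M" for i using e by (simp add: orthonormal_def)
  have s: "(\<lambda>x. \<Sum>i\<in>A. c i * e i x) \<in> square_integrable M"
    by (intro square_integrable_sum square_integrable_scale e_sq)
  have "complex_of_real (l2_normsq M (\<lambda>x. \<Sum>i\<in>A. c i * e i x)) = (\<Sum>i\<in>A. c i * cnj (c i))"
    unfolding l2_inner_self[symmetric] l2_inner_with_combination[OF e s]
    by (intro sum.cong) (simp_all add: l2_inner_combination[OF e A])
  also have "\<dots> = complex_of_real (\<Sum>i\<in>A. (cmod (c i))\<^sup>2)"
    by (simp add: mult_cnj_self)
  finally show ?thesis using of_real_eq_iff by blast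
qed

lemma Bessel:
  assumes e: "orthonormal M e" and f: "f \<in> square_integrable M"
  shows "sumsq_upto (\<lambda>i. l2_inner M f (e i)) n \<le> l2_normsq M f"
proof -
  define c where "c i = l2_inner M f (e i)" for i
  define s where "s x = (\<Sum>i\<in>{-int n..int n}. c i * e i x)" for x
  have e_sq: "e i \<in> square_integrable M" for i using e by (simp add: orthonormal_def)
  have s_sq: "s \<in> square_integrable M" unfolding s_def
    by (intro square_integrable_sum square_integrable_scale e_sq)
  have ns: "l2_normsq M s = sumsq_upto c n"
    unfolding s_def sumsq_upto_def by (rule l2_normsq_combination[OF e]) simp
  have "l2_inner M s f = complex_of_real (sumsq_upto c n)"
    unfolding s_def l2_inner_with_combination[OF e f] sumsq_upto_def
    by (simp add: c_def mult_cnj_self)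
  then have "0 \<le> sumsq_upto c n + l2_normsq M f - 2 * sumsq_upto c n"
    using l2_normsq_diff[OF s_sq f] l2_normsq_nonneg[of M "\<lambda>x. s x - f x"] by (simp add: ns)
  then show ?thesis by (simp add: c_def[abs_def])
qed

lemma l2_inner_tendsto:
  assumes "\<And>n. s n \<in> square_integrable M" "g \<in> square_integrable M" "h \<in> square_integrable M"
    and lim: "(\<lambda>n. l2_normsq M (\<lambda>x. s n x - g x)) \<longlonglongrightarrow> 0"
  shows "(\<lambda>n. l2_inner M (s n) h) \<longlonglongrightarrow> l2_inner M g h"
proof -
  have "(\<lambda>n. sqrt (l2_normsq M (\<lambda>x. s n x - g x) * l2_normsq M h)) \<longlonglongrightarrow> sqrt (0 * l2_normsq M h)"
    by (intro tendsto_intros lim)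
  then have "(\<lambda>n. sqrt (l2_normsq M (\<lambda>x. s n x - g x) * l2_normsq M h)) \<longlonglongrightarrow> 0" by simp
  moreover have le: "norm (l2_inner M (s n) h - l2_inner M g h)
      \<le> sqrt (l2_normsq M (\<lambda>x. s n x - g x) * l2_normsq M h)" for n
    using l2_Cauchy_Schwarz[of "\<lambda>x. s n x - g x" M h] assms
    by (simp add: l2_inner_diff_left[symmetric] square_integrable_diff real_le_rsqrt)
  ultimately have "(\<lambda>n. l2_inner M (s n) h - l2_inner M g h) \<longlonglongrightarrow> 0"
    by (intro Lim_null_comparison[where net = sequentially, OF always_eventually[OF allI[OF le]]])
  then show ?thesis by (simp add: LIM_zero_iff)
qed

text \<open>The increments of the partial sums of \<open>\<Sum>i. c i * e i\<close> have squared norm equal to the increments of the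
bounded increasing sequence \<open>sumsq_upto c\<close>, so the partial sums converge; the inner product is continuous.\<close>

lemma exists_with_coefficients:
  assumes e: "orthonormal M e" and c: "\<And>n. sumsq_upto c n \<le> B"
  obtains g where "g \<in> square_integrable M" "\<And>i. l2_inner M g (e i) = c i"
    "sumsq_upto c \<longlonglongrightarrow> l2_normsq M g"
proof -
  define s where "s n x = (\<Sum>i\<in>{-int n..int n}. c i * e i x)" for n x
  have e_sq: "e i \<in> square_integrable M" for i using e by (simp add: orthonormal_def)
  have s_sq: "s n \<in> square_integrable M" for n unfolding s_def
    by (intro square_integrable_sum square_integrable_scale e_sq)
  obtain L where L: "sumsq_upto c \<longlonglongrightarrow> L"
    using incseq_convergent[OF incseq_sumsq_upto] c by blast
  have diff: "l2_normsq M (\<lambda>x. s m x - s n x) = sumsq_upto c m - sumsq_upto c n" if "n \<le> m" for m n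
  proof -
    have sub: "{-int n..int n} \<subseteq> {-int m..int m}" using that by auto
    have "(\<lambda>x. s m x - s n x) = (\<lambda>x. \<Sum>i\<in>{-int m..int m} - {-int n..int n}. c i * e i x)"
      unfolding s_def by (intro ext sum_diff[symmetric] sub) simp
    then have "l2_normsq M (\<lambda>x. s m x - s n x)
        = (\<Sum>i\<in>{-int m..int m} - {-int n..int n}. (cmod (c i))\<^sup>2)"
      using l2_normsq_combination[OF e] by simp
    then show ?thesis using sum_diff[OF _ sub] by (simp add: sumsq_upto_def)
  qed
  have sym: "l2_normsq M (\<lambda>x. s m x - s n x) = l2_normsq M (\<lambda>x. s n x - s m x)" for m n
    by (simp add: l2_normsq_def norm_minus_commute)
  have "\<exists>N. \<forall>m\<ge>N. \<forall>n\<ge>N. l2_normsq M (\<lambda>x. s m x - s n x) < \<epsilon>" if \<epsilon>: "\<epsilon> > 0" for \<epsilon>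
  proof -
    obtain N where N: "\<forall>m\<ge>N. \<forall>n\<ge>N. norm (sumsq_upto c m - sumsq_upto c n) < \<epsilon>"
      using CauchyD[OF LIMSEQ_imp_Cauchy[OF L] \<epsilon>] by (elim exE)
    have "l2_normsq M (\<lambda>x. s m x - s n x) < \<epsilon>" if mn: "m \<ge> N" "n \<ge> N" for m n
    proof (cases "n \<le> m")
      case True
      then show ?thesis using N mn diff[OF True] by fastforce
    next
      case False
      then show ?thesis using N mn diff[of m n] sym[of m n] by fastforce
    qed
    then show ?thesis by blast
  qed
  then obtain g where g: "g \<in> square_integrable M"
    and lim: "(\<lambda>n. l2_normsq M (\<lambda>x. s n x - g x)) \<longlonglongrightarrow> 0"
    using l2_complete[of s M] s_sq by blast
  have coeff: "l2_inner M g (e i) = c i" for i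
  proof (rule LIMSEQ_unique)
    show "(\<lambda>n. l2_inner M (s n) (e i)) \<longlonglongrightarrow> l2_inner M g (e i)"
      by (rule l2_inner_tendsto[OF s_sq g e_sq lim])
    have "\<forall>\<^sub>F n in sequentially. l2_inner M (s n) (e i) = c i"
      using eventually_ge_at_top[of "nat \<bar>i\<bar>"]
    proof eventually_elim
      case (elim n)
      then have "i \<in> {-int n..int n}" by auto
      then show ?case unfolding s_def by (subst l2_inner_combination[OF e]) auto
    qed
    then show "(\<lambda>n. l2_inner M (s n) (e i)) \<longlonglongrightarrow> c i" by (rule tendsto_eventually)
  qed
  have "l2_inner M (s n) g = complex_of_real (sumsq_upto c n)" for n
    unfolding s_def l2_inner_with_combination[OF e g] sumsq_upto_def coeff
    by (simp add: mult_cnj_self)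
  then have "(\<lambda>n. Re (complex_of_real (sumsq_upto c n))) \<longlonglongrightarrow> Re (l2_inner M g g)"
    using l2_inner_tendsto[OF s_sq g g lim] by (intro tendsto_Re) simp
  then have "sumsq_upto c \<longlonglongrightarrow> l2_normsq M g" by (simp add: l2_inner_self)
  with g coeff show ?thesis by (rule that)
qed

lemma AE_eq_of_coefficients:
  assumes e: "orthonormal_basis M e" and f: "f \<in> square_integrable M" and g: "g \<in> square_integrable M"
    and eq: "\<And>i. l2_inner M f (e i) = l2_inner M g (e i)"
  shows "AE x in M. f x = g x"
proof -
  have "e i \<in> square_integrable M" for i
    using e by (simp add: orthonormal_basis_def orthonormal_def)
  then have "\<forall>i. l2_inner M (\<lambda>x. f x - g x) (e i) = 0"
    by (simp add: l2_inner_diff_left f g eq)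
  then have "AE x in M. f x - g x = 0"
    using e square_integrable_diff[OF f g] by (auto simp: orthonormal_basis_def)
  then show ?thesis by simp
qed

text \<open>The function built from the coefficients of \<open>f\<close> has as its squared norm the limit of the partial sums, and
completeness of the family forces that function to be \<open>f\<close>.\<close>

lemma Parseval:
  assumes e: "orthonormal_basis M e" and f: "f \<in> square_integrable M"
  shows "sumsq_upto (\<lambda>i. l2_inner M f (e i)) \<longlonglongrightarrow> l2_normsq M f"
proof -
  have o: "orthonormal M e" using e by (simp add: orthonormal_basis_def)
  obtain g where g: "g \<in> square_integrable M" "\<And>i. l2_inner M g (e i) = l2_inner M f (e i)"
    "sumsq_upto (\<lambda>i. l2_inner M f (e i)) \<longlonglongrightarrow> l2_normsq M g"
    using exists_with_coefficients[OF o Bessel[OF o f]] by blast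
  have ae: "AE x in M. g x = f x"
    by (rule AE_eq_of_coefficients[OF e g(1) f g(2)])
  have "l2_inner M g g = l2_inner M f f"
    by (rule l2_inner_cong_AE) (use ae f g in auto)
  then show ?thesis using g(3) by (simp add: l2_normsq_eq_inner)
qed

text \<open>The unitary map sends \<open>f\<close> to the function with the same coefficients.  The premise \<open>matrix\<close> says that the
two operators act on coefficients by the same rule; it is phrased for functions rather than for matrix
entries, so that no infinite sums over entries occur.\<close>

theorem unitarily_equivalent_of_bases:
  fixes M :: "'a measure" and N :: "'b measure"
  assumes e: "orthonormal_basis M e" and v: "orthonormal_basis N v"
    and S: "bounded_operator (L2 M) S" and T: "bounded_operator (L2 N) T"
    and \<phi>: "\<And>f. f \<in> square_integrable M \<Longrightarrow> \<phi> f \<in> square_integrable M \<and> S (ae_class M f) = ae_class M (\<phi> f)"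
    and \<psi>: "\<And>g. g \<in> square_integrable N \<Longrightarrow> \<psi> g \<in> square_integrable N \<and> T (ae_class N g) = ae_class N (\<psi> g)"
    and matrix: "\<And>f g i. f \<in> square_integrable M \<Longrightarrow> g \<in> square_integrable N \<Longrightarrow>
        (\<And>i. l2_inner M f (e i) = l2_inner N g (v i)) \<Longrightarrow>
        l2_inner M (\<phi> f) (e i) = l2_inner N (\<psi> g) (v i)"
  shows "unitarily_equivalent (L2 M) S (L2 N) T"
proof -
  have oe: "orthonormal M e" and ov: "orthonormal N v"
    using e v by (simp_all add: orthonormal_basis_def)
  have e_sq: "e i \<in> square_integrable M" and v_sq: "v i \<in> square_integrable N" for i
    using oe ov by (simp_all add: orthonormal_def)
  define match where "match f g \<longleftrightarrow> f \<in> square_integrable M \<and> g \<in> square_integrable N \<and>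
      (\<forall>i. l2_inner M f (e i) = l2_inner N g (v i))" for f g
  have ex1: "\<exists>g. match f g" if f: "f \<in> square_integrable M" for f
  proof -
    obtain g where "g \<in> square_integrable N" "\<And>i. l2_inner N g (v i) = l2_inner M f (e i)"
      by (rule exists_with_coefficients[OF ov Bessel[OF oe f]]) blast
    then have "match f g" using f by (simp add: match_def)
    then show ?thesis by (intro exI[where P = "match f"])
  qed
  have ex2: "\<exists>f. match f g" if g: "g \<in> square_integrable N" for g
  proof -
    obtain f where "f \<in> square_integrable M" "\<And>i. l2_inner M f (e i) = l2_inner N g (v i)"
      by (rule exists_with_coefficients[OF oe Bessel[OF ov g]]) blast
    then have "match f g" using g by (simp add: match_def)
    then show ?thesis by (intro exI[where P = "\<lambda>f. match f g"])
  qed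
  have cong: "ae_class N g = ae_class N g'" if "match f g" "match f' g'" "ae_class M f = ae_class M f'" for f f' g g'
  proof (rule ae_class_eqI)
    show "g \<in> square_integrable N" "g' \<in> square_integrable N"
      using that by (simp_all add: match_def)
    have f: "f \<in> square_integrable M" "f' \<in> square_integrable M"
      using that by (simp_all add: match_def)
    then have "f' \<in> ae_class M f" unfolding that(3) by (simp add: mem_ae_class_iff)
    then have "AE x in M. f x = f' x" by (simp add: mem_ae_class_iff)
    then have "l2_inner M f (e i) = l2_inner M f' (e i)" for i
      by (intro l2_inner_cong_AE f e_sq) auto
    then show "AE x in N. g x = g' x"
      using that by (intro AE_eq_of_coefficients[OF v]) (auto simp: match_def)
  qed
  \<comment> \<open>By \<open>cong\<close> the class chosen here depends on the coefficients only.\<close>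
  define \<Psi> where "\<Psi> F = (SOME G. \<exists>f g. match f g \<and> F = ae_class M f \<and> G = ae_class N g)" for F
  have \<Psi>: "\<Psi> (ae_class M f) = ae_class N g" if m: "match f g" for f g
  proof -
    have "\<exists>G. \<exists>f' g'. match f' g' \<and> ae_class M f = ae_class M f' \<and> G = ae_class N g'"
      using m by blast
    then have "\<exists>f' g'. match f' g' \<and> ae_class M f = ae_class M f' \<and> \<Psi> (ae_class M f) = ae_class N g'"
      unfolding \<Psi>_def by (rule someI_ex)
    then obtain f' g' where m': "match f' g'" "ae_class M f = ae_class M f'"
      and eq: "\<Psi> (ae_class M f) = ae_class N g'" by (elim exE conjE)
    show ?thesis unfolding eq by (rule cong[OF m m', symmetric])
  qed
  have repr: "\<exists>f g. match f g \<and> F = ae_class M f" if F: "F \<in> hcarrier (L2 M)" for F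
  proof -
    obtain f where f: "f \<in> square_integrable M" and eq: "F = ae_class M f"
      using F unfolding hcarrier_L2 by (elim imageE)
    obtain g where "match f g" using ex1[OF f] by (elim exE)
    with eq show ?thesis by (intro exI conjI)
  qed
  have carrier: "ae_class N g \<in> hcarrier (L2 N)" if "match f g" for f g
    using that by (auto simp: hcarrier_L2 match_def)
  have linear: "linear_map (L2 M) (L2 N) \<Psi>"
    unfolding linear_map_def
  proof (intro conjI ballI allI)
    fix F assume "F \<in> hcarrier (L2 M)"
    from repr[OF this] obtain f g where m: "match f g" and F: "F = ae_class M f"
      by (elim exE conjE)
    show "\<Psi> F \<in> hcarrier (L2 N)" unfolding F \<Psi>[OF m] by (rule carrier[OF m])
  next
    fix F F' assume "F \<in> hcarrier (L2 M)" "F' \<in> hcarrier (L2 M)"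
    from this[THEN repr] obtain f g f' g'
      where m: "match f g" "match f' g'" and F: "F = ae_class M f" "F' = ae_class M f'"
      by (elim exE conjE)
    have "match (\<lambda>x. f x + f' x) (\<lambda>x. g x + g' x)"
      using m by (simp add: match_def square_integrable_add l2_inner_add_left e_sq v_sq)
    from \<Psi>[OF this] \<Psi>[OF m(1)] \<Psi>[OF m(2)]
    show "\<Psi> (hadd (L2 M) F F') = hadd (L2 N) (\<Psi> F) (\<Psi> F')"
      using m by (simp add: F hadd_ae_class match_def)
  next
    fix c F assume "F \<in> hcarrier (L2 M)"
    from repr[OF this] obtain f g where m: "match f g" and F: "F = ae_class M f"
      by (elim exE conjE)
    have "match (\<lambda>x. c * f x) (\<lambda>x. c * g x)"
      using m by (simp add: match_def square_integrable_scale l2_inner_scale_left)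
    from \<Psi>[OF this] \<Psi>[OF m] show "\<Psi> (hscale (L2 M) c F) = hscale (L2 N) c (\<Psi> F)"
      using m by (simp add: F hscale_ae_class match_def)
  qed
  have isometric: "hnorm (L2 N) (\<Psi> F) = hnorm (L2 M) F" if "F \<in> hcarrier (L2 M)" for F
  proof -
    obtain f g where m: "match f g" and F: "F = ae_class M f"
      using repr[OF \<open>F \<in> hcarrier (L2 M)\<close>] by (elim exE conjE)
    have fg: "f \<in> square_integrable M" "g \<in> square_integrable N" using m by (simp_all add: match_def)
    have "sumsq_upto (\<lambda>i. l2_inner M f (e i)) \<longlonglongrightarrow> l2_normsq M f"
      by (rule Parseval[OF e fg(1)])
    moreover have "sumsq_upto (\<lambda>i. l2_inner M f (e i)) \<longlonglongrightarrow> l2_normsq N g"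
      using Parseval[OF v fg(2)] m by (simp add: match_def)
    ultimately have "l2_normsq M f = l2_normsq N g" by (rule LIMSEQ_unique)
    then show ?thesis using \<Psi>[OF m] fg by (simp add: F hnorm_ae_class l2_normsq_def)
  qed
  have onto: "\<Psi> ` hcarrier (L2 M) = hcarrier (L2 N)"
  proof (intro subset_antisym subsetI)
    fix G assume "G \<in> \<Psi> ` hcarrier (L2 M)"
    then obtain F where F: "F \<in> hcarrier (L2 M)" "G = \<Psi> F" by (elim imageE)
    then show "G \<in> hcarrier (L2 N)" using linear by (simp add: linear_map_def)
  next
    fix G assume "G \<in> hcarrier (L2 N)"
    then obtain g where g: "g \<in> square_integrable N" and G: "G = ae_class N g"
      unfolding hcarrier_L2 by (elim imageE)
    obtain f where m: "match f g" using ex2[OF g] by (elim exE)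
    from G have "G = \<Psi> (ae_class M f)" unfolding \<Psi>[OF m] .
    moreover have "ae_class M f \<in> hcarrier (L2 M)" using m by (auto simp: hcarrier_L2 match_def)
    ultimately show "G \<in> \<Psi> ` hcarrier (L2 M)" by blast
  qed
  have "\<Psi> (S F) = T (\<Psi> F)" if "F \<in> hcarrier (L2 M)" for F
  proof -
    obtain f g where m: "match f g" and F: "F = ae_class M f"
      using repr[OF \<open>F \<in> hcarrier (L2 M)\<close>] by (elim exE conjE)
    then have fg: "f \<in> square_integrable M" "g \<in> square_integrable N" by (simp_all add: match_def)
    have "match (\<phi> f) (\<psi> g)"
      using matrix[OF fg] m \<phi>[OF fg(1)] \<psi>[OF fg(2)] by (simp add: match_def)
    then show ?thesis using \<Psi>[OF m] \<Psi>[of "\<phi> f" "\<psi> g"] \<phi>[OF fg(1)] \<psi>[OF fg(2)] by (simp add: F)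
  qed
  then have "surjective_linear_isometry (L2 M) (L2 N) \<Psi> \<and>
      (\<forall>F\<in>hcarrier (L2 M). \<Psi> (S F) = T (\<Psi> F))"
    using linear isometric onto by (simp add: surjective_linear_isometry_def)
  then show ?thesis
    unfolding unitarily_equivalent_def by (intro conjI S T exI[of _ \<Psi>]) simp_all
qed

lemma bounded_operator_L2_lift:
  assumes sq: "\<And>f. f \<in> square_integrable M \<Longrightarrow> \<phi> f \<in> square_integrable M"
    and resp: "\<And>f g. f \<in> square_integrable M \<Longrightarrow> g \<in> square_integrable M \<Longrightarrow>
                 AE x in M. f x = g x \<Longrightarrow> AE x in M. \<phi> f x = \<phi> g x"
    and add: "\<And>f g. f \<in> square_integrable M \<Longrightarrow> g \<in> square_integrable M \<Longrightarrow>
                 AE x in M. \<phi> (\<lambda>x. f x + g x) x = \<phi> f x + \<phi> g x"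
    and scale: "\<And>c f. f \<in> square_integrable M \<Longrightarrow> AE x in M. \<phi> (\<lambda>x. c * f x) x = c * \<phi> f x"
    and bound: "\<And>f. f \<in> square_integrable M \<Longrightarrow> l2_normsq M (\<phi> f) \<le> B\<^sup>2 * l2_normsq M f"
    and B: "B \<ge> 0"
  shows "bounded_operator (L2 M) (L2_lift M \<phi>)"
proof -
  have lift: "L2_lift M \<phi> (ae_class M f) = ae_class M (\<phi> f)" if "f \<in> square_integrable M" for f
    by (rule L2_lift_ae_class[OF that sq resp])
  have "linear_map (L2 M) (L2 M) (L2_lift M \<phi>)"
    unfolding linear_map_def
  proof (intro conjI ballI allI)
    fix F assume "F \<in> hcarrier (L2 M)"
    then show "L2_lift M \<phi> F \<in> hcarrier (L2 M)" using lift sq by (auto simp: hcarrier_L2)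
  next
    fix F G assume "F \<in> hcarrier (L2 M)" "G \<in> hcarrier (L2 M)"
    then obtain f g where fg: "f \<in> square_integrable M" "g \<in> square_integrable M"
      and F: "F = ae_class M f" "G = ae_class M g" by (auto simp: hcarrier_L2)
    show "L2_lift M \<phi> (hadd (L2 M) F G) = hadd (L2 M) (L2_lift M \<phi> F) (L2_lift M \<phi> G)"
      using add[OF fg] by (simp add: F hadd_ae_class lift fg square_integrable_add sq ae_class_eqI)
  next
    fix c F assume "F \<in> hcarrier (L2 M)"
    then obtain f where f: "f \<in> square_integrable M" and F: "F = ae_class M f"
      by (auto simp: hcarrier_L2)
    show "L2_lift M \<phi> (hscale (L2 M) c F) = hscale (L2 M) c (L2_lift M \<phi> F)"
      using scale[OF f] by (simp add: F hscale_ae_class lift f square_integrable_scale sq ae_class_eqI)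
  qed
  moreover have "hnorm (L2 M) (L2_lift M \<phi> F) \<le> B * hnorm (L2 M) F" if F: "F \<in> hcarrier (L2 M)" for F
  proof -
    obtain f where f: "f \<in> square_integrable M" and F: "F = ae_class M f"
      using F by (auto simp: hcarrier_L2)
    have "sqrt (l2_normsq M (\<phi> f)) \<le> sqrt (B\<^sup>2 * l2_normsq M f)"
      using bound[OF f] by simp
    then show ?thesis
      using B by (simp add: F lift f sq hnorm_ae_class l2_normsq_def real_sqrt_mult)
  qed
  ultimately show ?thesis unfolding bounded_operator_def by blast
qed

section \<open>Functions with vanishing moments\<close>

text \<open>The complex measure \<open>B \<mapsto> \<integral>\<^sub>T\<^sub>\<in>\<^sub>B G\<close> vanishes on closed sets, whose indicators are pointwise limits of
continuous functions, and closed sets form a generator stable under intersections.\<close>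

lemma integral_set_zero_of_continuous:
  fixes G :: "'a \<Rightarrow> complex" and T :: "'a \<Rightarrow> 'e::euclidean_space"
  assumes G: "integrable M G" and T: "T \<in> borel_measurable M"
    and zero: "\<And>\<phi>. continuous_on UNIV \<phi> \<Longrightarrow> (\<forall>x. 0 \<le> \<phi> x \<and> \<phi> x \<le> 1) \<Longrightarrow> (\<integral>x. \<phi> (T x) *\<^sub>R G x \<partial>M) = 0"
    and B: "B \<in> sets borel"
  shows "(\<integral>x. indicator B (T x) *\<^sub>R G x \<partial>M) = 0"
proof -
  note [measurable] = T borel_measurable_integrable[OF G]
  have int: "integrable M (\<lambda>x. indicator A (T x) *\<^sub>R G x)" if A: "A \<in> sets borel" for A
  proof (rule Bochner_Integration.integrable_bound[OF G])
    note [measurable] = A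
    show "(\<lambda>x. indicator A (T x) *\<^sub>R G x) \<in> borel_measurable M" by measurable
  qed (auto simp: indicator_def)
  have closed: "(\<integral>x. indicator A (T x) *\<^sub>R G x \<partial>M) = 0" if A: "closed A" for A
  proof (cases "A = {}")
    case False
    \<comment> \<open>a continuous function that is 1 on \<open>A\<close> and 0 at distance at least \<open>1 / n\<close> from it\<close>
    define \<phi> where "\<phi> n y = max 0 (1 - real n * infdist y A)" for n y
    have cont: "continuous_on UNIV (\<phi> n)" for n
      unfolding \<phi>_def by (intro continuous_intros)
    have [measurable]: "\<phi> n \<in> borel_measurable borel" for n
      by (rule borel_measurable_continuous_onI[OF cont])
    have [measurable]: "A \<in> sets borel" using A by simp
    have bd: "0 \<le> \<phi> n y \<and> \<phi> n y \<le> 1" for n y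
      by (simp add: \<phi>_def infdist_nonneg)
    have lim: "(\<lambda>n. \<phi> n y) \<longlonglongrightarrow> indicator A y" for y
    proof (cases "y \<in> A")
      case True
      then show ?thesis by (simp add: \<phi>_def)
    next
      case F: False
      then have pos: "infdist y A > 0"
        using A False infdist_nonneg[of y A] in_closed_iff_infdist_zero[OF A False, of y] by linarith
      obtain N where N: "1 < real N * infdist y A"
        using reals_Archimedean3[OF pos] by blast
      have "\<forall>\<^sub>F n in sequentially. \<phi> n y = 0"
        using eventually_ge_at_top[of N]
      proof eventually_elim
        case (elim n)
        then have "real N * infdist y A \<le> real n * infdist y A"
          using pos by (intro mult_right_mono) auto
        then show ?case using N by (simp add: \<phi>_def)
      qed
      then show ?thesis using F by (simp add: tendsto_eventually)
    qed
    have lim_int: "(\<lambda>n. \<integral>x. \<phi> n (T x) *\<^sub>R G x \<partial>M) \<longlonglongrightarrow> (\<integral>x. indicator A (T x) *\<^sub>R G x \<partial>M)"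
    proof (rule integral_dominated_convergence)
      show "integrable M (\<lambda>x. norm (G x))" using G by simp
      show "AE x in M. (\<lambda>n. \<phi> n (T x) *\<^sub>R G x) \<longlonglongrightarrow> indicator A (T x) *\<^sub>R G x"
        by (intro AE_I2 tendsto_intros lim)
      show "AE x in M. norm (\<phi> n (T x) *\<^sub>R G x) \<le> norm (G x)" for n
        using bd by (auto intro!: mult_left_le_one_le)
      show "(\<lambda>x. \<phi> n (T x) *\<^sub>R G x) \<in> borel_measurable M" for n by measurable
      show "(\<lambda>x. indicator A (T x) *\<^sub>R G x) \<in> borel_measurable M" by measurable
    qed
    have "(\<integral>x. \<phi> n (T x) *\<^sub>R G x \<partial>M) = 0" for n
      using bd by (intro zero cont) auto
    then show ?thesis using LIMSEQ_unique[OF lim_int] by simp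
  qed simp
  have "Int_stable (Collect closed :: 'e set set)" "Collect closed \<subseteq> Pow (UNIV :: 'e set)"
    by (auto simp: Int_stable_def)
  moreover have "B \<in> sigma_sets UNIV (Collect closed)"
    using B by (simp add: borel_eq_closed sets_measure_of)
  ultimately show ?thesis
  proof (induction rule: sigma_sets_induct_disjoint)
    case (basic A)
    then show ?case using closed by simp
  next
    case (compl A)
    then have A: "A \<in> sets borel" by (simp add: borel_eq_closed sets_measure_of)
    have "(\<integral>x. indicator (UNIV - A) (T x) *\<^sub>R G x \<partial>M)
        = (\<integral>x. indicator UNIV (T x) *\<^sub>R G x - indicator A (T x) *\<^sub>R G x \<partial>M)"
      by (intro Bochner_Integration.integral_cong) (auto simp: indicator_def)
    also have "\<dots> = (\<integral>x. indicator UNIV (T x) *\<^sub>R G x \<partial>M) - (\<integral>x. indicator A (T x) *\<^sub>R G x \<partial>M)"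
      by (rule Bochner_Integration.integral_diff[OF int int[OF A]]) simp
    finally show ?case using compl closed[of UNIV] by (simp add: G)
  next
    case (union A)
    then have A: "A i \<in> sets borel" for i
      by (simp add: borel_eq_closed sets_measure_of subset_eq image_subset_iff)
    have lim_int: "(\<lambda>n. \<integral>x. indicator (\<Union>i<n. A i) (T x) *\<^sub>R G x \<partial>M) \<longlonglongrightarrow> (\<integral>x. indicator (\<Union>i. A i) (T x) *\<^sub>R G x \<partial>M)"
    proof (rule integral_dominated_convergence)
      show "integrable M (\<lambda>x. norm (G x))" using G by simp
      show "AE x in M. (\<lambda>n. indicator (\<Union>i<n. A i) (T x) *\<^sub>R G x) \<longlonglongrightarrow> indicator (\<Union>i. A i) (T x) *\<^sub>R G x"
        by (intro AE_I2 tendsto_intros LIMSEQ_indicator_UN)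
      show "AE x in M. norm (indicator (\<Union>i<n. A i) (T x) *\<^sub>R G x) \<le> norm (G x)" for n
        by (auto simp: indicator_def)
      show "(\<lambda>x. indicator (\<Union>i<n. A i) (T x) *\<^sub>R G x) \<in> borel_measurable M" for n
        by (intro borel_measurable_integrable int sets.finite_UN A) simp
      show "(\<lambda>x. indicator (\<Union>i. A i) (T x) *\<^sub>R G x) \<in> borel_measurable M"
        by (intro borel_measurable_integrable int sets.countable_UN) (use A in auto)
    qed
    have "(\<integral>x. indicator (\<Union>i<n. A i) (T x) *\<^sub>R G x \<partial>M) = 0" for n
    proof -
      have "(\<integral>x. indicator (\<Union>i<n. A i) (T x) *\<^sub>R G x \<partial>M) = (\<integral>x. (\<Sum>i<n. indicator (A i) (T x) *\<^sub>R G x) \<partial>M)"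
        using union(1) by (intro Bochner_Integration.integral_cong refl)
          (simp add: indicator_UN_disjoint disjoint_family_on_def scaleR_sum_left)
      also have "\<dots> = (\<Sum>i<n. (\<integral>x. indicator (A i) (T x) *\<^sub>R G x \<partial>M))"
        by (rule Bochner_Integration.integral_sum[OF int[OF A]])
      also have "\<dots> = 0" using union by simp
      finally show ?thesis .
    qed
    then show ?case using LIMSEQ_unique[OF lim_int] by simp
  qed (simp_all)
qed

text \<open>Continuous functions on \<open>K\<close> are uniform limits of polynomials.  The map \<open>T\<close> allows polynomials in a coordinate other than the variable of integration.\<close>

lemma integral_set_zero_of_moments:
  fixes G :: "'a \<Rightarrow> complex" and T :: "'a \<Rightarrow> 'e::euclidean_space"
  assumes G: "integrable M G" and T: "T \<in> borel_measurable M"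
    and K: "compact K" "\<And>x. x \<in> space M \<Longrightarrow> T x \<in> K"
    and zero: "\<And>p. real_polynomial_function p \<Longrightarrow> (\<integral>x. p (T x) *\<^sub>R G x \<partial>M) = 0"
    and B: "B \<in> sets borel"
  shows "(\<integral>x. indicator B (T x) *\<^sub>R G x \<partial>M) = 0"
proof (rule integral_set_zero_of_continuous[OF G T _ B])
  fix \<phi> :: "'e \<Rightarrow> real" assume \<phi>: "continuous_on UNIV \<phi>"
  note [measurable] = T borel_measurable_integrable[OF G]
  have int: "integrable M (\<lambda>x. p (T x) *\<^sub>R G x)" if p: "continuous_on UNIV p" for p :: "'e \<Rightarrow> real"
  proof -
    have [measurable]: "p \<in> borel_measurable borel" by (rule borel_measurable_continuous_onI[OF p])
    have "bounded (p ` K)"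
      using K(1) p by (intro compact_imp_bounded compact_continuous_image) (auto intro: continuous_on_subset)
    then obtain b where b: "\<And>y. y \<in> K \<Longrightarrow> \<bar>p y\<bar> \<le> b" by (auto simp: bounded_iff)
    show ?thesis
    proof (rule Bochner_Integration.integrable_bound)
      show "integrable M (\<lambda>x. b *\<^sub>R G x)" using G by simp
      show "AE x in M. norm (p (T x) *\<^sub>R G x) \<le> norm (b *\<^sub>R G x)"
        using b K(2) by (intro AE_I2) (auto intro!: mult_right_mono simp: order_trans[OF _ abs_ge_self])
    qed measurable
  qed
  have "cmod (\<integral>x. \<phi> (T x) *\<^sub>R G x \<partial>M) \<le> e * (\<integral>x. cmod (G x) \<partial>M)" if e: "e > 0" for e
  proof -
    obtain p where p: "real_polynomial_function p" and close: "\<And>y. y \<in> K \<Longrightarrow> \<bar>\<phi> y - p y\<bar> < e"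
      using Stone_Weierstrass_real_polynomial_function[OF K(1) continuous_on_subset[OF \<phi> subset_UNIV] e] by blast
    have pc: "continuous_on UNIV p"
      using p by (simp add: continuous_on_polymonial_function real_polynomial_function_eq)
    have "(\<integral>x. \<phi> (T x) *\<^sub>R G x \<partial>M) = (\<integral>x. \<phi> (T x) *\<^sub>R G x - p (T x) *\<^sub>R G x \<partial>M)"
      using zero[OF p] int[OF \<phi>] int[OF pc] by simp
    also have "cmod \<dots> \<le> (\<integral>x. e * cmod (G x) \<partial>M)"
    proof (rule order_trans[OF integral_norm_bound integral_mono])
      show "integrable M (\<lambda>x. cmod (\<phi> (T x) *\<^sub>R G x - p (T x) *\<^sub>R G x))"
        by (intro integrable_norm Bochner_Integration.integrable_diff int \<phi> pc)
      show "integrable M (\<lambda>x. e * cmod (G x))" using G by simp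
      fix x assume "x \<in> space M"
      then show "cmod (\<phi> (T x) *\<^sub>R G x - p (T x) *\<^sub>R G x) \<le> e * cmod (G x)"
        using close[OF K(2)[of x]]
        by (simp add: scaleR_diff_left[symmetric] mult_right_mono)
    qed
    finally show ?thesis by simp
  qed
  note le = this
  define I where "I = (\<integral>x. cmod (G x) \<partial>M)"
  have I: "I \<ge> 0" by (simp add: I_def)
  show "(\<integral>x. \<phi> (T x) *\<^sub>R G x \<partial>M) = 0"
  proof (rule ccontr)
    assume ne: "(\<integral>x. \<phi> (T x) *\<^sub>R G x \<partial>M) \<noteq> 0"
    define r where "r = cmod (\<integral>x. \<phi> (T x) *\<^sub>R G x \<partial>M)"
    have r: "r > 0" using ne by (simp add: r_def)
    have "r \<le> r / (2 * (I + 1)) * I"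
      using le[of "r / (2 * (I + 1))", folded r_def I_def] r I by simp
    moreover have "0 < I * r + r * 2"
      using r I by (intro add_nonneg_pos mult_nonneg_nonneg) auto
    then have "r / (2 * (I + 1)) * I < r"
      using I by (simp add: field_simps)
    ultimately show False by simp
  qed
qed

section \<open>Multiplication by the variable on the circle\<close>

definition circle_density :: "complex \<Rightarrow> real" where
  "circle_density z = pi / 2 * ((sech (pi * inv m_map z))\<^sup>2 / (cmod z)\<^sup>2)"

lemma circle_density_nonneg: "circle_density z \<ge> 0"
  by (simp add: circle_density_def)

lemma circle_density_pos: "z \<noteq> 0 \<Longrightarrow> circle_density z > 0"
  by (simp add: circle_density_def sech_def cosh_real_pos)

lemma mu_eq: "mu = density arc_length_measure (\<lambda>z. ennreal (circle_density z))"
  by (simp add: mu_def circle_density_def)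

lemma sets_arc: "sets arc_length_measure = sets (restrict_space borel (sphere 1 1))"
  by (simp add: arc_length_measure_def)

lemma space_arc: "space arc_length_measure = sphere 1 1"
  by (simp add: arc_length_measure_def space_restrict_space)

lemma space_mu: "space mu = sphere 1 1"
  by (simp add: mu_eq space_arc)

lemma measurable_arc_id [measurable]: "(\<lambda>z. z) \<in> borel_measurable arc_length_measure"
  by (simp add: arc_length_measure_def measurable_restrict_space1)

lemma circle_density_measurable [measurable]: "circle_density \<in> borel_measurable arc_length_measure"
proof -
  have "(\<lambda>z. enn2real (ennreal (circle_density z))) \<in> borel_measurable arc_length_measure"
    using measurable_mu_density unfolding circle_density_def[symmetric] by measurable
  then show ?thesis by (simp add: circle_density_nonneg)
qed

lemma AE_lebesgue_singleton: "AE x in lebesgue. x \<noteq> (c :: real)"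
  by (rule AE_completion[OF AE_lborel_singleton])

lemma finite_measure_arc: "finite_measure arc_length_measure"
proof -
  have "finite_measure (lebesgue_on {0..<2*pi})" 
    by (intro finite_measure_lebesgue_on bounded_set_imp_lmeasurable) auto
  then show ?thesis unfolding arc_length_measure_def
    by (rule finite_measure.finite_measure_distr[OF _ measurable_arc_length_param])
qed

lemma integral_arc:
  fixes f :: "complex \<Rightarrow> complex"
  assumes "f \<in> borel_measurable arc_length_measure"
  shows "(\<integral>z. f z \<partial>arc_length_measure) = (\<integral>\<theta>. f (1 + cis \<theta>) \<partial>lebesgue_on {0..<2*pi})"
  using assms unfolding arc_length_measure_def
  by (intro integral_distr measurable_arc_length_param) simp

text \<open>The origin is hit only by the angle \<open>\<pi>\<close>.\<close>

lemma AE_arc_nonzero: "AE z in arc_length_measure. z \<noteq> 0"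
proof -
  have m: "{z \<in> space (restrict_space borel (sphere 1 1)). z \<noteq> 0} \<in> sets (restrict_space borel (sphere (1::complex) 1))"
    by (auto simp: sets_restrict_space space_restrict_space)
  have "AE \<theta> in lebesgue_on {0..<2*pi}. \<theta> \<noteq> pi"
    by (subst AE_restrict_space_iff) (auto intro: AE_mp[OF AE_lebesgue_singleton])
  then have "AE \<theta> in lebesgue_on {0..<2*pi}. 1 + cis \<theta> \<noteq> 0"
    using AE_space
  proof eventually_elim
    case (elim \<theta>)
    show ?case
    proof
      assume "1 + cis \<theta> = 0"
      then have "cis (\<theta> - pi) = 1" by (simp add: cis_divide[symmetric] add_eq_0_iff)
      then have "cos (\<theta> - pi) = 1" by (simp add: complex_eq_iff)
      then obtain n::int where "\<theta> - pi = of_int n * 2 * pi"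
        unfolding cos_one_2pi_int by blast
      moreover have "- pi \<le> \<theta> - pi" "\<theta> - pi < pi" using elim by auto
      ultimately have "pi * (-1) \<le> pi * (2 * real_of_int n)" "pi * (2 * real_of_int n) < pi * 1"
        by (simp_all add: mult_ac)
      then have "-1 \<le> 2 * real_of_int n" "2 * real_of_int n < 1"
        unfolding mult_le_cancel_left_pos[OF pi_gt_zero] mult_less_cancel_left_pos[OF pi_gt_zero] .
      then have "n = 0" by linarith
      then show False using elim \<open>\<theta> - pi = of_int n * 2 * pi\<close> by simp
    qed
  qed
  then show ?thesis unfolding arc_length_measure_def
    by (subst AE_distr_iff[OF measurable_arc_length_param m])
qed

lemma integral_cis_multiple:
  "(\<integral>\<theta>. cis (real_of_int n * \<theta>) \<partial>lebesgue_on {0..<2*pi}) = (if n = 0 then 2 * complex_of_real pi else 0)"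
proof (cases "n = 0")
  case True
  then show ?thesis by (simp add: lebesgue_integral_const measure_restrict_space scaleR_conv_of_real)
next
  case False
  have "(\<integral>\<theta>. cis (real_of_int n * \<theta>) \<partial>lebesgue_on {0..<2*pi})
      = (\<integral>\<theta>. indicator {0..<2*pi} \<theta> *\<^sub>R cis (real_of_int n * \<theta>) \<partial>lebesgue)"
    by (rule integral_restrict_space) simp
  also have "\<dots> = (\<integral>\<theta>. indicator {0..2*pi} \<theta> *\<^sub>R cis (real_of_int n * \<theta>) \<partial>lebesgue)"
  proof (rule integral_cong_AE)
    show "AE \<theta> in lebesgue. indicator {0..<2*pi} \<theta> *\<^sub>R cis (real_of_int n * \<theta>)
       = indicator {0..2*pi} \<theta> *\<^sub>R cis (real_of_int n * \<theta>)"
      using AE_lebesgue_singleton[of "2 * pi"] by eventually_elim (auto simp: indicator_def)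
    have [measurable]: "(\<lambda>\<theta>. cis (real_of_int n * \<theta>)) \<in> borel_measurable borel"
      by (intro borel_measurable_continuous_onI continuous_intros)
    have "(\<lambda>\<theta>. indicator A \<theta> *\<^sub>R cis (real_of_int n * \<theta>)) \<in> borel_measurable borel"
      if [measurable]: "A \<in> sets borel" for A by measurable
    then show "(\<lambda>\<theta>. indicator {0..<2*pi} \<theta> *\<^sub>R cis (real_of_int n * \<theta>)) \<in> borel_measurable lebesgue"
      "(\<lambda>\<theta>. indicator {0..2*pi} \<theta> *\<^sub>R cis (real_of_int n * \<theta>)) \<in> borel_measurable lebesgue"
      by (intro measurable_completion; simp)+
  qed
  also have "\<dots> = (\<integral>\<theta>. indicator {0..2*pi} \<theta> *\<^sub>R cis (real_of_int n * \<theta>) \<partial>lborel)"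
  proof (rule integral_completion)
    have "(\<lambda>\<theta>. cis (real_of_int n * \<theta>)) \<in> borel_measurable borel"
      by (intro borel_measurable_continuous_onI continuous_intros)
    then have [measurable]: "(\<lambda>\<theta>. cis (real_of_int n * \<theta>)) \<in> borel_measurable lborel" by simp
    show "(\<lambda>\<theta>. indicator {0..2*pi} \<theta> *\<^sub>R cis (real_of_int n * \<theta>)) \<in> borel_measurable lborel"
      by measurable
  qed
  also have "\<dots> = cis (real_of_int n * (2*pi)) / (\<i> * of_int n) - cis (real_of_int n * 0) / (\<i> * of_int n)"
  proof (rule integral_FTC_atLeastAtMost)
    show "((\<lambda>\<theta>. cis (real_of_int n * \<theta>) / (\<i> * of_int n)) has_vector_derivative cis (real_of_int n * x)) (at x within {0..2*pi})" for x
    proof -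
      have rotate: "- (\<i> * (y * \<i>)) = y" for y :: complex by (simp add: complex_eq_iff)
      have "((\<lambda>w. exp (\<i> * (of_int n * w)) / (\<i> * of_int n)) has_field_derivative exp (\<i> * (of_int n * of_real x)))
          (at (of_real x))"
        using False rotate by (auto intro!: derivative_eq_intros)
      from has_vector_derivative_real_field[OF this] show ?thesis
        by (simp add: cis_conv_exp)
    qed
  qed (auto intro!: continuous_intros)
  also have "\<dots> = 0"
  proof -
    have "cis (real_of_int n * (2 * pi)) = 1"
      using cos_int_2pin[of n] sin_int_2pin[of n] by (simp add: complex_eq_iff mult_ac)
    then show ?thesis by simp
  qed
  finally show ?thesis using False by simp
qed

lemma circle_point:
  assumes "z \<in> sphere 1 (1::real)"
  shows "cmod (z - 1) = 1" "z - 1 \<noteq> 0" "cnj (z - 1) = inverse (z - 1)"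
proof -
  show n: "cmod (z - 1) = 1" using assms by (simp add: dist_norm norm_minus_commute)
  then show ne: "z - 1 \<noteq> 0" by auto
  have "(z - 1) * cnj (z - 1) = 1" unfolding mult_cnj_self n by simp
  then show "cnj (z - 1) = inverse (z - 1)" using ne by (metis inverse_unique)
qed

lemma measurable_circle_powi [measurable]: "(\<lambda>z. (z - 1) powi n) \<in> borel_measurable arc_length_measure"
proof -
  have "continuous_on (sphere 1 1) (\<lambda>z::complex. (z - 1) powi n)"
    by (intro continuous_intros) (use circle_point in auto)
  then have "(\<lambda>z::complex. (z - 1) powi n) \<in> borel_measurable (restrict_space borel (sphere 1 1))"
    by (rule borel_measurable_continuous_on_restrict)
  then show ?thesis by (simp add: arc_length_measure_def)
qed

lemma integral_circle_powi:
  "(\<integral>z. (z - 1) powi n \<partial>arc_length_measure) = (if n = 0 then 2 * complex_of_real pi else 0)"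
  by (subst integral_arc) (simp_all add: cis_power_int integral_cis_multiple)

text \<open>Powers of \<open>z - 1\<close> are the characters of the circle, so these are the Fourier coefficients of \<open>G\<close>.\<close>

definition circle_moments_vanish :: "(complex \<Rightarrow> complex) \<Rightarrow> bool" where
  "circle_moments_vanish G \<longleftrightarrow> integrable arc_length_measure G \<and>
     (\<forall>n::int. (\<integral>z. (z - 1) powi n * G z \<partial>arc_length_measure) = 0)"

lemma integrable_circle_powi:
  assumes "integrable arc_length_measure G"
  shows "integrable arc_length_measure (\<lambda>z. (z - 1) powi n * G z)"
proof (rule Bochner_Integration.integrable_bound[OF assms])
  have [measurable]: "G \<in> borel_measurable arc_length_measure" using assms by simp
  show "(\<lambda>z. (z - 1) powi n * G z) \<in> borel_measurable arc_length_measure" by measurable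
  show "AE z in arc_length_measure. norm ((z - 1) powi n * G z) \<le> norm (G z)"
    by (rule AE_I2) (simp add: space_arc norm_mult norm_power_int circle_point(1))
qed

text \<open>With \<open>w = z - 1\<close>, a real linear form in \<open>z\<close> restricts on the circle to a combination of 1, \<open>w\<close> and
\<open>w\<^sup>-\<^sup>1\<close>, so multiplication by it only mixes neighbouring Fourier coefficients.  Letting \<open>G\<close> vary in the
induction makes the claim pass to products of polynomials.\<close>

lemma circle_moments_vanish_polynomial:
  assumes "real_polynomial_function p" "circle_moments_vanish G"
  shows "circle_moments_vanish (\<lambda>z. p z *\<^sub>R G z)"
  using assms
proof (induction arbitrary: G rule: real_polynomial_function.induct)
  case (linear p)
  have int: "integrable arc_length_measure (\<lambda>z. (z - 1) powi n * G z)" for n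
    using linear(2) by (auto simp: circle_moments_vanish_def integrable_circle_powi)
  have moment: "(\<integral>z. (z - 1) powi n * G z \<partial>arc_length_measure) = 0" for n
    using linear(2) by (simp add: circle_moments_vanish_def)
  interpret bounded_linear p by fact
  \<comment> \<open>\<open>Re z = 1 + (w + 1/w) / 2\<close> and \<open>Im z = (w - 1/w) / (2 \<i>)\<close> for \<open>w = z - 1\<close>\<close>
  define \<beta> where "\<beta> = (p 1 - \<i> * p \<i>) / 2"
  define \<gamma> where "\<gamma> = (p 1 + \<i> * p \<i>) / 2"
  have p: "complex_of_real (p z) = p 1 + \<beta> * (z - 1) + \<gamma> * inverse (z - 1)"
    if "z \<in> sphere 1 1" for z
  proof -
    have "z = Re z *\<^sub>R 1 + Im z *\<^sub>R \<i>" by (simp add: complex_eq_iff)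
    then have "p z = p (Re z *\<^sub>R 1 + Im z *\<^sub>R \<i>)" by (rule arg_cong)
    also have "\<dots> = Re z * p 1 + Im z * p \<i>" by (simp add: add scale)
    finally show ?thesis
      unfolding circle_point(3)[OF that, symmetric]
      by (simp add: \<beta>_def \<gamma>_def complex_eq_iff field_simps)
  qed
  have eq: "(z - 1) powi n * (p z *\<^sub>R G z)
      = p 1 * ((z - 1) powi n * G z) + \<beta> * ((z - 1) powi (n + 1) * G z) + \<gamma> * ((z - 1) powi (n - 1) * G z)"
    if z: "z \<in> space arc_length_measure" for z n
  proof -
    have z: "z \<in> sphere 1 1" using z by (simp add: space_arc)
    have step: "(z - 1) powi (n + 1) = (z - 1) powi n * (z - 1)"
      "(z - 1) powi (n - 1) = (z - 1) powi n * inverse (z - 1)"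
      using circle_point(2)[OF z] by (simp_all add: power_int_add power_int_diff divide_inverse)
    show ?thesis unfolding scaleR_conv_of_real p[OF z] step by (simp add: algebra_simps)
  qed
  have "integrable arc_length_measure (\<lambda>z. p 1 * ((z - 1) powi 0 * G z)
      + \<beta> * ((z - 1) powi (0 + 1) * G z) + \<gamma> * ((z - 1) powi (0 - 1) * G z))"
    by (intro Bochner_Integration.integrable_add integrable_mult_right int)
  then have "integrable arc_length_measure (\<lambda>z. (z - 1) powi 0 * (p z *\<^sub>R G z))"
    by (subst Bochner_Integration.integrable_cong[OF refl eq])
  moreover have "(\<integral>z. (z - 1) powi n * (p z *\<^sub>R G z) \<partial>arc_length_measure) = 0" for n
  proof -
    have "(\<integral>z. (z - 1) powi n * (p z *\<^sub>R G z) \<partial>arc_length_measure)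
        = (\<integral>z. p 1 * ((z - 1) powi n * G z) + \<beta> * ((z - 1) powi (n + 1) * G z)
            + \<gamma> * ((z - 1) powi (n - 1) * G z) \<partial>arc_length_measure)"
      by (rule Bochner_Integration.integral_cong[OF refl eq])
    also have "\<dots> = p 1 * (\<integral>z. (z - 1) powi n * G z \<partial>arc_length_measure)
        + \<beta> * (\<integral>z. (z - 1) powi (n + 1) * G z \<partial>arc_length_measure)
        + \<gamma> * (\<integral>z. (z - 1) powi (n - 1) * G z \<partial>arc_length_measure)"
      by (simp add: int)
    also have "\<dots> = 0" unfolding moment by simp
    finally show ?thesis .
  qed
  ultimately show ?case by (simp add: circle_moments_vanish_def)
next
  case (const c)
  then show ?case by (simp add: circle_moments_vanish_def)
next
  case (add p q)
  have "circle_moments_vanish (\<lambda>z. p z *\<^sub>R G z)" "circle_moments_vanish (\<lambda>z. q z *\<^sub>R G z)"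
    by (intro add.IH add.prems)+
  then show ?case
    by (simp add: circle_moments_vanish_def scaleR_add_left distrib_left integrable_circle_powi
        del: mult_scaleR_right)
next
  case (mult p q)
  have "circle_moments_vanish (\<lambda>z. p z *\<^sub>R (q z *\<^sub>R G z))"
    by (intro mult.IH mult.prems)
  then show ?case by simp
qed

lemma circle_moments_vanish_imp_zero:
  assumes "circle_moments_vanish G"
  shows "AE z in arc_length_measure. G z = 0"
proof -
  have G: "integrable arc_length_measure G" using assms by (simp add: circle_moments_vanish_def)
  interpret finite_measure arc_length_measure by (rule finite_measure_arc)
  have "(\<integral>z. p z *\<^sub>R G z \<partial>arc_length_measure) = 0" if "real_polynomial_function p" for p
    using circle_moments_vanish_polynomial[OF that assms]
    by (auto simp: circle_moments_vanish_def dest!: spec[of _ 0])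
  then have zero: "(\<integral>z. indicator B z *\<^sub>R G z \<partial>arc_length_measure) = 0" if "B \<in> sets borel" for B
    by (intro integral_set_zero_of_moments[of _ _ "\<lambda>z. z" "sphere 1 1", OF G _ _ _ _ that])
      (auto simp: space_arc)
  show ?thesis
  proof (rule density_unique_banach[OF G])
    show "integrable arc_length_measure (\<lambda>z. 0 :: complex)" by simp
    fix A assume "A \<in> sets arc_length_measure"
    then obtain B where "B \<in> sets borel" "A = sphere 1 1 \<inter> B"
      by (auto simp: sets_arc sets_restrict_space)
    then have "A \<in> sets borel" by simp
    from zero[OF this] show "(LINT x:A|arc_length_measure. G x) = (LINT x:A|arc_length_measure. 0)"
      by (simp add: set_lebesgue_integral_def)
  qed
qed

lemma l2_inner_mu:
  assumes [measurable]: "f \<in> borel_measurable mu" "g \<in> borel_measurable mu"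
  shows "l2_inner mu f g
    = (\<integral>z. circle_density z *\<^sub>R (f z * cnj (g z)) \<partial>arc_length_measure)"
proof -
  have [measurable]: "f \<in> borel_measurable arc_length_measure" "g \<in> borel_measurable arc_length_measure"
    using assms by (simp_all cong: measurable_cong_sets add: mu_eq)
  show ?thesis unfolding l2_inner_def mu_eq
    by (intro integral_density) (measurable, simp add: circle_density_nonneg)
qed

lemma square_integrable_mu:
  assumes [measurable]: "f \<in> borel_measurable arc_length_measure"
  shows "f \<in> square_integrable mu
    \<longleftrightarrow> integrable arc_length_measure (\<lambda>z. circle_density z * (cmod (f z))\<^sup>2)"
proof -
  have "f \<in> borel_measurable mu" by (simp add: mu_eq)
  moreover have "integrable mu (\<lambda>z. (cmod (f z))\<^sup>2)
      \<longleftrightarrow> integrable arc_length_measure (\<lambda>z. circle_density z *\<^sub>R (cmod (f z))\<^sup>2)"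
    unfolding mu_eq by (rule integrable_density) (measurable, simp add: circle_density_nonneg)
  ultimately show ?thesis by (simp add: square_integrable_def)
qed

definition mu_basis :: "int \<Rightarrow> complex \<Rightarrow> complex" where
  "mu_basis n z = (z - 1) powi n / complex_of_real (sqrt (2 * pi * circle_density z))"

lemma measurable_mu_basis [measurable]: "mu_basis n \<in> borel_measurable arc_length_measure"
  unfolding mu_basis_def by measurable

lemma density_mu_basis:
  assumes "z \<in> sphere 1 1" "z \<noteq> 0"
  shows "circle_density z * (cmod (mu_basis n z))\<^sup>2 = 1 / (2 * pi)"
  using assms circle_density_pos[of z] circle_point(1)[of z]
  by (simp add: mu_basis_def norm_divide norm_power_int power_divide)

lemma square_integrable_mu_basis: "mu_basis n \<in> square_integrable mu"
proof (subst square_integrable_mu)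
  interpret finite_measure arc_length_measure by (rule finite_measure_arc)
  show "integrable arc_length_measure (\<lambda>z. circle_density z * (cmod (mu_basis n z))\<^sup>2)"
  proof (rule integrable_const_bound)
    show "AE z in arc_length_measure. norm (circle_density z * (cmod (mu_basis n z))\<^sup>2) \<le> 1 / (2 * pi)"
      using AE_arc_nonzero AE_space
    proof eventually_elim
      case (elim z)
      then show ?case using density_mu_basis[of z n] by (simp only: space_arc) simp
    qed
  qed measurable
qed measurable

lemma orthonormal_mu_basis: "orthonormal mu mu_basis"
  unfolding orthonormal_def
proof (intro conjI allI)
  fix m n
  have "l2_inner mu (mu_basis m) (mu_basis n)
      = (\<integral>z. circle_density z *\<^sub>R (mu_basis m z * cnj (mu_basis n z)) \<partial>arc_length_measure)"
    by (intro l2_inner_mu square_integrable_measurable square_integrable_mu_basis)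
  also have "\<dots> = (\<integral>z. (1 / (2 * complex_of_real pi)) * (z - 1) powi (m - n) \<partial>arc_length_measure)"
  proof (rule integral_cong_AE)
    show "AE z in arc_length_measure. circle_density z *\<^sub>R (mu_basis m z * cnj (mu_basis n z))
        = (1 / (2 * complex_of_real pi)) * (z - 1) powi (m - n)"
      using AE_arc_nonzero AE_space
    proof eventually_elim
      case (elim z)
      then have z: "z \<in> sphere 1 1" by (simp add: space_arc)
      have pos: "circle_density z > 0" using circle_density_pos elim by simp
      define w where "w = z - 1"
      have w: "w \<noteq> 0" "cnj w = inverse w" using circle_point[OF z] by (simp_all add: w_def)
      define s where "s = complex_of_real (sqrt (2 * pi * circle_density z))"
      have s: "s * s = 2 * complex_of_real pi * complex_of_real (circle_density z)" "cnj s = s"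
        using pos by (simp_all only: s_def complex_cnj_complex_of_real of_real_mult[symmetric])
          (simp_all)
      have "mu_basis m z * cnj (mu_basis n z) = (w powi m * cnj w powi n) / (s * s)"
        by (simp add: mu_basis_def w_def[symmetric] s_def[symmetric] s(2))
      also have "w powi m * cnj w powi n = w powi (m - n)"
        using w by (simp add: power_int_diff power_int_inverse divide_inverse)
      finally show ?case
        using pos by (simp add: s(1) scaleR_conv_of_real w_def)
    qed
  qed measurable
  also have "\<dots> = (if m = n then 1 else 0)"
    by (simp add: integral_circle_powi)
  finally show "l2_inner mu (mu_basis m) (mu_basis n) = (if m = n then 1 else 0)" .
qed (rule square_integrable_mu_basis)

text \<open>A function orthogonal to the basis, multiplied by the square root of the density, is square-integrable for
arc length, hence integrable, and all its Fourier coefficients vanish.\<close>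

lemma orthonormal_basis_mu_basis: "orthonormal_basis mu mu_basis"
  unfolding orthonormal_basis_def
proof (intro conjI ballI impI orthonormal_mu_basis)
  fix f assume f: "f \<in> square_integrable mu" and zero: "\<forall>n. l2_inner mu f (mu_basis n) = 0"
  have fmu: "f \<in> borel_measurable mu" using f by (rule square_integrable_measurable)
  then have [measurable]: "f \<in> borel_measurable arc_length_measure"
    by (simp cong: measurable_cong_sets add: mu_eq)
  interpret finite_measure arc_length_measure by (rule finite_measure_arc)
  define G where "G z = complex_of_real (sqrt (circle_density z)) * f z" for z
  have [measurable]: "G \<in> borel_measurable arc_length_measure"
    unfolding G_def by measurable
  have "integrable arc_length_measure (\<lambda>z. (cmod (G z))\<^sup>2)"
    using f by (simp add: square_integrable_mu G_def norm_mult power_mult_distrib circle_density_nonneg)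
  then have "G \<in> square_integrable arc_length_measure" by (simp add: square_integrable_def)
  moreover have "(\<lambda>z. 1) \<in> square_integrable arc_length_measure" by (simp add: square_integrable_def)
  ultimately have int: "integrable arc_length_measure G"
    using integrable_l2_prod by fastforce
  have "(\<integral>z. (z - 1) powi n * G z \<partial>arc_length_measure) = 0" for n
  proof -
    have "(\<integral>z. (z - 1) powi n * G z \<partial>arc_length_measure)
        = (\<integral>z. complex_of_real (sqrt (2 * pi)) * (circle_density z *\<^sub>R (f z * cnj (mu_basis (- n) z))) \<partial>arc_length_measure)"
    proof (rule integral_cong_AE)
      show "AE z in arc_length_measure. (z - 1) powi n * G z
          = complex_of_real (sqrt (2 * pi)) * (circle_density z *\<^sub>R (f z * cnj (mu_basis (- n) z)))"
        using AE_arc_nonzero AE_space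
      proof eventually_elim
        case (elim z)
        then have z: "z \<in> sphere 1 1" by (simp add: space_arc)
        have pos: "circle_density z > 0" using circle_density_pos elim by simp
        define w where "w = z - 1"
        have w: "w \<noteq> 0" "cnj w = inverse w" using circle_point[OF z] by (simp_all add: w_def)
        define r where "r = sqrt (circle_density z)"
        have r: "r > 0" "circle_density z = r * r" using pos by (simp_all add: r_def)
        have "cnj (mu_basis (- n) z) = cnj w powi (- n) / complex_of_real (sqrt (2 * pi) * r)"
          by (simp add: mu_basis_def w_def[symmetric] r_def real_sqrt_mult)
        also have "cnj w powi (- n) = w powi n"
          using w by (simp add: power_int_minus power_int_inverse)
        finally show ?case
          using r by (simp add: G_def w_def[symmetric] r_def[symmetric] scaleR_conv_of_real)
      qed
    qed measurable
    also have "\<dots> = complex_of_real (sqrt (2 * pi)) * l2_inner mu f (mu_basis (- n))"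
      unfolding l2_inner_mu[OF fmu square_integrable_measurable[OF square_integrable_mu_basis]]
      by (rule integral_mult_right_zero)
    finally show ?thesis using zero by simp
  qed
  then have "circle_moments_vanish G" using int by (simp add: circle_moments_vanish_def)
  then have "AE z in arc_length_measure. G z = 0" by (rule circle_moments_vanish_imp_zero)
  then have "AE z in arc_length_measure. f z = 0"
    using AE_arc_nonzero
  proof eventually_elim
    case (elim z)
    then show ?case using circle_density_pos[of z] by (simp add: G_def)
  qed
  then show "AE z in mu. f z = 0"
    unfolding mu_eq by (subst AE_density) (measurable, auto)
qed

lemma AE_mu_circle: "AE z in mu. z \<in> sphere 1 1"
  by (rule AE_I2) (simp add: space_mu)

lemma measurable_mu_id [measurable]: "(\<lambda>z. z) \<in> borel_measurable mu"
  by (simp add: mu_eq)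

lemma square_integrable_mult_z:
  assumes f: "f \<in> square_integrable mu"
  shows "(\<lambda>z. z * f z) \<in> square_integrable mu" "l2_normsq mu (\<lambda>z. z * f z) \<le> 2\<^sup>2 * l2_normsq mu f"
proof -
  have [measurable]: "f \<in> borel_measurable mu" using f by (rule square_integrable_measurable)
  have bd: "cmod z \<le> 2" if "z \<in> sphere 1 1" for z
    using norm_triangle_ineq[of "z - 1" 1] circle_point(1)[OF that] by simp
  show sq: "(\<lambda>z. z * f z) \<in> square_integrable mu"
  proof (rule square_integrable_bounded_by[OF f])
    show "AE z in mu. cmod (z * f z) \<le> 2 * cmod (f z)"
      using AE_mu_circle by eventually_elim (simp only: norm_mult bd mult_right_mono norm_ge_zero)
  qed measurable
  have "l2_normsq mu (\<lambda>z. z * f z) \<le> (\<integral>z. 2\<^sup>2 * (cmod (f z))\<^sup>2 \<partial>mu)"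
    unfolding l2_normsq_def
  proof (rule integral_mono_AE)
    show "AE z in mu. (cmod (z * f z))\<^sup>2 \<le> 2\<^sup>2 * (cmod (f z))\<^sup>2"
      using AE_mu_circle
    proof eventually_elim
      case (elim z)
      then show ?case unfolding norm_mult power_mult_distrib by (intro mult_right_mono power_mono bd) auto
    qed
  qed (use f sq in \<open>auto simp: square_integrable_def\<close>)
  then show "l2_normsq mu (\<lambda>z. z * f z) \<le> 2\<^sup>2 * l2_normsq mu f" by (simp add: l2_normsq_def)
qed

lemma mult_z_ae_class:
  assumes "f \<in> square_integrable mu"
  shows "mult_z (ae_class mu f) = ae_class mu (\<lambda>z. z * f z)"
  unfolding mult_z_def by (rule L2_lift_ae_class[OF assms square_integrable_mult_z(1)]) auto

lemma bounded_operator_mult_z: "bounded_operator (L2 mu) mult_z"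
  unfolding mult_z_def
  by (rule bounded_operator_L2_lift[where B = 2])
    (rule square_integrable_mult_z, assumption | force simp: algebra_simps)+

text \<open>On the circle the conjugate of \<open>z\<close> is \<open>1 + (z - 1)\<^sup>-\<^sup>1\<close>.\<close>

lemma l2_inner_mult_z_mu_basis:
  assumes f: "f \<in> square_integrable mu"
  shows "l2_inner mu (\<lambda>z. z * f z) (mu_basis n)
    = l2_inner mu f (mu_basis n) + l2_inner mu f (mu_basis (n - 1))"
proof -
  have [measurable]: "f \<in> borel_measurable mu" using f by (rule square_integrable_measurable)
  note [measurable] = square_integrable_mu_basis[THEN square_integrable_measurable]
  have "l2_inner mu (\<lambda>z. z * f z) (mu_basis n)
      = l2_inner mu f (\<lambda>z. mu_basis n z + mu_basis (n - 1) z)"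
    unfolding l2_inner_def
  proof (rule integral_cong_AE)
    show "AE z in mu. z * f z * cnj (mu_basis n z) = f z * cnj (mu_basis n z + mu_basis (n - 1) z)"
      using AE_mu_circle
    proof eventually_elim
      case (elim z)
      have "cnj z = 1 + inverse (z - 1)" using circle_point(3)[OF elim] by (simp add: algebra_simps)
      moreover have "mu_basis n z + mu_basis (n - 1) z = (1 + inverse (z - 1)) * mu_basis n z"
        using circle_point(2)[OF elim]
        by (simp add: mu_basis_def power_int_diff divide_inverse algebra_simps)
      ultimately have "mu_basis n z + mu_basis (n - 1) z = cnj z * mu_basis n z" by simp
      then show ?case by simp
    qed
  qed measurable
  then show ?thesis by (simp add: l2_inner_add_right f square_integrable_mu_basis)
qed

section \<open>The kernel of the Cesaro operator and its adjoint\<close>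

text \<open>An opaque name for the measure keeps measurability proofs from descending into the completion of Borel
measure.\<close>

definition interval01 :: "real measure" where
  "interval01 = lebesgue_on {0<..<1}"

lemma space_interval01 [simp]: "space interval01 = {0<..<1}"
  by (simp add: interval01_def)

lemma measurable_interval01_id [measurable]: "(\<lambda>x. x) \<in> borel_measurable interval01"
  unfolding interval01_def by (intro measurable_restrict_space1 measurable_completion) simp

lemma finite_measure_interval01: "finite_measure interval01"
  unfolding interval01_def by (intro finite_measure_lebesgue_on bounded_set_imp_lmeasurable) auto

interpretation interval01: finite_measure interval01
  by (rule finite_measure_interval01)

interpretation interval01_pair: pair_sigma_finite interval01 interval01 ..

lemma AE_interval01_neq: "AE t in interval01. t \<noteq> c"
  unfolding interval01_def
  by (subst AE_restrict_space_iff) (use AE_lebesgue_singleton[of c] in auto)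

lemma has_bochner_integral_interval01_FTC:
  fixes f F :: "real \<Rightarrow> real"
  assumes ab: "0 < a" "a \<le> b" "b \<le> 1"
    and F: "\<And>x. a \<le> x \<Longrightarrow> x \<le> b \<Longrightarrow> (F has_real_derivative f x) (at x)"
    and f: "continuous_on {a..b} f"
  shows "has_bochner_integral interval01 (\<lambda>x. indicator {a<..<b} x * f x) (F b - F a)"
proof -
  have int: "integrable lborel (\<lambda>x. indicator {a..b} x * f x)"
    using borel_integrable_atLeastAtMost'[OF f] by (simp add: set_integrable_def)
  have val: "(\<integral>x. indicator {a..b} x * f x \<partial>lborel) = F b - F a"
    using integral_FTC_atLeastAtMost[OF ab(2), of F f] F f
    by (simp add: has_real_derivative_iff_has_vector_derivative has_vector_derivative_at_within)
  define g where "g x = indicator {a..b} x * f x" for x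
  have g: "integrable lborel g" "integral\<^sup>L lborel g = F b - F a"
    using int val by (simp_all add: g_def[abs_def])
  have [measurable]: "g \<in> borel_measurable borel"
    using borel_measurable_integrable[OF g(1)] by simp
  define h where "h x = indicator {a<..<b} x * g x" for x
  have h_meas: "h \<in> borel_measurable borel" unfolding h_def by measurable
  have "has_bochner_integral lborel h (F b - F a)"
  proof (subst has_bochner_integral_cong_AE)
    show "AE x in lborel. h x = g x"
      using AE_lborel_singleton[of a] AE_lborel_singleton[of b]
      by eventually_elim (auto simp: h_def g_def indicator_def)
    show "has_bochner_integral lborel g (F b - F a)" using g by (simp add: has_bochner_integral_iff)
  qed (use h_meas in simp_all)
  then have "has_bochner_integral lebesgue h (F b - F a)"
    using h_meas by (simp add: has_bochner_integral_iff integrable_completion integral_completion)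
  moreover have "h = (\<lambda>x. indicator {0<..<1} x *\<^sub>R (indicator {a<..<b} x * f x))"
    using ab by (auto simp: h_def g_def indicator_def)
  ultimately show ?thesis
    unfolding interval01_def has_bochner_integral_iff
    by (simp add: integrable_restrict_space integral_restrict_space)
qed

definition cesaro_kernel :: "real \<Rightarrow> real \<Rightarrow> real" where
  "cesaro_kernel x t = (if 0 < t \<and> t < x \<and> x < 1 then 1 / (x * (1 - t)) else 0)"

lemma cesaro_kernel_nonneg [simp]: "cesaro_kernel x t \<ge> 0"
  by (simp add: cesaro_kernel_def)

lemma cesaro_kernel_measurable [measurable]:
  assumes [measurable]: "f \<in> borel_measurable M" "g \<in> borel_measurable M"
  shows "(\<lambda>p. cesaro_kernel (f p) (g p)) \<in> borel_measurable M"
  unfolding cesaro_kernel_def by measurable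

lemma cesaro_kernel_reflect: "cesaro_kernel (1 - t) (1 - x) = cesaro_kernel x t"
  by (simp add: cesaro_kernel_def mult.commute)

lemma cesaro_kernel_le_column:
  assumes "0 < t" "t < 1" shows "cesaro_kernel x t \<le> 1 / (t * (1 - t))"
  using assms by (auto simp: cesaro_kernel_def intro!: divide_left_mono mult_right_mono mult_pos_pos)

lemma cesaro_kernel_le_row:
  assumes "0 < x" "x < 1" shows "cesaro_kernel x t \<le> 1 / (x * (1 - x))"
  using assms by (auto simp: cesaro_kernel_def intro!: divide_left_mono mult_left_mono mult_pos_pos)

lemma DERIV_minus_inverse: "x > 0 \<Longrightarrow> ((\<lambda>x. - (1 / x)) has_real_derivative 1 / x\<^sup>2) (at x)"
  by (auto intro!: derivative_eq_intros simp: power2_eq_square)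

text \<open>The left-hand side integrates the kernel of \<open>C\<^sup>* C\<close>, the right-hand side is the kernel of \<open>C + C\<^sup>*\<close>.  Beyond
\<open>max s t\<close> the integrand is a multiple of \<open>1 / x\<^sup>2\<close>.  On the diagonal the identity fails, but the diagonal
is a null set.\<close>

lemma has_bochner_integral_cesaro_kernel_product:
  assumes s: "0 < s" "s < 1" and t: "0 < t" "t < 1" and ne: "s \<noteq> t"
  shows "has_bochner_integral interval01 (\<lambda>x. cesaro_kernel x s * cesaro_kernel x t)
    (cesaro_kernel t s + cesaro_kernel s t)"
proof -
  define c where "c = 1 / ((1 - s) * (1 - t))"
  have "has_bochner_integral interval01 (\<lambda>x. indicator {max s t<..<1} x * (1 / x\<^sup>2)) (- (1 / 1) - - (1 / max s t))"
    by (rule has_bochner_integral_interval01_FTC)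
      (use s t DERIV_minus_inverse in \<open>auto intro!: continuous_intros\<close>)
  then have "has_bochner_integral interval01 (\<lambda>x. c * (indicator {max s t<..<1} x * (1 / x\<^sup>2))) (c * (- (1 / 1) - - (1 / max s t)))"
    by (intro has_bochner_integral_mult_right)
  moreover have "cesaro_kernel x s * cesaro_kernel x t = c * (indicator {max s t<..<1} x * (1 / x\<^sup>2))" for x
    using s t by (auto simp: cesaro_kernel_def c_def indicator_def power2_eq_square)
  moreover have "c * (- (1 / 1) - - (1 / max s t)) = cesaro_kernel t s + cesaro_kernel s t"
  proof -
    have "1 / ((1 - u) * (1 - v)) * (1 / v - 1) = 1 / (v * (1 - u))"
      if "u \<noteq> 1" "v \<noteq> 1" "v \<noteq> 0" for u v :: real
    proof -
      have "1 / v - 1 = (1 - v) / v" using that by (simp add: field_simps)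
      then show ?thesis using that by simp
    qed
    from this[of s t] this[of t s] show ?thesis
      using s t ne by (auto simp: cesaro_kernel_def c_def max_def mult.commute)
  qed
  ultimately show ?thesis by simp
qed

text \<open>The operator and its adjoint on functions with values in \<open>[0, \<infinity>]\<close>, where Tonelli's theorem applies before
anything is known to be integrable.\<close>

definition nn_cesaro :: "(real \<Rightarrow> ennreal) \<Rightarrow> real \<Rightarrow> ennreal" where
  "nn_cesaro h x = (\<integral>\<^sup>+t. ennreal (cesaro_kernel x t) * h t \<partial>interval01)"

definition nn_cesaro_adj :: "(real \<Rightarrow> ennreal) \<Rightarrow> real \<Rightarrow> ennreal" where
  "nn_cesaro_adj h t = (\<integral>\<^sup>+x. ennreal (cesaro_kernel x t) * h x \<partial>interval01)"

lemma nn_cesaro_measurable [measurable]: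
  assumes [measurable]: "h \<in> borel_measurable interval01"
  shows "nn_cesaro h \<in> borel_measurable interval01"
  unfolding nn_cesaro_def by measurable

lemma nn_cesaro_adj_measurable [measurable]:
  assumes [measurable]: "h \<in> borel_measurable interval01"
  shows "nn_cesaro_adj h \<in> borel_measurable interval01"
  unfolding nn_cesaro_adj_def by measurable

lemma nn_cesaro_adjoint:
  assumes [measurable]: "h \<in> borel_measurable interval01" "g \<in> borel_measurable interval01"
  shows "(\<integral>\<^sup>+x. nn_cesaro h x * g x \<partial>interval01) = (\<integral>\<^sup>+t. h t * nn_cesaro_adj g t \<partial>interval01)"
proof -
  have "(\<integral>\<^sup>+x. nn_cesaro h x * g x \<partial>interval01)
      = (\<integral>\<^sup>+x. \<integral>\<^sup>+t. ennreal (cesaro_kernel x t) * h t * g x \<partial>interval01 \<partial>interval01)"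
    unfolding nn_cesaro_def by (intro nn_integral_cong nn_integral_multc[symmetric]) measurable
  also have "\<dots> = (\<integral>\<^sup>+t. \<integral>\<^sup>+x. ennreal (cesaro_kernel x t) * h t * g x \<partial>interval01 \<partial>interval01)"
    by (rule interval01_pair.Fubini'[symmetric]) measurable
  also have "\<dots> = (\<integral>\<^sup>+t. \<integral>\<^sup>+x. h t * (ennreal (cesaro_kernel x t) * g x) \<partial>interval01 \<partial>interval01)"
    by (simp add: mult_ac)
  also have "\<dots> = (\<integral>\<^sup>+t. h t * nn_cesaro_adj g t \<partial>interval01)"
    unfolding nn_cesaro_adj_def by (intro nn_integral_cong nn_integral_cmult) measurable
  finally show ?thesis .
qed

lemma nn_cesaro_adj_kernel:
  assumes "0 < s" "s < 1" "0 < t" "t < 1" "s \<noteq> t"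
  shows "nn_cesaro_adj (\<lambda>x. ennreal (cesaro_kernel x s)) t
    = ennreal (cesaro_kernel t s) + ennreal (cesaro_kernel s t)"
proof -
  have "nn_cesaro_adj (\<lambda>x. ennreal (cesaro_kernel x s)) t
      = (\<integral>\<^sup>+x. ennreal (cesaro_kernel x s * cesaro_kernel x t) \<partial>interval01)"
    by (simp add: nn_cesaro_adj_def ennreal_mult mult.commute)
  also have "\<dots> = ennreal (\<integral>x. cesaro_kernel x s * cesaro_kernel x t \<partial>interval01)"
    using has_bochner_integral_cesaro_kernel_product[OF assms]
    by (intro nn_integral_eq_integral) (auto simp: has_bochner_integral_iff)
  also have "(\<integral>x. cesaro_kernel x s * cesaro_kernel x t \<partial>interval01) = cesaro_kernel t s + cesaro_kernel s t"
    by (rule has_bochner_integral_integral_eq[OF has_bochner_integral_cesaro_kernel_product[OF assms]])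
  finally show ?thesis by simp
qed

lemma nn_cesaro_adj_cesaro:
  assumes [measurable]: "h \<in> borel_measurable interval01" and s: "0 < s" "s < 1"
  shows "nn_cesaro_adj (nn_cesaro h) s = nn_cesaro_adj h s + nn_cesaro h s"
proof -
  have "nn_cesaro_adj (nn_cesaro h) s = (\<integral>\<^sup>+x. nn_cesaro h x * ennreal (cesaro_kernel x s) \<partial>interval01)"
    by (simp add: nn_cesaro_adj_def mult.commute)
  also have "\<dots> = (\<integral>\<^sup>+t. h t * nn_cesaro_adj (\<lambda>x. ennreal (cesaro_kernel x s)) t \<partial>interval01)"
    by (rule nn_cesaro_adjoint) measurable
  also have "\<dots> = (\<integral>\<^sup>+t. ennreal (cesaro_kernel t s) * h t + ennreal (cesaro_kernel s t) * h t \<partial>interval01)"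
  proof (rule nn_integral_cong_AE)
    show "AE t in interval01. h t * nn_cesaro_adj (\<lambda>x. ennreal (cesaro_kernel x s)) t
        = ennreal (cesaro_kernel t s) * h t + ennreal (cesaro_kernel s t) * h t"
      using AE_interval01_neq[of s] AE_space
    proof eventually_elim
      case (elim t)
      then show ?case using nn_cesaro_adj_kernel[OF s, of t] by (simp add: algebra_simps)
    qed
  qed
  also have "\<dots> = nn_cesaro_adj h s + nn_cesaro h s"
    unfolding nn_cesaro_adj_def nn_cesaro_def by (rule nn_integral_add) measurable
  finally show ?thesis .
qed

text \<open>Let \<open>A\<close> be the integral of the square of \<open>C h\<close> and \<open>B\<close> that of \<open>(C h) h\<close>.  The identity \<open>C\<^sup>* C = C + C\<^sup>*\<close>
gives \<open>A = 2 B\<close>, and \<open>4 a b \<le> a\<^sup>2 + 4 b\<^sup>2\<close> gives \<open>2 A \<le> A + 4 \<integral>h\<^sup>2\<close>, where a finite \<open>A\<close> can be cancelled.\<close>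

lemma nn_cesaro_bound_finite:
  assumes h[measurable]: "h \<in> borel_measurable interval01"
    and fin: "(\<integral>\<^sup>+x. (nn_cesaro h x)\<^sup>2 \<partial>interval01) < \<infinity>"
  shows "(\<integral>\<^sup>+x. (nn_cesaro h x)\<^sup>2 \<partial>interval01) \<le> 4 * (\<integral>\<^sup>+x. (h x)\<^sup>2 \<partial>interval01)"
proof -
  define A where "A = (\<integral>\<^sup>+x. (nn_cesaro h x)\<^sup>2 \<partial>interval01)"
  define B where "B = (\<integral>\<^sup>+x. nn_cesaro h x * h x \<partial>interval01)"
  have "A = (\<integral>\<^sup>+t. h t * nn_cesaro_adj (nn_cesaro h) t \<partial>interval01)"
    unfolding A_def power2_eq_square by (rule nn_cesaro_adjoint) measurable
  also have "\<dots> = (\<integral>\<^sup>+t. h t * nn_cesaro_adj h t + nn_cesaro h t * h t \<partial>interval01)"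
    by (intro nn_integral_cong) (simp add: nn_cesaro_adj_cesaro[OF h] algebra_simps)
  also have "\<dots> = (\<integral>\<^sup>+t. h t * nn_cesaro_adj h t \<partial>interval01) + B"
    unfolding B_def by (rule nn_integral_add) measurable
  also have "(\<integral>\<^sup>+t. h t * nn_cesaro_adj h t \<partial>interval01) = B"
    unfolding B_def by (rule nn_cesaro_adjoint[symmetric]) measurable
  finally have A: "A = 2 * B" by (simp add: mult_2)
  have ineq: "4 * (a * b) \<le> a\<^sup>2 + 4 * b\<^sup>2" for a b :: ennreal
  proof (cases "a = top \<or> b = top")
    case True
    then show ?thesis by (auto simp: power2_eq_square ennreal_mult_top ennreal_top_mult)
  next
    case False
    then obtain a' b' where ab: "a = ennreal a'" "b = ennreal b'" "a' \<ge> 0" "b' \<ge> 0"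
      by (metis ennreal_cases)
    have "0 \<le> (a' - 2 * b')\<^sup>2" by simp
    then have "4 * (a' * b') \<le> a'\<^sup>2 + 4 * b'\<^sup>2" by (simp add: power2_diff power_mult_distrib)
    then have "ennreal (4 * (a' * b')) \<le> ennreal (a'\<^sup>2 + 4 * b'\<^sup>2)" by (rule ennreal_leI)
    then show ?thesis using ab by (simp add: ennreal_mult ennreal_plus ennreal_power)
  qed
  have "A + A = 4 * B" unfolding A by (simp add: mult_2[symmetric] mult.assoc[symmetric])
  also have "\<dots> = (\<integral>\<^sup>+x. 4 * (nn_cesaro h x * h x) \<partial>interval01)"
    unfolding B_def by (rule nn_integral_cmult[symmetric]) measurable
  also have "\<dots> \<le> (\<integral>\<^sup>+x. (nn_cesaro h x)\<^sup>2 + 4 * (h x)\<^sup>2 \<partial>interval01)"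
    by (intro nn_integral_mono ineq)
  also have "\<dots> = A + (\<integral>\<^sup>+x. 4 * (h x)\<^sup>2 \<partial>interval01)"
    unfolding A_def by (rule nn_integral_add) measurable
  also have "(\<integral>\<^sup>+x. 4 * (h x)\<^sup>2 \<partial>interval01) = 4 * (\<integral>\<^sup>+x. (h x)\<^sup>2 \<partial>interval01)"
    by (rule nn_integral_cmult) measurable
  finally show ?thesis using fin unfolding ennreal_add_left_cancel_le A_def by auto
qed

text \<open>Truncation supplies the finiteness that the cancellation requires, and Fatou's lemma removes the
truncation.\<close>

lemma nn_cesaro_bound:
  fixes f :: "real \<Rightarrow> real"
  assumes f[measurable]: "f \<in> borel_measurable interval01" and f0: "\<And>x. f x \<ge> 0"
  shows "(\<integral>\<^sup>+x. (nn_cesaro (\<lambda>t. ennreal (f t)) x)\<^sup>2 \<partial>interval01) \<le> 4 * (\<integral>\<^sup>+x. (ennreal (f x))\<^sup>2 \<partial>interval01)"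
proof -
  \<comment> \<open>On \<open>A n\<close> both \<open>f\<close> and every kernel value \<open>k(x, t)\<close> are at most \<open>n\<close>.\<close>
  define A where "A n = {t. f t \<le> real n \<and> 1 \<le> real n * (t * (1 - t)) \<and> 0 < t \<and> t < 1}" for n
  define h where "h n t = ennreal (if t \<in> A n then f t else 0)" for n t
  have [measurable]: "h n \<in> borel_measurable interval01" for n
    unfolding h_def A_def mem_Collect_eq by measurable
  have mono: "A m \<subseteq> A n" if "m \<le> n" for m n
  proof
    fix t assume t: "t \<in> A m"
    have "real m * (t * (1 - t)) \<le> real n * (t * (1 - t))"
      using that t by (intro mult_right_mono) (auto simp: A_def)
    moreover have "f t \<le> real m" "1 \<le> real m * (t * (1 - t))" "0 < t" "t < 1" "real m \<le> real n"
      using t that by (auto simp: A_def)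
    ultimately show "t \<in> A n" unfolding A_def mem_Collect_eq by linarith
  qed
  have kbound: "ennreal (cesaro_kernel x t) * h n t \<le> ennreal (real n * real n)" for x t n
  proof (cases "t \<in> A n")
    case True
    then have t: "0 < t" "t < 1" "1 \<le> real n * (t * (1 - t))" "f t \<le> real n" by (auto simp: A_def)
    have "cesaro_kernel x t \<le> 1 / (t * (1 - t))" by (rule cesaro_kernel_le_column[OF t(1,2)])
    also have "\<dots> \<le> real n" using t by (simp add: divide_le_eq)
    finally have "cesaro_kernel x t * f t \<le> real n * real n"
      using t f0 by (intro mult_mono) auto
    then show ?thesis using True f0
      by (simp add: h_def ennreal_mult[symmetric] ennreal_leI)
  qed (simp add: h_def)
  have bd: "(\<integral>\<^sup>+x. (nn_cesaro (h n) x)\<^sup>2 \<partial>interval01) \<le> 4 * (\<integral>\<^sup>+x. (h n x)\<^sup>2 \<partial>interval01)" for n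
  proof (rule nn_cesaro_bound_finite)
    have mass: "emeasure interval01 {0<..<1} < top"
      using less_top interval01.emeasure_finite by blast
    define c where "c = ennreal (real n * real n) * emeasure interval01 (space interval01)"
    have cfin: "c < \<infinity>"
      unfolding c_def using mass by (simp add: ennreal_mult_less_top)
    have "nn_cesaro (h n) x \<le> c" for x
    proof -
      have "nn_cesaro (h n) x \<le> (\<integral>\<^sup>+t. ennreal (real n * real n) \<partial>interval01)"
        unfolding nn_cesaro_def by (intro nn_integral_mono kbound)
      then show ?thesis by (simp add: c_def)
    qed
    then have "(\<integral>\<^sup>+x. (nn_cesaro (h n) x)\<^sup>2 \<partial>interval01) \<le> (\<integral>\<^sup>+x. c\<^sup>2 \<partial>interval01)"
      by (intro nn_integral_mono power_mono) auto
    also have "\<dots> < \<infinity>"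
      using cfin mass by (simp add: ennreal_mult_less_top power2_eq_square)
    finally show "(\<integral>\<^sup>+x. (nn_cesaro (h n) x)\<^sup>2 \<partial>interval01) < \<infinity>" .
  qed measurable
  have h_le: "h n t \<le> ennreal (f t)" for n t using f0 by (simp add: h_def)
  have lim: "(\<lambda>n. nn_cesaro (h n) x) \<longlonglongrightarrow> nn_cesaro (\<lambda>t. ennreal (f t)) x" for x
    unfolding nn_cesaro_def
  proof (rule nn_integral_LIMSEQ)
    show "incseq (\<lambda>n t. ennreal (cesaro_kernel x t) * h n t)"
      using mono[THEN subsetD] f0 by (intro monoI le_funI mult_left_mono) (auto simp: h_def)
    show "(\<lambda>t. ennreal (cesaro_kernel x t) * h n t) \<in> borel_measurable interval01" for n
      by measurable
    fix t
    show "(\<lambda>n. ennreal (cesaro_kernel x t) * h n t) \<longlonglongrightarrow> ennreal (cesaro_kernel x t) * ennreal (f t)"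
    proof (cases "0 < t \<and> t < 1")
      case True
      then have pos: "t * (1 - t) > 0" by simp
      obtain N1 where N1: "f t \<le> real N1" using real_arch_simple by blast
      obtain N2 where N2: "1 < real N2 * (t * (1 - t))" using reals_Archimedean3[OF pos] by blast
      have "\<forall>\<^sub>F n in sequentially. ennreal (cesaro_kernel x t) * h n t = ennreal (cesaro_kernel x t) * ennreal (f t)"
        using eventually_ge_at_top[of "max N1 N2"]
      proof eventually_elim
        case (elim n)
        have "real N2 * (t * (1 - t)) \<le> real n * (t * (1 - t))"
          using elim pos by (intro mult_right_mono) auto
        moreover have "real N1 \<le> real n" using elim by simp
        ultimately have "t \<in> A n" using N1 N2 True unfolding A_def mem_Collect_eq by linarith
        then show ?case by (simp add: h_def)
      qed
      then show ?thesis by (rule tendsto_eventually)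
    qed (auto simp: cesaro_kernel_def)
  qed
  have "(\<integral>\<^sup>+x. (nn_cesaro (\<lambda>t. ennreal (f t)) x)\<^sup>2 \<partial>interval01)
      = (\<integral>\<^sup>+x. liminf (\<lambda>n. (nn_cesaro (h n) x)\<^sup>2) \<partial>interval01)"
  proof (intro nn_integral_cong lim_imp_Liminf[symmetric])
    fix x
    show "(\<lambda>n. (nn_cesaro (h n) x)\<^sup>2) \<longlonglongrightarrow> (nn_cesaro (\<lambda>t. ennreal (f t)) x)\<^sup>2"
      unfolding power2_eq_square by (intro tendsto_mult_ennreal lim) auto
  qed simp
  also have "\<dots> \<le> liminf (\<lambda>n. \<integral>\<^sup>+x. (nn_cesaro (h n) x)\<^sup>2 \<partial>interval01)"
    by (rule nn_integral_liminf) measurable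
  also have "\<dots> \<le> 4 * (\<integral>\<^sup>+x. (ennreal (f x))\<^sup>2 \<partial>interval01)"
  proof (rule Liminf_le)
    have "(\<integral>\<^sup>+x. (nn_cesaro (h n) x)\<^sup>2 \<partial>interval01) \<le> 4 * (\<integral>\<^sup>+x. (ennreal (f x))\<^sup>2 \<partial>interval01)" for n
      by (rule order_trans[OF bd]) (intro mult_left_mono nn_integral_mono power_mono h_le, auto)
    then show "\<forall>\<^sub>F n in sequentially. (\<integral>\<^sup>+x. (nn_cesaro (h n) x)\<^sup>2 \<partial>interval01) \<le> 4 * (\<integral>\<^sup>+x. (ennreal (f x))\<^sup>2 \<partial>interval01)"
      by simp
  qed simp
  finally show ?thesis .
qed

section \<open>The Cesaro operator minus the identity is unitary\<close>

definition cesaro_op :: "(real \<Rightarrow> complex) \<Rightarrow> real \<Rightarrow> complex" where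
  "cesaro_op f x = (\<integral>t. complex_of_real (cesaro_kernel x t) * f t \<partial>interval01)"

definition cesaro_adj :: "(real \<Rightarrow> complex) \<Rightarrow> real \<Rightarrow> complex" where
  "cesaro_adj f t = (\<integral>x. complex_of_real (cesaro_kernel x t) * f x \<partial>interval01)"

lemma cesaro_fun_eq_cesaro_op:
  assumes x: "0 < x" "x < 1"
  shows "cesaro_fun f x = cesaro_op f x"
proof -
  have "cesaro_op f x = (\<integral>t. indicator {0<..<1} t *\<^sub>R (complex_of_real (cesaro_kernel x t) * f t) \<partial>lebesgue)"
    unfolding cesaro_op_def interval01_def by (rule integral_restrict_space) simp
  also have "\<dots> = (\<integral>t. 1 / complex_of_real x * (indicator {0<..<x} t *\<^sub>R (f t / complex_of_real (1 - t))) \<partial>lebesgue)"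
    using x by (intro Bochner_Integration.integral_cong refl) (auto simp: cesaro_kernel_def indicator_def)
  also have "\<dots> = cesaro_fun f x"
    unfolding cesaro_fun_def set_lebesgue_integral_def by (rule integral_mult_right_zero)
  finally show ?thesis by simp
qed

text \<open>For \<open>x\<close> outside the unit interval the row is zero; the absolute value makes the bound nonnegative there.\<close>

lemma square_integrable_kernel_row: "(\<lambda>t. complex_of_real (cesaro_kernel x t)) \<in> square_integrable interval01"
proof (rule square_integrable_bounded[OF finite_measure_interval01])
  show "AE t in interval01. cmod (complex_of_real (cesaro_kernel x t)) \<le> 1 / \<bar>x * (1 - x)\<bar>"
    using cesaro_kernel_le_row[of x] by (cases "0 < x \<and> x < 1") (auto simp: cesaro_kernel_def)
qed measurable

lemma square_integrable_kernel_column: "(\<lambda>x. complex_of_real (cesaro_kernel x t)) \<in> square_integrable interval01"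
proof (rule square_integrable_bounded[OF finite_measure_interval01])
  show "AE x in interval01. cmod (complex_of_real (cesaro_kernel x t)) \<le> 1 / \<bar>t * (1 - t)\<bar>"
    using cesaro_kernel_le_column[of t] by (cases "0 < t \<and> t < 1") (auto simp: cesaro_kernel_def)
qed measurable

lemma cesaro_op_integrable:
  assumes "f \<in> square_integrable interval01"
  shows "integrable interval01 (\<lambda>t. complex_of_real (cesaro_kernel x t) * f t)"
  by (rule integrable_l2_prod[OF square_integrable_kernel_row assms])

lemma cesaro_adj_integrable:
  assumes "f \<in> square_integrable interval01"
  shows "integrable interval01 (\<lambda>x. complex_of_real (cesaro_kernel x t) * f x)"
  by (rule integrable_l2_prod[OF square_integrable_kernel_column assms])

lemma cesaro_op_add:
  assumes "f \<in> square_integrable interval01" "g \<in> square_integrable interval01"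
  shows "cesaro_op (\<lambda>x. f x + g x) x = cesaro_op f x + cesaro_op g x"
  by (simp add: cesaro_op_def distrib_left cesaro_op_integrable assms)

lemma cesaro_op_diff:
  assumes "f \<in> square_integrable interval01" "g \<in> square_integrable interval01"
  shows "cesaro_op (\<lambda>x. f x - g x) x = cesaro_op f x - cesaro_op g x"
  by (simp add: cesaro_op_def right_diff_distrib cesaro_op_integrable assms)

lemma cesaro_op_scale: "cesaro_op (\<lambda>x. c * f x) x = c * cesaro_op f x"
  by (simp add: cesaro_op_def mult.left_commute)

lemma cesaro_adj_diff:
  assumes "f \<in> square_integrable interval01" "g \<in> square_integrable interval01"
  shows "cesaro_adj (\<lambda>x. f x - g x) x = cesaro_adj f x - cesaro_adj g x"
  by (simp add: cesaro_adj_def right_diff_distrib cesaro_adj_integrable assms)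

lemma cesaro_op_measurable [measurable]:
  assumes [measurable]: "f \<in> borel_measurable interval01"
  shows "cesaro_op f \<in> borel_measurable interval01"
  unfolding cesaro_op_def by measurable

lemma norm_cesaro_op_le:
  assumes "f \<in> square_integrable interval01"
  shows "ennreal (cmod (cesaro_op f x)) \<le> nn_cesaro (\<lambda>t. ennreal (cmod (f t))) x"
  using integral_norm_bound_ennreal[OF cesaro_op_integrable[OF assms, of x]]
  by (simp add: cesaro_op_def nn_cesaro_def norm_mult ennreal_mult)

lemma nn_cesaro_norm_bound:
  assumes f: "f \<in> square_integrable interval01"
  shows "(\<integral>\<^sup>+x. (nn_cesaro (\<lambda>t. ennreal (cmod (f t))) x)\<^sup>2 \<partial>interval01) \<le> ennreal (4 * l2_normsq interval01 f)"
proof -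
  have "(\<integral>\<^sup>+x. (nn_cesaro (\<lambda>t. ennreal (cmod (f t))) x)\<^sup>2 \<partial>interval01)
      \<le> 4 * (\<integral>\<^sup>+x. (ennreal (cmod (f x)))\<^sup>2 \<partial>interval01)"
    using square_integrable_measurable[OF f] by (intro nn_cesaro_bound) auto
  also have "\<dots> = ennreal (4 * l2_normsq interval01 f)"
    by (simp add: ennreal_power ennreal_l2_normsq[OF f] ennreal_mult)
  finally show ?thesis .
qed

lemma
  assumes f: "f \<in> square_integrable interval01"
  shows square_integrable_cesaro_op: "cesaro_op f \<in> square_integrable interval01"
    and l2_normsq_cesaro_op_le: "l2_normsq interval01 (cesaro_op f) \<le> 2\<^sup>2 * l2_normsq interval01 f"
proof -
  note [measurable] = square_integrable_measurable[OF f]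
  have "(\<integral>\<^sup>+x. ennreal ((cmod (cesaro_op f x))\<^sup>2) \<partial>interval01)
      \<le> (\<integral>\<^sup>+x. (nn_cesaro (\<lambda>t. ennreal (cmod (f t))) x)\<^sup>2 \<partial>interval01)"
    unfolding ennreal_power[symmetric, OF norm_ge_zero]
    by (intro nn_integral_mono power_mono norm_cesaro_op_le f) simp
  also note nn_cesaro_norm_bound[OF f]
  finally have le: "(\<integral>\<^sup>+x. ennreal ((cmod (cesaro_op f x))\<^sup>2) \<partial>interval01) \<le> ennreal (4 * l2_normsq interval01 f)" .
  show sq: "cesaro_op f \<in> square_integrable interval01"
    by (rule square_integrableI_nn) (use le in \<open>auto simp: le_less_trans\<close>)
  show "l2_normsq interval01 (cesaro_op f) \<le> 2\<^sup>2 * l2_normsq interval01 f"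
    using le by (simp add: ennreal_l2_normsq[OF sq])
qed

lemma measurable_reflect [measurable]: "(\<lambda>x. 1 - x) \<in> interval01 \<rightarrow>\<^sub>M interval01"
proof -
  have "(\<lambda>x. 1 + (-1) * x) \<in> lebesgue \<rightarrow>\<^sub>M (lebesgue :: real measure)"
    using lebesgue_affine_measurable[where c = "\<lambda>x::real. -1" and t = 1] by simp
  then have "(\<lambda>x::real. 1 - x) \<in> lebesgue \<rightarrow>\<^sub>M lebesgue" by simp
  then show ?thesis unfolding interval01_def
    by (intro measurable_restrict_space2 measurable_restrict_space1) auto
qed

lemma distr_reflect: "distr interval01 interval01 (\<lambda>x. 1 - x) = interval01"
proof (rule measure_eqI)
  fix A assume "A \<in> sets (distr interval01 interval01 (\<lambda>x. 1 - x))"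
  then have A: "A \<in> sets interval01" by simp
  then have A': "A \<in> sets lebesgue" "A \<subseteq> {0<..<1}"
    by (auto simp: interval01_def sets_restrict_space)
  have vim: "(\<lambda>x. 1 - x) -` A \<inter> space interval01 = (\<lambda>x. 1 - x) -` A"
    using A' by auto
  have meas: "(\<lambda>x::real. 1 - x) \<in> lebesgue \<rightarrow>\<^sub>M lebesgue"
    using lebesgue_affine_measurable[where c = "\<lambda>x::real. -1" and t = 1] by simp
  have "lebesgue = distr lebesgue lebesgue (\<lambda>x::real. 1 - x)"
    using lebesgue_real_affine[of "-1" 1] by (simp add: density_1)
  then have "emeasure lebesgue A = emeasure (distr lebesgue lebesgue (\<lambda>x. 1 - x)) A" by simp
  also have "\<dots> = emeasure lebesgue ((\<lambda>x. 1 - x) -` A)"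
    using emeasure_distr[OF meas A'(1)] by simp
  finally have "emeasure lebesgue ((\<lambda>x. 1 - x) -` A) = emeasure lebesgue A" ..
  moreover have "emeasure interval01 B = emeasure lebesgue B" if "B \<subseteq> {0<..<1}" for B
    unfolding interval01_def by (rule emeasure_restrict_space) (use that in auto)
  moreover have "(\<lambda>x. 1 - x) -` A \<subseteq> {0<..<1}" using A'(2) by auto
  ultimately show "emeasure (distr interval01 interval01 (\<lambda>x. 1 - x)) A = emeasure interval01 A"
    using A'(2) by (simp only: emeasure_distr[OF measurable_reflect A] vim)
qed simp

lemma integral_reflect:
  fixes f :: "real \<Rightarrow> 'b::{banach, second_countable_topology}"
  assumes "f \<in> borel_measurable interval01"
  shows "(\<integral>x. f (1 - x) \<partial>interval01) = (\<integral>x. f x \<partial>interval01)"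
  using integral_distr[OF measurable_reflect assms] by (simp add: distr_reflect)

lemma square_integrable_reflect:
  assumes "f \<in> square_integrable interval01"
  shows "(\<lambda>x. f (1 - x)) \<in> square_integrable interval01"
proof -
  have [measurable]: "f \<in> borel_measurable interval01" by (rule square_integrable_measurable[OF assms])
  have "integrable (distr interval01 interval01 (\<lambda>x. 1 - x)) (\<lambda>x. (cmod (f x))\<^sup>2)"
    using assms by (simp add: distr_reflect square_integrable_def)
  then have "integrable interval01 (\<lambda>x. (cmod (f (1 - x)))\<^sup>2)"
    by (subst (asm) integrable_distr_eq) measurable
  then show ?thesis by (simp add: square_integrable_def)
qed

lemma l2_inner_reflect:
  assumes [measurable]: "f \<in> borel_measurable interval01" "g \<in> borel_measurable interval01"
  shows "l2_inner interval01 (\<lambda>x. f (1 - x)) (\<lambda>x. g (1 - x)) = l2_inner interval01 f g"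
  unfolding l2_inner_def by (rule integral_reflect[of "\<lambda>x. f x * cnj (g x)"]) measurable

text \<open>The kernel satisfies \<open>k(1 - t, 1 - x) = k(x, t)\<close>, so the adjoint is the operator conjugated by the
reflection.\<close>

lemma cesaro_adj_reflect:
  assumes [measurable]: "f \<in> borel_measurable interval01"
  shows "cesaro_adj f t = cesaro_op (\<lambda>x. f (1 - x)) (1 - t)"
proof -
  have "cesaro_adj f t = (\<integral>x. complex_of_real (cesaro_kernel (1 - x) t) * f (1 - x) \<partial>interval01)"
    unfolding cesaro_adj_def
    by (rule integral_reflect[of "\<lambda>x. complex_of_real (cesaro_kernel x t) * f x", symmetric]) measurable
  also have "\<dots> = cesaro_op (\<lambda>x. f (1 - x)) (1 - t)"
    unfolding cesaro_op_def using cesaro_kernel_reflect[of "1 - t" for t]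
    by (intro Bochner_Integration.integral_cong refl) (metis cesaro_kernel_reflect diff_diff_eq2 diff_add_cancel add_diff_cancel_left')
  finally show ?thesis .
qed

lemma cesaro_op_reflect:
  assumes [measurable]: "f \<in> borel_measurable interval01"
  shows "cesaro_op f x = cesaro_adj (\<lambda>x. f (1 - x)) (1 - x)"
  using cesaro_adj_reflect[of "\<lambda>x. f (1 - x)" "1 - x"] by simp

lemma square_integrable_cesaro_adj:
  assumes f: "f \<in> square_integrable interval01"
  shows "cesaro_adj f \<in> square_integrable interval01"
proof -
  have "cesaro_adj f = (\<lambda>t. cesaro_op (\<lambda>x. f (1 - x)) (1 - t))"
    by (intro ext cesaro_adj_reflect square_integrable_measurable f)
  then show ?thesis
    by (simp only: square_integrable_reflect square_integrable_cesaro_op f)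
qed

text \<open>Fubini's theorem applies because \<open>C |f|\<close> and \<open>g\<close> are square-integrable.\<close>

lemma cesaro_adjoint:
  assumes f: "f \<in> square_integrable interval01" and g: "g \<in> square_integrable interval01"
  shows "l2_inner interval01 (cesaro_op f) g = l2_inner interval01 f (cesaro_adj g)"
proof -
  note [measurable] = square_integrable_measurable[OF f] square_integrable_measurable[OF g]
  define H where "H x t = complex_of_real (cesaro_kernel x t) * f t * cnj (g x)" for x t
  have [measurable]: "case_prod H \<in> borel_measurable (interval01 \<Otimes>\<^sub>M interval01)"
    unfolding H_def by measurable
  have "integrable (interval01 \<Otimes>\<^sub>M interval01) (case_prod H)"
  proof (rule integrableI_bounded)
    define N where "N = nn_cesaro (\<lambda>t. ennreal (cmod (f t)))"
    have [measurable]: "N \<in> borel_measurable interval01" unfolding N_def by measurable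
    define a where "a = (\<integral>\<^sup>+x. N x * ennreal (cmod (g x)) \<partial>interval01)"
    have "(\<integral>\<^sup>+p. ennreal (norm (case_prod H p)) \<partial>(interval01 \<Otimes>\<^sub>M interval01))
        = (\<integral>\<^sup>+x. \<integral>\<^sup>+t. ennreal (norm (case_prod H (x, t))) \<partial>interval01 \<partial>interval01)"
      by (rule interval01.nn_integral_fst[symmetric]) measurable
    also have "\<dots> = (\<integral>\<^sup>+x. \<integral>\<^sup>+t. ennreal (cesaro_kernel x t) * ennreal (cmod (f t)) * ennreal (cmod (g x)) \<partial>interval01 \<partial>interval01)"
      by (simp add: H_def norm_mult ennreal_mult)
    also have "\<dots> = a"
      unfolding a_def N_def nn_cesaro_def by (intro nn_integral_cong nn_integral_multc) measurable
    finally have eq: "(\<integral>\<^sup>+p. ennreal (norm (case_prod H p)) \<partial>(interval01 \<Otimes>\<^sub>M interval01)) = a" .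
    have "a\<^sup>2 \<le> (\<integral>\<^sup>+x. (N x)\<^sup>2 \<partial>interval01) * (\<integral>\<^sup>+x. (ennreal (cmod (g x)))\<^sup>2 \<partial>interval01)"
      unfolding a_def by (rule Cauchy_Schwarz_nn_integral) measurable
    also have "\<dots> \<le> ennreal (4 * l2_normsq interval01 f) * ennreal (l2_normsq interval01 g)"
      unfolding N_def using nn_cesaro_norm_bound[OF f]
      by (intro mult_mono) (auto simp: ennreal_power ennreal_l2_normsq[OF g])
    also have "\<dots> < \<infinity>" by (simp add: ennreal_mult_less_top)
    finally have "a < \<infinity>" by (cases "a = top") (auto simp: power2_eq_square ennreal_mult_top less_top)
    then show "(\<integral>\<^sup>+p. ennreal (norm (case_prod H p)) \<partial>(interval01 \<Otimes>\<^sub>M interval01)) < \<infinity>"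
      using eq by simp
  qed measurable
  from interval01_pair.Fubini_integral[OF this]
  have "(\<integral>x. \<integral>t. H x t \<partial>interval01 \<partial>interval01) = (\<integral>t. \<integral>x. H x t \<partial>interval01 \<partial>interval01)" by simp
  moreover have "(\<integral>t. H x t \<partial>interval01) = cesaro_op f x * cnj (g x)" for x
    unfolding H_def cesaro_op_def by (rule integral_mult_left_zero)
  moreover have "(\<integral>x. H x t \<partial>interval01) = f t * cnj (cesaro_adj g t)" for t
  proof -
    have "(\<integral>x. H x t \<partial>interval01) = (\<integral>x. f t * cnj (complex_of_real (cesaro_kernel x t) * g x) \<partial>interval01)"
      by (simp add: H_def mult_ac)
    also have "\<dots> = f t * (\<integral>x. cnj (complex_of_real (cesaro_kernel x t) * g x) \<partial>interval01)"
      by (rule integral_mult_right_zero)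
    also have "\<dots> = f t * cnj (cesaro_adj g t)"
      unfolding cesaro_adj_def by (simp only: Bochner_Integration.integral_cnj)
    finally show ?thesis .
  qed
  ultimately show ?thesis by (simp add: l2_inner_def)
qed

lemma cesaro_adj_kernel:
  assumes "0 < s" "s < 1" "0 < t" "t < 1" "s \<noteq> t"
  shows "cesaro_adj (\<lambda>x. complex_of_real (cesaro_kernel x s)) t
    = complex_of_real (cesaro_kernel t s) + complex_of_real (cesaro_kernel s t)"
proof -
  have "cesaro_adj (\<lambda>x. complex_of_real (cesaro_kernel x s)) t
      = (\<integral>x. complex_of_real (cesaro_kernel x s * cesaro_kernel x t) \<partial>interval01)"
    by (simp add: cesaro_adj_def mult.commute)
  also have "\<dots> = complex_of_real (cesaro_kernel t s + cesaro_kernel s t)"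
    using has_bochner_integral_integral_eq[OF has_bochner_integral_cesaro_kernel_product[OF assms]]
    by (simp only: integral_complex_of_real)
  finally show ?thesis by simp
qed

text \<open>The value at \<open>s\<close> of the adjoint is an inner product with a kernel column.  Moving \<open>C\<close> to the other side
applies \<open>C\<^sup>*\<close> to that column, and the result is known from the kernel identity.\<close>

lemma cesaro_adj_cesaro_op:
  assumes f: "f \<in> square_integrable interval01" and s: "0 < s" "s < 1"
  shows "cesaro_adj (cesaro_op f) s = cesaro_op f s + cesaro_adj f s"
proof -
  let ?k = "\<lambda>x. complex_of_real (cesaro_kernel x s)"
  have k: "?k \<in> square_integrable interval01" by (rule square_integrable_kernel_column)
  note [measurable] = square_integrable_measurable[OF f]
    square_integrable_measurable[OF square_integrable_cesaro_adj[OF k]]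
  have "cesaro_adj (cesaro_op f) s = l2_inner interval01 (cesaro_op f) ?k"
    by (simp add: cesaro_adj_def l2_inner_def mult.commute)
  also have "\<dots> = l2_inner interval01 f (cesaro_adj ?k)" by (rule cesaro_adjoint[OF f k])
  also have "\<dots> = (\<integral>t. complex_of_real (cesaro_kernel s t) * f t + complex_of_real (cesaro_kernel t s) * f t \<partial>interval01)"
    unfolding l2_inner_def
  proof (rule integral_cong_AE)
    show "AE t in interval01. f t * cnj (cesaro_adj ?k t)
        = complex_of_real (cesaro_kernel s t) * f t + complex_of_real (cesaro_kernel t s) * f t"
      using AE_interval01_neq[of s] AE_space
    proof eventually_elim
      case (elim t)
      then show ?case using cesaro_adj_kernel[OF s, of t] by (simp add: algebra_simps)
    qed
  qed measurable
  also have "\<dots> = cesaro_op f s + cesaro_adj f s"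
    unfolding cesaro_op_def cesaro_adj_def
    by (rule Bochner_Integration.integral_add[OF cesaro_op_integrable[OF f] cesaro_adj_integrable[OF f]])
  finally show ?thesis .
qed

text \<open>This is the preceding identity conjugated by the reflection.\<close>

lemma cesaro_op_cesaro_adj:
  assumes f: "f \<in> square_integrable interval01" and s: "0 < s" "s < 1"
  shows "cesaro_op (cesaro_adj f) s = cesaro_adj f s + cesaro_op f s"
proof -
  note [measurable] = square_integrable_measurable[OF f]
    square_integrable_measurable[OF square_integrable_cesaro_adj[OF f]]
  have "cesaro_op (cesaro_adj f) s = cesaro_adj (\<lambda>x. cesaro_adj f (1 - x)) (1 - s)"
    by (rule cesaro_op_reflect) measurable
  also have "(\<lambda>x. cesaro_adj f (1 - x)) = cesaro_op (\<lambda>x. f (1 - x))"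
    using cesaro_adj_reflect[of f] by (simp add: fun_eq_iff)
  also have "cesaro_adj (cesaro_op (\<lambda>x. f (1 - x))) (1 - s)
      = cesaro_op (\<lambda>x. f (1 - x)) (1 - s) + cesaro_adj (\<lambda>x. f (1 - x)) (1 - s)"
    using s by (intro cesaro_adj_cesaro_op square_integrable_reflect f) auto
  also have "\<dots> = cesaro_adj f s + cesaro_op f s"
    by (simp only: cesaro_adj_reflect[of f] cesaro_op_reflect[of f] square_integrable_measurable[OF f])
  finally show ?thesis .
qed

definition cesaro_shift :: "(real \<Rightarrow> complex) \<Rightarrow> real \<Rightarrow> complex" where
  "cesaro_shift f x = cesaro_op f x - f x"

definition cesaro_unshift :: "(real \<Rightarrow> complex) \<Rightarrow> real \<Rightarrow> complex" where
  "cesaro_unshift f x = cesaro_adj f x - f x"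

lemma square_integrable_cesaro_shift:
  "f \<in> square_integrable interval01 \<Longrightarrow> cesaro_shift f \<in> square_integrable interval01"
  unfolding cesaro_shift_def by (intro square_integrable_diff square_integrable_cesaro_op)

lemma square_integrable_cesaro_unshift:
  "f \<in> square_integrable interval01 \<Longrightarrow> cesaro_unshift f \<in> square_integrable interval01"
  unfolding cesaro_unshift_def by (intro square_integrable_diff square_integrable_cesaro_adj)

lemma square_integrable_cesaro_shift_pow:
  "f \<in> square_integrable interval01 \<Longrightarrow> (cesaro_shift ^^ n) f \<in> square_integrable interval01"
  by (induction n) (auto intro: square_integrable_cesaro_shift)

lemma square_integrable_cesaro_unshift_pow:
  "f \<in> square_integrable interval01 \<Longrightarrow> (cesaro_unshift ^^ n) f \<in> square_integrable interval01"
  by (induction n) (auto intro: square_integrable_cesaro_unshift)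

lemma cesaro_unshift_shift:
  assumes f: "f \<in> square_integrable interval01" and x: "0 < x" "x < 1"
  shows "cesaro_unshift (cesaro_shift f) x = f x"
  unfolding cesaro_unshift_def cesaro_shift_def
  by (simp add: cesaro_adj_diff square_integrable_cesaro_op f cesaro_adj_cesaro_op[OF f x])

lemma cesaro_shift_unshift:
  assumes f: "f \<in> square_integrable interval01" and x: "0 < x" "x < 1"
  shows "cesaro_shift (cesaro_unshift f) x = f x"
  unfolding cesaro_unshift_def cesaro_shift_def
  by (simp add: cesaro_op_diff square_integrable_cesaro_adj f cesaro_op_cesaro_adj[OF f x])

lemma cesaro_shift_adjoint:
  assumes "f \<in> square_integrable interval01" "g \<in> square_integrable interval01"
  shows "l2_inner interval01 (cesaro_shift f) g = l2_inner interval01 f (cesaro_unshift g)"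
  using assms unfolding cesaro_shift_def cesaro_unshift_def
  by (simp add: l2_inner_diff_left l2_inner_diff_right square_integrable_cesaro_op
      square_integrable_cesaro_adj cesaro_adjoint)

lemma AE_interval01I: "(\<And>x. 0 < x \<Longrightarrow> x < 1 \<Longrightarrow> P x) \<Longrightarrow> AE x in interval01. P x"
  by (rule AE_I2) simp

lemma l2_inner_cesaro_unshift:
  assumes f: "f \<in> square_integrable interval01" and g: "g \<in> square_integrable interval01"
  shows "l2_inner interval01 (cesaro_unshift f) (cesaro_unshift g) = l2_inner interval01 f g"
proof -
  have "l2_inner interval01 (cesaro_unshift f) (cesaro_unshift g)
      = l2_inner interval01 (cesaro_shift (cesaro_unshift f)) g"
    by (simp add: cesaro_shift_adjoint square_integrable_cesaro_unshift f g)
  also have "\<dots> = l2_inner interval01 f g"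
    by (rule l2_inner_cong_AE)
      (auto intro!: AE_interval01I square_integrable_cesaro_shift square_integrable_cesaro_unshift
        cesaro_shift_unshift f g)
  finally show ?thesis .
qed

lemma cesaro_adj_cong_AE:
  assumes "f \<in> square_integrable interval01" "g \<in> square_integrable interval01" "AE x in interval01. f x = g x"
  shows "cesaro_adj f t = cesaro_adj g t"
  unfolding cesaro_adj_def
  by (rule integral_cong_AE)
    (use assms(3) in \<open>auto intro!: borel_measurable_integrable cesaro_adj_integrable assms elim: eventually_mono\<close>)

lemma cesaro_unshift_cong_AE:
  assumes "f \<in> square_integrable interval01" "g \<in> square_integrable interval01" "AE x in interval01. f x = g x"
  shows "AE x in interval01. cesaro_unshift f x = cesaro_unshift g x"
  using assms(3) by eventually_elim (simp add: cesaro_unshift_def cesaro_adj_cong_AE[OF assms])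

text \<open>The reflection turns forward powers into backward ones, which later reduces the half of the basis with
negative indices to the other half.\<close>

lemma reflect_cesaro_shift:
  assumes "f \<in> square_integrable interval01"
  shows "(\<lambda>x. cesaro_shift f (1 - x)) = cesaro_unshift (\<lambda>x. f (1 - x))"
  using cesaro_op_reflect[OF square_integrable_measurable[OF assms]]
  by (simp add: fun_eq_iff cesaro_shift_def cesaro_unshift_def)

lemma reflect_cesaro_shift_pow:
  assumes f: "f \<in> square_integrable interval01"
  shows "(\<lambda>x. (cesaro_shift ^^ n) f (1 - x)) = (cesaro_unshift ^^ n) (\<lambda>x. f (1 - x))"
proof (induction n)
  case (Suc n)
  show ?case
    using reflect_cesaro_shift[OF square_integrable_cesaro_shift_pow[OF f, of n]] Suc by simp
qed simp

section \<open>A wandering vector and its translates\<close>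

text \<open>The value 0 up to \<open>1/2\<close> keeps the ratio in the compact interval \<open>[0, 1]\<close>; functions of the ratio are only
integrated against functions that vanish there.\<close>

definition half_ratio :: "real \<Rightarrow> real" where
  "half_ratio x = (if 1/2 < x then (1 - x) / x else 0)"

definition half_inverse :: "real \<Rightarrow> real" where
  "half_inverse x = (if 1/2 < x then 1 / x else 0)"

lemma half_ratio_measurable [measurable]: "half_ratio \<in> borel_measurable interval01"
  unfolding half_ratio_def by measurable

lemma half_inverse_measurable [measurable]: "half_inverse \<in> borel_measurable interval01"
  unfolding half_inverse_def by measurable

lemma half_ratio_bounds: "x < 1 \<Longrightarrow> 0 \<le> half_ratio x \<and> half_ratio x \<le> 1"
  by (simp add: half_ratio_def divide_le_eq)

definition half_power :: "nat \<Rightarrow> real \<Rightarrow> complex" where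
  "half_power k x = complex_of_real (half_ratio x ^ k * half_inverse x)"

lemma square_integrable_half_power: "half_power k \<in> square_integrable interval01"
proof (rule square_integrable_bounded[OF finite_measure_interval01])
  show "AE x in interval01. cmod (half_power k x) \<le> 1 * 2"
  proof (rule AE_interval01I)
    fix x :: real assume "0 < x" "x < 1"
    then have "half_ratio x ^ k \<le> 1" "0 \<le> half_ratio x ^ k" "half_inverse x \<le> 2" "0 \<le> half_inverse x"
      using half_ratio_bounds[of x] by (auto simp: power_le_one half_inverse_def divide_le_eq)
    then have "half_ratio x ^ k * half_inverse x \<le> 1 * 2" by (intro mult_mono) auto
    then show "cmod (half_power k x) \<le> 1 * 2"
      using \<open>0 \<le> half_ratio x ^ k\<close> \<open>0 \<le> half_inverse x\<close> unfolding half_power_def norm_of_real by simp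
  qed
qed (unfold half_power_def, measurable)

abbreviation wandering :: "real \<Rightarrow> complex" where
  "wandering \<equiv> half_power 0"

lemma cesaro_adj_wandering:
  assumes t: "0 < t" "t < 1"
  shows "cesaro_adj wandering t = complex_of_real (1 / max t (1/2) - 1) / complex_of_real (1 - t)"
proof -
  have "has_bochner_integral interval01 (\<lambda>x. indicator {max t (1/2)<..<1} x * (1 / x\<^sup>2)) (- (1 / 1) - - (1 / max t (1/2)))"
    by (rule has_bochner_integral_interval01_FTC)
      (use t DERIV_minus_inverse in \<open>auto intro!: continuous_intros\<close>)
  then have int: "(\<integral>x. indicator {max t (1/2)<..<1} x * (1 / x\<^sup>2) \<partial>interval01) = 1 / max t (1/2) - 1"
    using has_bochner_integral_integral_eq by fastforce
  have "cesaro_adj wandering t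
      = (\<integral>x. complex_of_real (1 / (1 - t) * (indicator {max t (1/2)<..<1} x * (1 / x\<^sup>2))) \<partial>interval01)"
    unfolding cesaro_adj_def using t
    by (intro Bochner_Integration.integral_cong refl)
      (auto simp: cesaro_kernel_def half_power_def half_inverse_def indicator_def power2_eq_square)
  also have "\<dots> = complex_of_real (1 / (1 - t) * (1 / max t (1/2) - 1))"
    unfolding integral_complex_of_real integral_mult_right_zero int ..
  finally show ?thesis by simp
qed

text \<open>At \<open>t = 1/2\<close> the second formula fails; it is used almost everywhere.\<close>

lemma cesaro_unshift_wandering:
  assumes t: "0 < t" "t < 1"
  shows "1/2 < t \<Longrightarrow> cesaro_unshift wandering t = 0"
    and "t < 1/2 \<Longrightarrow> cesaro_unshift wandering t = wandering (1 - t)"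
proof -
  have "1 / t - 1 = (1 - t) / t" using t by (simp add: field_simps)
  then show "1/2 < t \<Longrightarrow> cesaro_unshift wandering t = 0"
    using t by (simp add: cesaro_unshift_def cesaro_adj_wandering half_power_def half_inverse_def max_def
        del: of_real_diff)
  show "t < 1/2 \<Longrightarrow> cesaro_unshift wandering t = wandering (1 - t)"
    using t by (simp add: cesaro_unshift_def cesaro_adj_wandering half_power_def half_inverse_def max_def)
qed

lemma l2_inner_wandering: "l2_inner interval01 wandering wandering = 1"
proof -
  have "has_bochner_integral interval01 (\<lambda>x. indicator {1/2<..<1} x * (1 / x\<^sup>2)) (- (1 / 1) - - (1 / (1/2)))"
    by (rule has_bochner_integral_interval01_FTC)
      (use DERIV_minus_inverse in \<open>auto intro!: continuous_intros\<close>)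
  then have int: "(\<integral>x. indicator {1/2<..<1} x * (1 / x\<^sup>2) \<partial>interval01) = (1 :: real)"
    using has_bochner_integral_integral_eq by fastforce
  have "l2_inner interval01 wandering wandering
      = (\<integral>x. complex_of_real (indicator {1/2<..<1} x * (1 / x\<^sup>2)) \<partial>interval01)"
    unfolding l2_inner_def
    by (intro Bochner_Integration.integral_cong refl)
      (auto simp: half_power_def half_inverse_def indicator_def power2_eq_square)
  then show ?thesis unfolding integral_complex_of_real int by simp
qed

lemma cesaro_shift_support:
  assumes "\<And>x. x \<le> 1/2 \<Longrightarrow> f x = 0" "x \<le> 1/2"
  shows "cesaro_shift f x = 0"
proof -
  have "complex_of_real (cesaro_kernel x t) * f t = 0" for t
    using assms by (cases "t \<le> 1/2") (auto simp: cesaro_kernel_def)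
  then have "cesaro_op f x = 0" unfolding cesaro_op_def by (simp only: Bochner_Integration.integral_zero)
  then show ?thesis using assms by (simp add: cesaro_shift_def)
qed

lemma cesaro_shift_pow_wandering_support:
  "x \<le> 1/2 \<Longrightarrow> (cesaro_shift ^^ n) wandering x = 0"
proof (induction n arbitrary: x)
  case 0
  then show ?case by (simp add: half_power_def half_inverse_def)
next
  case (Suc n)
  then show ?case using cesaro_shift_support[of "(cesaro_shift ^^ n) wandering"] by simp
qed

text \<open>After one factor is moved to the right, the supports of the two functions are disjoint.\<close>

lemma wandering_orthogonal: "l2_inner interval01 ((cesaro_shift ^^ Suc n) wandering) wandering = 0"
proof -
  let ?g = "(cesaro_shift ^^ n) wandering"
  have g: "?g \<in> square_integrable interval01"
    by (intro square_integrable_cesaro_shift_pow square_integrable_half_power)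
  have "l2_inner interval01 ((cesaro_shift ^^ Suc n) wandering) wandering
      = l2_inner interval01 ?g (cesaro_unshift wandering)"
    using cesaro_shift_adjoint[OF g square_integrable_half_power] by simp
  also have "\<dots> = (\<integral>x. 0 \<partial>interval01)"
    unfolding l2_inner_def
  proof (rule Bochner_Integration.integral_cong[OF refl])
    fix x assume "x \<in> space interval01"
    then show "?g x * cnj (cesaro_unshift wandering x) = 0"
      using cesaro_shift_pow_wandering_support[of x n] cesaro_unshift_wandering(1)[of x]
      by (cases "x \<le> 1/2") auto
  qed
  finally show ?thesis by simp
qed

definition cesaro_basis :: "int \<Rightarrow> real \<Rightarrow> complex" where
  "cesaro_basis n = (if 0 \<le> n then (cesaro_shift ^^ nat n) wandering else (cesaro_unshift ^^ nat (- n)) wandering)"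

lemma square_integrable_cesaro_basis: "cesaro_basis n \<in> square_integrable interval01"
  by (simp add: cesaro_basis_def square_integrable_cesaro_shift_pow square_integrable_cesaro_unshift_pow
      square_integrable_half_power)

lemma cesaro_unshift_basis:
  assumes x: "0 < x" "x < 1"
  shows "cesaro_unshift (cesaro_basis n) x = cesaro_basis (n - 1) x"
proof (cases "0 < n")
  case True
  then have n: "nat n = Suc (nat (n - 1))" by simp
  show ?thesis
    using True cesaro_unshift_shift[OF square_integrable_cesaro_shift_pow[OF square_integrable_half_power] x]
    unfolding cesaro_basis_def n by simp
next
  case False
  then have n: "nat (- (n - 1)) = Suc (nat (- n))" by simp
  show ?thesis using False unfolding cesaro_basis_def n by (auto simp: le_less)
qed

lemma l2_inner_cesaro_basis_shift:
  "l2_inner interval01 (cesaro_basis (m - int k)) (cesaro_basis (n - int k))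
    = l2_inner interval01 (cesaro_basis m) (cesaro_basis n)"
proof (induction k)
  case (Suc k)
  let ?a = "cesaro_basis (m - int k)" and ?b = "cesaro_basis (n - int k)"
  have "l2_inner interval01 (cesaro_basis (m - int (Suc k))) (cesaro_basis (n - int (Suc k)))
      = l2_inner interval01 (cesaro_unshift ?a) (cesaro_unshift ?b)"
  proof (rule l2_inner_cong_AE)
    have s: "m - int (Suc k) = m - int k - 1" "n - int (Suc k) = n - int k - 1" by simp_all
    show "AE x in interval01. cesaro_basis (m - int (Suc k)) x = cesaro_unshift ?a x"
      "AE x in interval01. cesaro_basis (n - int (Suc k)) x = cesaro_unshift ?b x"
      unfolding s by (intro AE_interval01I; simp add: cesaro_unshift_basis)+
  qed (intro square_integrable_cesaro_unshift square_integrable_cesaro_basis)+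
  then show ?case
    using Suc by (simp add: l2_inner_cesaro_unshift square_integrable_cesaro_basis)
qed simp

text \<open>The inner products of the translates depend on the difference of the indices only, so orthonormality reduces
to inner products with the wandering vector.\<close>

lemma l2_inner_cesaro_basis_diff:
  "l2_inner interval01 (cesaro_basis m) (cesaro_basis n)
    = l2_inner interval01 (cesaro_basis (m - n)) (cesaro_basis 0)"
proof (cases "0 \<le> n")
  case True
  then show ?thesis using l2_inner_cesaro_basis_shift[of m "nat n" n] by simp
next
  case False
  then show ?thesis using l2_inner_cesaro_basis_shift[of "m - n" "nat (- n)" 0] by simp
qed

lemma orthonormal_cesaro_basis: "orthonormal interval01 cesaro_basis"
proof -
  have pos: "l2_inner interval01 (cesaro_basis m) (cesaro_basis n) = 0" if "n < m" for m n
  proof -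
    have "nat (m - n) = Suc (nat (m - n - 1))" using that by simp
    then show ?thesis
      using that wandering_orthogonal[of "nat (m - n - 1)"]
      by (subst l2_inner_cesaro_basis_diff) (simp add: cesaro_basis_def)
  qed
  have "l2_inner interval01 (cesaro_basis m) (cesaro_basis n) = (if m = n then 1 else 0)" for m n
  proof (cases m n rule: linorder_cases)
    case less
    then show ?thesis using pos[OF less] l2_inner_commute[of interval01 "cesaro_basis m" "cesaro_basis n"] by simp
  next
    case equal
    then show ?thesis by (subst l2_inner_cesaro_basis_diff) (simp add: cesaro_basis_def l2_inner_wandering)
  next
    case greater
    then show ?thesis using pos[OF greater] by simp
  qed
  then show ?thesis by (simp add: orthonormal_def square_integrable_cesaro_basis)
qed

section \<open>Completeness of the translates\<close>

text \<open>With \<open>q(t) = (1 - t) / t\<close> and \<open>q' = - 1 / t\<^sup>2\<close>, the integrand \<open>q\<^sup>k / (t (1 - t)) = q\<^sup>k\<^sup>-\<^sup>1 / t\<^sup>2\<close> has the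
antiderivative \<open>- q\<^sup>k / k\<close>, and \<open>q(1/2) = 1\<close>.\<close>

lemma cesaro_op_half_power:
  assumes x: "0 < x" "x < 1" and k: "k > 0"
  shows "of_nat k * cesaro_op (half_power k) x = wandering x - half_power k x"
proof (cases "1/2 < x")
  case False
  then have "complex_of_real (cesaro_kernel x t) * half_power k t = 0" for t
    by (cases "1/2 < t") (auto simp: cesaro_kernel_def half_power_def half_inverse_def)
  then have "cesaro_op (half_power k) x = 0"
    unfolding cesaro_op_def by (simp only: Bochner_Integration.integral_zero)
  then show ?thesis using False by (simp add: half_power_def half_inverse_def)
next
  case True
  define F where "F t = - (((1 - t) / t) ^ k)" for t :: real
  define f where "f t = real k * (((1 - t) / t) ^ (k - 1) * (1 / t\<^sup>2))" for t :: real
  have has_int: "has_bochner_integral interval01 (\<lambda>t. indicator {1/2<..<x} t * f t) (F x - F (1/2))"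
  proof (rule has_bochner_integral_interval01_FTC)
    fix t assume "1/2 \<le> t" "t \<le> x"
    then have t: "t \<noteq> 0" by simp
    then have "((\<lambda>t. (1 - t) / t) has_real_derivative - (1 / t\<^sup>2)) (at t)"
      by (auto intro!: derivative_eq_intros simp: power2_eq_square field_simps)
    from DERIV_minus[OF DERIV_power[OF this, of k]]
    show "(F has_real_derivative f t) (at t)"
      by (simp add: F_def[abs_def] f_def mult_ac)
  next
    show "continuous_on {1/2..x} f" unfolding f_def by (intro continuous_intros) auto
  qed (use x True in auto)
  then have int: "(\<integral>t. indicator {1/2<..<x} t * f t \<partial>interval01) = 1 - half_ratio x ^ k"
    using has_bochner_integral_integral_eq[OF has_int] True by (simp add: F_def half_ratio_def)
  have "of_nat k * cesaro_op (half_power k) x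
      = (\<integral>t. of_nat k * (complex_of_real (cesaro_kernel x t) * half_power k t) \<partial>interval01)"
    unfolding cesaro_op_def by (rule integral_mult_right_zero[symmetric])
  also have "\<dots> = (\<integral>t. complex_of_real (1 / x * (indicator {1/2<..<x} t * f t)) \<partial>interval01)"
  proof (rule Bochner_Integration.integral_cong[OF refl])
    fix t assume t: "t \<in> space interval01"
    have "real k * (cesaro_kernel x t * (half_ratio t ^ k * half_inverse t))
        = 1 / x * (indicator {1/2<..<x} t * f t)"
    proof (cases "1/2 < t \<and> t < x")
      case True
      have "half_ratio t ^ k = (1 - t) / t * ((1 - t) / t) ^ (k - 1)"
        using True k by (cases k) (simp_all add: half_ratio_def)
      then show ?thesis
        using True t x by (simp add: cesaro_kernel_def half_inverse_def f_def power2_eq_square)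
    next
      case False
      then show ?thesis by (auto simp: cesaro_kernel_def half_inverse_def)
    qed
    from arg_cong[OF this, of complex_of_real]
    show "of_nat k * (complex_of_real (cesaro_kernel x t) * half_power k t)
        = complex_of_real (1 / x * (indicator {1/2<..<x} t * f t))"
      by (simp only: half_power_def of_real_mult of_real_of_nat_eq)
  qed
  also have "\<dots> = complex_of_real (1 / x * (1 - half_ratio x ^ k))"
    unfolding integral_complex_of_real integral_mult_right_zero int ..
  also have "\<dots> = wandering x - half_power k x"
    using True by (simp add: half_power_def half_inverse_def diff_divide_distrib)
  finally show ?thesis .
qed

text \<open>For \<open>k \<ge> 1\<close>, \<open>cesaro_op_half_power\<close> gives \<open>w = k U g\<^sub>k + (k + 1) g\<^sub>k\<close>.  Hence the numbers \<open>c n = \<langle>g\<^sub>k, (U\<^sup>*)\<^sup>n f\<rangle>\<close> grow in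
modulus by the factor \<open>(k + 1) / k > 1\<close> at each step, while the Cauchy-Schwarz inequality bounds them
because \<open>U\<^sup>*\<close> is an isometry.\<close>

lemma l2_inner_half_power_zero:
  assumes f: "f \<in> square_integrable interval01"
    and zero: "\<And>n. l2_inner interval01 ((cesaro_shift ^^ n) wandering) f = 0"
  shows "l2_inner interval01 (half_power k) f = 0"
proof (cases "k = 0")
  case True
  then show ?thesis using zero[of 0] by simp
next
  case False
  then have k: "k > 0" by simp
  define v where "v n = (cesaro_unshift ^^ n) f" for n
  have v: "v n \<in> square_integrable interval01" for n
    unfolding v_def by (intro square_integrable_cesaro_unshift_pow f)
  have adj: "l2_inner interval01 ((cesaro_shift ^^ n) g) h = l2_inner interval01 g ((cesaro_unshift ^^ n) h)"
    if g: "g \<in> square_integrable interval01" and h: "h \<in> square_integrable interval01" for n g h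
    using h
  proof (induction n arbitrary: h)
    case (Suc n)
    have "l2_inner interval01 ((cesaro_shift ^^ Suc n) g) h
        = l2_inner interval01 ((cesaro_shift ^^ n) g) (cesaro_unshift h)"
      using cesaro_shift_adjoint[OF square_integrable_cesaro_shift_pow[OF g] Suc.prems] by simp
    also have "\<dots> = l2_inner interval01 g ((cesaro_unshift ^^ n) (cesaro_unshift h))"
      by (intro Suc.IH square_integrable_cesaro_unshift Suc.prems)
    finally show ?case by (simp add: funpow_swap1)
  qed simp
  have norm_v: "l2_normsq interval01 (v n) = l2_normsq interval01 f" for n
  proof (induction n)
    case (Suc n)
    have "v (Suc n) = cesaro_unshift (v n)" by (simp add: v_def)
    then show ?case using Suc l2_inner_cesaro_unshift[OF v v] by (simp add: l2_normsq_eq_inner)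
  qed (simp add: v_def)
  define c where "c n = l2_inner interval01 (half_power k) (v n)" for n
  have rec: "of_nat k * c (Suc n) = - (of_nat (Suc k) * c n)" for n
  proof -
    have "0 = l2_inner interval01 wandering (v n)"
      using zero[of n] adj[OF square_integrable_half_power f] by (simp add: v_def)
    also have "\<dots> = l2_inner interval01 (\<lambda>x. of_nat k * cesaro_shift (half_power k) x + of_nat (Suc k) * half_power k x) (v n)"
    proof (rule l2_inner_cong_AE)
      show "AE x in interval01. wandering x = of_nat k * cesaro_shift (half_power k) x + of_nat (Suc k) * half_power k x"
      proof (rule AE_interval01I)
        fix x :: real assume "0 < x" "x < 1"
        from cesaro_op_half_power[OF this k]
        show "wandering x = of_nat k * cesaro_shift (half_power k) x + of_nat (Suc k) * half_power k x"
          by (simp add: cesaro_shift_def algebra_simps)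
      qed
    qed (intro square_integrable_add square_integrable_scale square_integrable_cesaro_shift
        square_integrable_half_power v AE_I2 refl)+
    also have "\<dots> = of_nat k * l2_inner interval01 (cesaro_shift (half_power k)) (v n) + of_nat (Suc k) * c n"
      unfolding c_def
      by (simp only: l2_inner_add_left l2_inner_scale_left square_integrable_scale square_integrable_cesaro_shift
        square_integrable_half_power v)
    also have "l2_inner interval01 (cesaro_shift (half_power k)) (v n) = c (Suc n)"
      unfolding c_def by (simp add: cesaro_shift_adjoint square_integrable_half_power v) (simp add: v_def)
    finally show ?thesis by (simp add: eq_neg_iff_add_eq_0)
  qed
  define q where "q = real (Suc k) / real k"
  have q: "q > 1" using k by (simp add: q_def)
  have step: "cmod (c (Suc n)) = q * cmod (c n)" for n
  proof -
    have "real k * cmod (c (Suc n)) = real (Suc k) * cmod (c n)"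
      using arg_cong[OF rec[of n], of cmod] by (simp only: norm_mult norm_of_nat norm_minus_cancel)
    then show ?thesis using k by (simp add: q_def field_simps)
  qed
  have growth: "cmod (c n) = q ^ n * cmod (c 0)" for n
  proof (induction n)
    case (Suc n)
    show ?case unfolding step Suc by simp
  qed simp
  define b where "b = l2_normsq interval01 (half_power k) * l2_normsq interval01 f"
  have bound: "(cmod (c n))\<^sup>2 \<le> b" for n
    using l2_Cauchy_Schwarz[OF square_integrable_half_power v, of k n] by (simp add: c_def b_def norm_v)
  have "cmod (c 0) = 0"
  proof (rule ccontr)
    assume ne: "cmod (c 0) \<noteq> 0"
    obtain n where n: "(b + 1) / cmod (c 0) < q ^ n" using real_arch_pow[OF q] by blast
    then have "b + 1 < q ^ n * cmod (c 0)" using ne by (simp add: divide_less_eq)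
    then have "b + 1 < cmod (c n)" using growth[of n] by linarith
    moreover have "b \<ge> 0" by (simp add: b_def)
    ultimately have "b + 1 < (cmod (c n))\<^sup>2"
      using self_le_power[of "cmod (c n)" 2] by simp
    then show False using bound[of n] by simp
  qed
  then show ?thesis by (simp add: c_def v_def)
qed

lemma sets_interval01_AE_borel:
  assumes "A \<in> sets interval01"
  obtains S where "S \<in> sets borel" "AE x in interval01. x \<in> A \<longleftrightarrow> x \<in> S"
proof -
  have "A \<in> sets lebesgue" using assms by (auto simp: interval01_def sets_restrict_space)
  then obtain S N N' where A: "A = S \<union> N" "N \<subseteq> N'" "N' \<in> null_sets lborel" "S \<in> sets lborel"
    by (rule sets_completionE)
  have "AE x in lborel. x \<notin> N'" by (rule AE_not_in[OF A(3)])
  then have "AE x in lebesgue. x \<notin> N'" by (rule AE_completion)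
  then have "AE x in interval01. x \<notin> N'"
    unfolding interval01_def by (subst AE_restrict_space_iff) auto
  then have "AE x in interval01. x \<in> A \<longleftrightarrow> x \<in> S"
    by eventually_elim (use A in auto)
  then show ?thesis using A(4) by (intro that[of S]) auto
qed

text \<open>On the upper half the ratio \<open>(1 - x) / x\<close> is an injective coordinate with values in a compact interval, and
\<open>l2_inner_half_power_zero\<close> says that all moments of \<open>w * cnj f\<close> in this coordinate vanish.\<close>

lemma zero_on_upper_half:
  assumes f: "f \<in> square_integrable interval01"
    and zero: "\<And>n. l2_inner interval01 ((cesaro_shift ^^ n) wandering) f = 0"
  shows "AE x in interval01. 1/2 < x \<longrightarrow> f x = 0"
proof -
  note [measurable] = square_integrable_measurable[OF f]
  define G where "G x = wandering x * cnj (f x)" for x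
  have G: "integrable interval01 G"
    unfolding G_def by (rule integrable_l2_inner[OF square_integrable_half_power f])
  have mom: "(\<integral>x. half_ratio x ^ k *\<^sub>R G x \<partial>interval01) = 0" for k
    using l2_inner_half_power_zero[OF f zero, of k]
    by (simp add: l2_inner_def G_def half_power_def scaleR_conv_of_real mult.assoc)
  have intk: "integrable interval01 (\<lambda>x. half_ratio x ^ k *\<^sub>R G x)" for k
    using integrable_l2_inner[OF square_integrable_half_power f, of k]
    by (simp add: G_def half_power_def scaleR_conv_of_real mult.assoc)
  have poly: "(\<integral>x. p (half_ratio x) *\<^sub>R G x \<partial>interval01) = 0" if p: "real_polynomial_function p" for p
  proof -
    obtain a n where "p = (\<lambda>x. \<Sum>i\<le>n. a i * x ^ i)" using p unfolding real_polynomial_function_iff_sum by blast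
    then have "(\<integral>x. p (half_ratio x) *\<^sub>R G x \<partial>interval01)
        = (\<integral>x. (\<Sum>i\<le>n. a i *\<^sub>R (half_ratio x ^ i *\<^sub>R G x)) \<partial>interval01)"
      by (simp add: scaleR_sum_left)
    also have "\<dots> = (\<Sum>i\<le>n. \<integral>x. a i *\<^sub>R (half_ratio x ^ i *\<^sub>R G x) \<partial>interval01)"
      by (intro Bochner_Integration.integral_sum integrable_scaleR_right intk)
    also have "\<dots> = 0" by (simp only: integral_scaleR_right mom) simp
    finally show ?thesis .
  qed
  have zeroB: "(\<integral>x. indicator B (half_ratio x) *\<^sub>R G x \<partial>interval01) = 0" if "B \<in> sets borel" for B
    by (rule integral_set_zero_of_moments[of _ _ _ "{0..1}", OF G half_ratio_measurable _ _ poly that])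
      (use half_ratio_bounds in auto)
  have "AE x in interval01. G x = 0"
  proof (rule interval01.density_unique_banach[OF G])
    show "integrable interval01 (\<lambda>x. 0 :: complex)" by simp
    fix A assume A: "A \<in> sets interval01"
    then obtain S where S: "S \<in> sets borel" and AS: "AE x in interval01. x \<in> A \<longleftrightarrow> x \<in> S"
      by (rule sets_interval01_AE_borel)
    \<comment> \<open>\<open>y \<mapsto> 1 / (1 + y)\<close> recovers a point of the upper half from its ratio.\<close>
    define B where "B = (\<lambda>y::real. 1 / (1 + y)) -` S"
    have "(\<lambda>y::real. 1 / (1 + y)) \<in> borel_measurable borel" by measurable
    from measurable_sets[OF this S] have B: "B \<in> sets borel" by (simp add: B_def)
    have "(LINT x:A|interval01. G x) = (\<integral>x. indicator B (half_ratio x) *\<^sub>R G x \<partial>interval01)"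
      unfolding set_lebesgue_integral_def
    proof (rule integral_cong_AE)
      note [measurable] = A B borel_measurable_integrable[OF G]
      show "(\<lambda>x. indicator A x *\<^sub>R G x) \<in> borel_measurable interval01"
        "(\<lambda>x. indicator B (half_ratio x) *\<^sub>R G x) \<in> borel_measurable interval01"
        by measurable
      show "AE x in interval01. indicator A x *\<^sub>R G x = indicator B (half_ratio x) *\<^sub>R G x"
        using AS
      proof eventually_elim
        case (elim x)
        show ?case
        proof (cases "1/2 < x")
          case True
          then have "1 / (1 + half_ratio x) = x" by (simp add: half_ratio_def field_simps)
          then show ?thesis using elim by (simp add: B_def indicator_def)
        next
          case False
          then show ?thesis by (simp add: G_def half_power_def half_inverse_def)
        qed
      qed
    qed
    then show "(LINT x:A|interval01. G x) = (LINT x:A|interval01. 0)"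
      using zeroB[OF B] by (simp add: set_lebesgue_integral_def)
  qed
  then show ?thesis
    by eventually_elim (auto simp: G_def half_power_def half_inverse_def)
qed

lemma orthonormal_basis_cesaro_basis: "orthonormal_basis interval01 cesaro_basis"
  unfolding orthonormal_basis_def
proof (intro conjI ballI impI orthonormal_cesaro_basis)
  fix f assume f: "f \<in> square_integrable interval01"
    and zero: "\<forall>n. l2_inner interval01 f (cesaro_basis n) = 0"
  have zero': "l2_inner interval01 (cesaro_basis n) f = 0" for n
    using zero by (subst l2_inner_commute) simp
  note [measurable] = square_integrable_measurable[OF f]
  have upper: "AE x in interval01. 1/2 < x \<longrightarrow> f x = 0"
  proof (rule zero_on_upper_half[OF f])
    fix n show "l2_inner interval01 ((cesaro_shift ^^ n) wandering) f = 0"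
      using zero'[of "int n"] by (simp add: cesaro_basis_def)
  qed
  let ?w = "\<lambda>x. wandering (1 - x)"
  have w: "?w \<in> square_integrable interval01"
    by (intro square_integrable_reflect square_integrable_half_power)
  have pow: "AE x in interval01. (cesaro_unshift ^^ n) ?w x = cesaro_basis (- int (Suc n)) x" for n
  proof (induction n)
    case 0
    have "AE x in interval01. wandering (1 - x) = cesaro_unshift wandering x"
      using AE_interval01_neq[of "1/2"] AE_space
    proof eventually_elim
      case (elim x)
      then show ?case
        using cesaro_unshift_wandering[of x] by (cases "x < 1/2") (auto simp: half_power_def half_inverse_def)
    qed
    then show ?case by (simp add: cesaro_basis_def)
  next
    case (Suc n)
    have "AE x in interval01. cesaro_unshift ((cesaro_unshift ^^ n) ?w) x = cesaro_unshift (cesaro_basis (- int (Suc n))) x"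
      by (rule cesaro_unshift_cong_AE[OF square_integrable_cesaro_unshift_pow[OF w] square_integrable_cesaro_basis Suc])
    moreover have "AE x in interval01. cesaro_unshift (cesaro_basis (- int (Suc n))) x = cesaro_basis (- int (Suc (Suc n))) x"
    proof -
      have s: "- int (Suc (Suc n)) = - int (Suc n) - 1" by simp
      show ?thesis unfolding s by (rule AE_interval01I) (rule cesaro_unshift_basis)
    qed
    ultimately show ?case by eventually_elim simp
  qed
  have f': "(\<lambda>x. f (1 - x)) \<in> square_integrable interval01" by (rule square_integrable_reflect[OF f])
  have "AE x in interval01. 1/2 < x \<longrightarrow> f (1 - x) = 0"
  proof (rule zero_on_upper_half[OF f'])
    fix n
    let ?g = "(cesaro_shift ^^ n) wandering"
    have g: "?g \<in> square_integrable interval01"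
      by (intro square_integrable_cesaro_shift_pow square_integrable_half_power)
    have "l2_inner interval01 ?g (\<lambda>x. f (1 - x))
        = l2_inner interval01 (\<lambda>x. ?g (1 - x)) (\<lambda>x. f (1 - (1 - x)))"
      by (rule l2_inner_reflect[symmetric]) (intro square_integrable_measurable g f')+
    also have "\<dots> = l2_inner interval01 ((cesaro_unshift ^^ n) ?w) f"
      by (simp add: reflect_cesaro_shift_pow square_integrable_half_power)
    also have "\<dots> = l2_inner interval01 (cesaro_basis (- int (Suc n))) f"
      by (rule l2_inner_cong_AE)
        (use pow[of n] in \<open>auto intro: square_integrable_cesaro_unshift_pow w square_integrable_cesaro_basis f\<close>)
    finally show "l2_inner interval01 ?g (\<lambda>x. f (1 - x)) = 0" using zero' by simp
  qed
  then have "AE x in distr interval01 interval01 (\<lambda>x. 1 - x). 1/2 < x \<longrightarrow> f (1 - x) = 0"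
    unfolding distr_reflect .
  from AE_distrD[OF measurable_reflect this]
  have "AE x in interval01. 1/2 < 1 - x \<longrightarrow> f x = 0" by simp
  with upper AE_interval01_neq[of "1/2"] show "AE x in interval01. f x = 0"
    by eventually_elim (auto simp: not_less)
qed

section \<open>The unitary equivalence\<close>

lemma AE_cesaro_fun: "AE x in interval01. cesaro_fun f x = cesaro_op f x"
  by (rule AE_interval01I) (rule cesaro_fun_eq_cesaro_op)

lemma square_integrable_cesaro_fun:
  assumes "f \<in> square_integrable interval01"
  shows "cesaro_fun f \<in> square_integrable interval01" "l2_normsq interval01 (cesaro_fun f) \<le> 2\<^sup>2 * l2_normsq interval01 f"
proof -
  have eq: "cesaro_fun f x = cesaro_op f x" if "x \<in> space interval01" for x
    using that by (simp add: cesaro_fun_eq_cesaro_op)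
  have "cesaro_fun f \<in> borel_measurable interval01 \<longleftrightarrow> cesaro_op f \<in> borel_measurable interval01"
    by (rule measurable_cong) (rule eq)
  moreover have "integrable interval01 (\<lambda>x. (cmod (cesaro_fun f x))\<^sup>2) \<longleftrightarrow> integrable interval01 (\<lambda>x. (cmod (cesaro_op f x))\<^sup>2)"
    by (rule Bochner_Integration.integrable_cong) (simp_all add: eq)
  ultimately show "cesaro_fun f \<in> square_integrable interval01"
    using square_integrable_cesaro_op[OF assms] by (simp add: square_integrable_def)
  have "l2_normsq interval01 (cesaro_fun f) = l2_normsq interval01 (cesaro_op f)"
    unfolding l2_normsq_def by (rule Bochner_Integration.integral_cong) (simp_all add: eq)
  then show "l2_normsq interval01 (cesaro_fun f) \<le> 2\<^sup>2 * l2_normsq interval01 f"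
    using l2_normsq_cesaro_op_le[OF assms] by simp
qed

lemma cesaro_fun_respects_AE:
  assumes "f \<in> square_integrable interval01" "g \<in> square_integrable interval01" "AE x in interval01. f x = g x"
  shows "AE x in interval01. cesaro_fun f x = cesaro_fun g x"
  by (rule AE_interval01I)
    (rule cesaro_fun_cong_AE[folded interval01_def], use assms in \<open>auto simp: square_integrable_def\<close>)

lemma cesaro_ae_class:
  assumes "f \<in> square_integrable interval01"
  shows "cesaro (ae_class interval01 f) = ae_class interval01 (cesaro_op f)"
proof -
  have "cesaro (ae_class interval01 f) = ae_class interval01 (cesaro_fun f)"
    unfolding cesaro_def interval01_def[symmetric]
    by (rule L2_lift_ae_class[OF assms square_integrable_cesaro_fun(1) cesaro_fun_respects_AE])
  also have "\<dots> = ae_class interval01 (cesaro_op f)"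
    by (intro ae_class_eqI square_integrable_cesaro_fun square_integrable_cesaro_op assms AE_cesaro_fun)
  finally show ?thesis .
qed

lemma bounded_operator_cesaro: "bounded_operator (L2 interval01) cesaro"
  unfolding cesaro_def interval01_def[symmetric]
proof (rule bounded_operator_L2_lift[where B = 2])
  show "AE x in interval01. cesaro_fun (\<lambda>x. f x + g x) x = cesaro_fun f x + cesaro_fun g x"
    if "f \<in> square_integrable interval01" "g \<in> square_integrable interval01" for f g
    using that by (intro AE_interval01I) (simp add: cesaro_fun_eq_cesaro_op cesaro_op_add)
  show "AE x in interval01. cesaro_fun (\<lambda>x. c * f x) x = c * cesaro_fun f x"
    if "f \<in> square_integrable interval01" for c f
    by (intro AE_interval01I) (simp add: cesaro_fun_eq_cesaro_op cesaro_op_scale)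
qed (intro square_integrable_cesaro_fun cesaro_fun_respects_AE zero_le_numeral; assumption)+

text \<open>The same rule as in \<open>l2_inner_mult_z_mu_basis\<close>, from \<open>C\<^sup>* = 1 + U\<^sup>*\<close>.\<close>

lemma l2_inner_cesaro_op_basis:
  assumes f: "f \<in> square_integrable interval01"
  shows "l2_inner interval01 (cesaro_op f) (cesaro_basis n)
    = l2_inner interval01 f (cesaro_basis n) + l2_inner interval01 f (cesaro_basis (n - 1))"
proof -
  note sq = square_integrable_cesaro_basis
  have "l2_inner interval01 (cesaro_op f) (cesaro_basis n) = l2_inner interval01 f (cesaro_adj (cesaro_basis n))"
    by (rule cesaro_adjoint[OF f sq])
  also have "\<dots> = l2_inner interval01 f (\<lambda>x. cesaro_basis n x + cesaro_basis (n - 1) x)"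
  proof (rule l2_inner_cong_AE)
    show "AE x in interval01. cesaro_adj (cesaro_basis n) x = cesaro_basis n x + cesaro_basis (n - 1) x"
    proof (rule AE_interval01I)
      fix x :: real assume "0 < x" "x < 1"
      from cesaro_unshift_basis[OF this, of n]
      show "cesaro_adj (cesaro_basis n) x = cesaro_basis n x + cesaro_basis (n - 1) x"
        by (simp add: cesaro_unshift_def algebra_simps)
    qed
  qed (auto intro: f square_integrable_cesaro_adj square_integrable_add sq)
  also have "\<dots> = l2_inner interval01 f (cesaro_basis n) + l2_inner interval01 f (cesaro_basis (n - 1))"
    by (rule l2_inner_add_right[OF sq sq f])
  finally show ?thesis .
qed

theorem theorem3p7:
  "unitarily_equivalent (L2 unit_interval_measure) cesaro (L2 mu) mult_z"
  unfolding interval01_def[symmetric]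
proof (rule unitarily_equivalent_of_bases[OF orthonormal_basis_cesaro_basis orthonormal_basis_mu_basis
      bounded_operator_cesaro bounded_operator_mult_z])
  show "cesaro_op f \<in> square_integrable interval01 \<and> cesaro (ae_class interval01 f) = ae_class interval01 (cesaro_op f)"
    if "f \<in> square_integrable interval01" for f
    using that by (simp add: square_integrable_cesaro_op cesaro_ae_class)
  show "(\<lambda>z. z * g z) \<in> square_integrable mu \<and> mult_z (ae_class mu g) = ae_class mu (\<lambda>z. z * g z)"
    if "g \<in> square_integrable mu" for g
    using that by (simp add: square_integrable_mult_z mult_z_ae_class)
  show "l2_inner interval01 (cesaro_op f) (cesaro_basis i) = l2_inner mu (\<lambda>z. z * g z) (mu_basis i)"
    if "f \<in> square_integrable interval01" "g \<in> square_integrable mu"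
      "\<And>i. l2_inner interval01 f (cesaro_basis i) = l2_inner mu g (mu_basis i)" for f g i
    using that by (simp add: l2_inner_cesaro_op_basis l2_inner_mult_z_mu_basis)
qed

end
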